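(* Let $G=G(\Gamma)$ be a tubular group. Then $G$ is isomorphic to a free by $\mathbb{Z}$ group if and only if there exists a homomorphism from $G$ to $\mathbb{Z}$ which is non zero on every edge group.
   Context: A tubular group $G=G(\Gamma)$ is the fundamental group of a graph of groups over a finite connected graph $\Gamma$ in which every vertex group is isomorphic to $\mathbb{Z}^2$ and every edge group is isomorphic to $\mathbb{Z}$. A homomorphism $\chi:G\to\mathbb{Z}$ is non zero on an edge group if its restriction to (the image in $G$ of) that edge group is not the zero homomorphism. A free by $\mathbb{Z}$ (or free by cyclic) group is a group of the form $F\rtimes_\alpha\mathbb{Z}$ where $F$ is a free group of finite rank and $\alpha$ is an automorphism of $F$. *)

theory Defs
  imports "HOL-Algebra.Elementary_Groups" "HOL-Algebra.Bij" "Graph_Theory.Digraph_Component"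
begin

section \<open>Groups given by generators and relators\<close>

text \<open>A letter \<open>(x, True)\<close> stands for the generator \<open>x\<close>, and \<open>(x, False)\<close> for its inverse.\<close>

type_synonym 'a word = "('a \<times> bool) list"

definition words :: "'a set \<Rightarrow> 'a word set" where
  "words X = lists (X \<times> UNIV)"

inductive word_eq :: "'a set \<Rightarrow> 'a word set \<Rightarrow> 'a word \<Rightarrow> 'a word \<Rightarrow> bool"
  for X :: "'a set" and R :: "'a word set" where
  refl: "w \<in> words X \<Longrightarrow> word_eq X R w w"
| sym: "word_eq X R u v \<Longrightarrow> word_eq X R v u"
| trans: "word_eq X R u v \<Longrightarrow> word_eq X R v w \<Longrightarrow> word_eq X R u w"
| cancel: "u @ [(x, b), (x, \<not> b)] @ v \<in> words X \<Longrightarrow>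
    word_eq X R (u @ [(x, b), (x, \<not> b)] @ v) (u @ v)"
| relator: "r \<in> R \<Longrightarrow> u @ r @ v \<in> words X \<Longrightarrow> word_eq X R (u @ r @ v) (u @ v)"

definition word_rel :: "'a set \<Rightarrow> 'a word set \<Rightarrow> 'a word rel" where
  "word_rel X R = {(u, v). word_eq X R u v}"

definition word_class :: "'a set \<Rightarrow> 'a word set \<Rightarrow> 'a word \<Rightarrow> 'a word set" where
  "word_class X R w = word_rel X R `` {w}"

definition presented_group :: "'a set \<Rightarrow> 'a word set \<Rightarrow> 'a word set monoid" where
  "presented_group X R =
    \<lparr>carrier = words X // word_rel X R,
     monoid.mult = (\<lambda>A B. \<Union>u\<in>A. \<Union>v\<in>B. word_class X R (u @ v)),
     one = word_class X R []\<rparr>"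

definition free_group :: "'a set \<Rightarrow> 'a word set monoid" where
  "free_group X = presented_group X {}"


section \<open>Free by cyclic groups\<close>

text \<open>The semidirect product of \<open>F\<close> and \<open>\<int>\<close>, where \<open>m\<close> acts on \<open>F\<close> as \<open>\<alpha>\<close> to the power \<open>m\<close>.\<close>

definition semidirect_int :: "'a monoid \<Rightarrow> ('a \<Rightarrow> 'a) \<Rightarrow> ('a \<times> int) monoid" where
  "semidirect_int F \<alpha> =
    \<lparr>carrier = carrier F \<times> UNIV,
     monoid.mult = (\<lambda>(f, m) (g, n). (f \<otimes>\<^bsub>F\<^esub> (\<alpha> [^]\<^bsub>AutoGroup F\<^esub> m) g, m + n)),
     one = (\<one>\<^bsub>F\<^esub>, 0)\<rparr>"

text \<open>Every free group \<open>F\<close> of finite rank is isomorphic to \<open>free_group {..<n}\<close> for some \<open>n\<close>,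
  which avoids an existential quantifier over the type of the elements of \<open>F\<close>.\<close>

definition free_by_cyclic :: "('a, 'b) monoid_scheme \<Rightarrow> bool" where
  "free_by_cyclic G \<longleftrightarrow>
    (\<exists>n::nat. \<exists>\<alpha> \<in> auto (free_group {..<n}). G \<cong> semidirect_int (free_group {..<n}) \<alpha>)"


section \<open>Graphs of groups\<close>

text \<open>The underlying graph may have loops and multiple edges. Each unoriented edge is represented
  by a single arc, whose orientation is arbitrary; connectedness does not depend on it.\<close>

record ('v, 'e, 'g, 'h) graph_of_groups =
  base_graph :: "('v, 'e) pre_digraph"
  vertex_group :: "'v \<Rightarrow> 'g monoid"
  edge_group :: "'e \<Rightarrow> 'h monoid"
  tail_map :: "'e \<Rightarrow> 'h \<Rightarrow> 'g"
  head_map :: "'e \<Rightarrow> 'h \<Rightarrow> 'g"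

locale connected_graph_of_groups =
  fixes \<G> :: "('v, 'e, 'g, 'h) graph_of_groups"
  assumes wf_base_graph: "wf_digraph (base_graph \<G>)"
    and connected_base_graph: "Digraph_Component.connected (base_graph \<G>)"
    and group_vertex_group: "v \<in> verts (base_graph \<G>) \<Longrightarrow> group (vertex_group \<G> v)"
    and group_edge_group: "e \<in> arcs (base_graph \<G>) \<Longrightarrow> group (edge_group \<G> e)"
    and tail_map_hom: "e \<in> arcs (base_graph \<G>) \<Longrightarrow>
      tail_map \<G> e \<in> hom (edge_group \<G> e) (vertex_group \<G> (tail (base_graph \<G>) e))"
    and tail_map_inj: "e \<in> arcs (base_graph \<G>) \<Longrightarrow>
      inj_on (tail_map \<G> e) (carrier (edge_group \<G> e))"
    and head_map_hom: "e \<in> arcs (base_graph \<G>) \<Longrightarrow>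
      head_map \<G> e \<in> hom (edge_group \<G> e) (vertex_group \<G> (head (base_graph \<G>) e))"
    and head_map_inj: "e \<in> arcs (base_graph \<G>) \<Longrightarrow>
      inj_on (head_map \<G> e) (carrier (edge_group \<G> e))"

locale tubular_graph_of_groups = connected_graph_of_groups +
  assumes finite_base_graph: "fin_digraph (base_graph \<G>)"
    and vertex_group_iso:
      "v \<in> verts (base_graph \<G>) \<Longrightarrow> vertex_group \<G> v \<cong> integer_group \<times>\<times> integer_group"
    and edge_group_iso: "e \<in> arcs (base_graph \<G>) \<Longrightarrow> edge_group \<G> e \<cong> integer_group"

text \<open>Trees are understood with orientations forgotten. The library predicate \<^const>\<open>tree\<close> is
  unsuitable: it excludes directed cycles only, so for instance two parallel arcs from \<open>u\<close> to \<open>v\<close>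
  would form a tree. A connected graph has no unoriented cycle (nor loop) iff deleting any of its
  edges disconnects it.\<close>

definition maximal_tree :: "('v, 'e) pre_digraph \<Rightarrow> ('v, 'e) pre_digraph \<Rightarrow> bool" where
  "maximal_tree T \<Gamma> \<longleftrightarrow> spanning T \<Gamma> \<and> Digraph_Component.connected T \<and>
    (\<forall>e\<in>arcs T. \<not> Digraph_Component.connected (pre_digraph.del_arc T e))"


section \<open>The fundamental group of a graph of groups\<close>

text \<open>The fundamental group relative to a maximal tree \<open>T\<close>: generated by the vertex groups and a
  stable letter for each edge, subject to the multiplication tables of the vertex groups, the
  relation \<open>t h t\<inverse> = g\<close> for the two images \<open>g\<close> (at the tail) and \<open>h\<close> (at the head) of each
  element of the group of an edge with stable letter \<open>t\<close>, and the triviality of the stable letters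
  of the edges of \<open>T\<close>. Up to isomorphism it does not depend on \<open>T\<close>.\<close>

datatype ('v, 'e, 'g) gen = Vertex_Elt 'v 'g | Stable_Letter 'e

definition gog_gens :: "('v, 'e, 'g, 'h) graph_of_groups \<Rightarrow> ('v, 'e, 'g) gen set" where
  "gog_gens \<G> =
    {Vertex_Elt v g | v g. v \<in> verts (base_graph \<G>) \<and> g \<in> carrier (vertex_group \<G> v)} \<union>
    {Stable_Letter e | e. e \<in> arcs (base_graph \<G>)}"

definition gog_relators ::
  "('v, 'e, 'g, 'h) graph_of_groups \<Rightarrow> ('v, 'e) pre_digraph \<Rightarrow> ('v, 'e, 'g) gen word set" where
  "gog_relators \<G> T =
    {[(Vertex_Elt v g, True), (Vertex_Elt v h, True),
      (Vertex_Elt v (g \<otimes>\<^bsub>vertex_group \<G> v\<^esub> h), False)] | v g h.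
        v \<in> verts (base_graph \<G>) \<and> g \<in> carrier (vertex_group \<G> v) \<and>
        h \<in> carrier (vertex_group \<G> v)} \<union>
    {[(Stable_Letter e, True),
      (Vertex_Elt (head (base_graph \<G>) e) (head_map \<G> e c), True),
      (Stable_Letter e, False),
      (Vertex_Elt (tail (base_graph \<G>) e) (tail_map \<G> e c), False)] | e c.
        e \<in> arcs (base_graph \<G>) \<and> c \<in> carrier (edge_group \<G> e)} \<union>
    {[(Stable_Letter e, True)] | e. e \<in> arcs T}"

definition fundamental_group ::
  "('v, 'e, 'g, 'h) graph_of_groups \<Rightarrow> ('v, 'e) pre_digraph \<Rightarrow>
   ('v, 'e, 'g) gen word set monoid" where
  "fundamental_group \<G> T = presented_group (gog_gens \<G>) (gog_relators \<G> T)"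

text \<open>The image of an edge group, embedded through its tail vertex. Embedding it through the head
  vertex gives a conjugate subgroup, so for the restriction of a homomorphism to an abelian group
  to be non zero the choice is irrelevant.\<close>

definition edge_group_image ::
  "('v, 'e, 'g, 'h) graph_of_groups \<Rightarrow> ('v, 'e) pre_digraph \<Rightarrow> 'e \<Rightarrow>
   ('v, 'e, 'g) gen word set set" where
  "edge_group_image \<G> T e =
    (\<lambda>c. word_class (gog_gens \<G>) (gog_relators \<G> T)
      [(Vertex_Elt (tail (base_graph \<G>) e) (tail_map \<G> e c), True)]) ` carrier (edge_group \<G> e)"

definition nonzero_on_edge_group ::
  "('v, 'e, 'g, 'h) graph_of_groups \<Rightarrow> ('v, 'e) pre_digraph \<Rightarrow>
   (('v, 'e, 'g) gen word set \<Rightarrow> int) \<Rightarrow> 'e \<Rightarrow> bool" where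
  "nonzero_on_edge_group \<G> T \<chi> e \<longleftrightarrow> (\<exists>x\<in>edge_group_image \<G> T e. \<chi> x \<noteq> 0)"

end

theory Submission
  imports Defs
begin

text \<open>
  If \<open>G\<close> is free by cyclic and the projection to \<open>\<int>\<close> vanishes on an edge group generated by \<open>c\<close>, take
  \<open>x\<close> and \<open>y\<close> in the two adjacent vertex groups, neither commensurable with \<open>c\<close>. Both commute
  with \<open>c\<close>, hence so does their commutator. It lies in the free kernel together with \<open>c\<close>, so the two
  satisfy a nontrivial relation \<open>[x, y]\<^sup>k = c\<^sup>l\<close>. An action of \<open>G\<close> on \<open>\<complex>\<close> refutes it: vertex groups act as
  the translations by Gaussian integers (up to conjugation along the tree), stable letters act by
  multiplication with the ratio of the two edge translations, except that of the given edge, which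
  is twisted by the cubic shear \<open>z \<mapsto> z + (Im z)\<^sup>3\<close>. Then \<open>[x, y]\<close>
  acts as a nontrivial shear and \<open>c\<close> as a translation, and these satisfy no such relation.

  Conversely, the kernel of a surjective \<open>\<chi>\<close> that is nonzero on all edge groups is the fundamental
  group of a finite graph of groups with trivial edge groups and infinite cyclic vertex groups, hence
  free of finite rank. Concretely, elements read off from a maximal tree of this finite
  graph define a homomorphism from a free group to \<open>G\<close>, and a homomorphism from \<open>G\<close> to the wreath
  product of the free group with \<open>\<int>\<close> provides the inverse on the kernel.
\<close>

section \<open>Presented groups\<close>

text \<open>Normal forms for graphs of groups would show that \<open>[x, y]\<close> and
  \<open>c\<close> are independent, and Bass-Serre theory would show that the kernel is free.
  Explicit homomorphisms replace both, built from the universal property of the presentation of G.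
  The action lives on \<complex> because multiplication carries any nonzero Gaussian integer to any
  other, so the edge translations have to satisfy no condition. In a coordinate where the edge
  translation is by 1, the twist may add any real function of \<open>Im z\<close> and still commute
  with it; the commutator then sees the second difference of that function. For a square it is
  constant, and the commutator would act as a power of \<open>c\<close>. For a cube it is linear and
  not constant, which yields the shear. In the converse, a homomorphism on the kernel of \<chi>
  cannot be read off from a presentation of G. A homomorphism from G to a wreath product that lifts
  \<chi> can, and its value at one fixed level is multiplicative on the kernel.\<close>

lemma words_simps [simp]:
  "[] \<in> words X"
  "l # w \<in> words X \<longleftrightarrow> fst l \<in> X \<and> w \<in> words X"
  "u @ v \<in> words X \<longleftrightarrow> u \<in> words X \<and> v \<in> words X"
  by (auto simp: words_def mem_Times_iff)

lemma word_eq_in_words: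
  assumes "word_eq X R u v"
  shows "u \<in> words X" "v \<in> words X"
  using assms by (induction rule: word_eq.induct) auto

lemma word_eq_context:
  assumes "word_eq X R u v" "a \<in> words X" "b \<in> words X"
  shows "word_eq X R (a @ u @ b) (a @ v @ b)"
  using assms
proof (induction rule: word_eq.induct)
  case (refl w)
  then show ?case by (intro word_eq.refl) auto
next
  case (sym u v)
  then show ?case by (auto intro: word_eq.sym)
next
  case (trans u v w)
  then show ?case by (auto intro: word_eq.trans)
next
  case (cancel u x c v)
  then show ?case
    using word_eq.cancel[of "a @ u" x c "v @ b" X R] by auto
next
  case (relator r u v)
  then show ?case
    using word_eq.relator[of r R "a @ u" "v @ b" X] by auto
qed

lemma word_eq_append:
  assumes "word_eq X R u u'" "word_eq X R v v'"
  shows "word_eq X R (u @ v) (u' @ v')"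
proof -
  have "word_eq X R (u @ v) (u' @ v)"
    using word_eq_context[OF assms(1), of "[]" v] word_eq_in_words[OF assms(2)] by simp
  moreover have "word_eq X R (u' @ v) (u' @ v')"
    using word_eq_context[OF assms(2), of u' "[]"] word_eq_in_words[OF assms(1)] by simp
  ultimately show ?thesis by (rule word_eq.trans)
qed

lemma equiv_word_rel: "equiv (words X) (word_rel X R)"
  by (rule equivI)
    (auto simp: word_rel_def refl_on_def sym_on_def trans_on_def
      intro: word_eq.intros dest: word_eq_in_words)

lemma word_class_eq_iff:
  assumes "u \<in> words X" "v \<in> words X"
  shows "word_class X R u = word_class X R v \<longleftrightarrow> word_eq X R u v"
  using eq_equiv_class_iff[OF equiv_word_rel assms]
  by (simp add: word_class_def word_rel_def)

lemma mem_word_class: "v \<in> word_class X R u \<longleftrightarrow> word_eq X R u v"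
  by (simp add: word_class_def word_rel_def)

lemma carrier_presented_group:
  "carrier (presented_group X R) = word_class X R ` words X"
  by (auto simp: presented_group_def word_class_def quotient_def)

lemma word_class_closed [simp]:
  "w \<in> words X \<Longrightarrow> word_class X R w \<in> carrier (presented_group X R)"
  by (simp add: carrier_presented_group)

lemma one_presented_group: "\<one>\<^bsub>presented_group X R\<^esub> = word_class X R []"
  by (simp add: presented_group_def)

text \<open>The product in the definition is a union over all pairs of representatives. All its
  members are the same class, and the index sets are nonempty, so the union is that class.\<close>

lemma mult_presented_group:
  assumes "u \<in> words X" "v \<in> words X"
  shows "word_class X R u \<otimes>\<^bsub>presented_group X R\<^esub> word_class X R v = word_class X R (u @ v)"
proof -
  have "word_class X R (u' @ v') = word_class X R (u @ v)"
    if "u' \<in> word_class X R u" "v' \<in> word_class X R v" for u' v'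
  proof -
    have "word_eq X R (u @ v) (u' @ v')"
      using that word_eq_append by (auto simp: mem_word_class)
    then show ?thesis
      using word_class_eq_iff word_eq_in_words by blast
  qed
  then have "(\<Union>u'\<in>word_class X R u. \<Union>v'\<in>word_class X R v. word_class X R (u' @ v'))
      = (\<Union>u'\<in>word_class X R u. \<Union>v'\<in>word_class X R v. word_class X R (u @ v))"
    by (intro SUP_cong) simp_all
  moreover have "u \<in> word_class X R u" "v \<in> word_class X R v"
    using assms by (auto simp: mem_word_class intro: word_eq.refl)
  then have "word_class X R u \<noteq> {}" "word_class X R v \<noteq> {}"
    by blast+
  ultimately show ?thesis
    by (simp add: presented_group_def)
qed

definition word_inv :: "'a word \<Rightarrow> 'a word" where
  "word_inv w = rev (map (\<lambda>(x, b). (x, \<not> b)) w)"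

lemma word_inv_simps [simp]:
  "word_inv [] = []"
  "word_inv ((x, b) # w) = word_inv w @ [(x, \<not> b)]"
  "word_inv (u @ v) = word_inv v @ word_inv u"
  by (auto simp: word_inv_def)

lemma length_word_inv [simp]: "length (word_inv w) = length w"
  by (simp add: word_inv_def)

lemma word_inv_in_words [simp]: "word_inv w \<in> words X \<longleftrightarrow> w \<in> words X"
  by (induction w) auto

lemma word_eq_word_inv:
  "w \<in> words X \<Longrightarrow> word_eq X R (word_inv w @ w) []"
proof (induction w)
  case Nil
  then show ?case by (auto intro: word_eq.refl)
next
  case (Cons l w)
  obtain x b where l: "l = (x, b)" by fastforce
  have "word_eq X R (word_inv w @ [(x, \<not> b), (x, \<not> \<not> b)] @ w) (word_inv w @ w)"
    using Cons.prems l by (intro word_eq.cancel) auto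
  then show ?case
    using Cons l by (auto intro: word_eq.trans)
qed

lemma group_presented_group: "group (presented_group X R)"
proof (rule groupI)
  show "\<one>\<^bsub>presented_group X R\<^esub> \<in> carrier (presented_group X R)"
    by (simp add: one_presented_group)
next
  fix x assume "x \<in> carrier (presented_group X R)"
  then obtain w where w: "x = word_class X R w" "w \<in> words X"
    by (auto simp: carrier_presented_group)
  show "\<one>\<^bsub>presented_group X R\<^esub> \<otimes>\<^bsub>presented_group X R\<^esub> x = x"
    by (simp add: w one_presented_group mult_presented_group)
  have "word_class X R (word_inv w) \<otimes>\<^bsub>presented_group X R\<^esub> x = \<one>\<^bsub>presented_group X R\<^esub>"
    using w by (simp add: mult_presented_group one_presented_group word_class_eq_iff word_eq_word_inv)
  then show "\<exists>y\<in>carrier (presented_group X R). y \<otimes>\<^bsub>presented_group X R\<^esub> x = \<one>\<^bsub>presented_group X R\<^esub>"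
    using w by (intro bexI[of _ "word_class X R (word_inv w)"]) auto
next
  fix x y
  assume "x \<in> carrier (presented_group X R)" "y \<in> carrier (presented_group X R)"
  then obtain u v where w: "x = word_class X R u" "u \<in> words X" "y = word_class X R v" "v \<in> words X"
    by (auto simp: carrier_presented_group)
  then show "x \<otimes>\<^bsub>presented_group X R\<^esub> y \<in> carrier (presented_group X R)"
    by (simp add: mult_presented_group)
  fix z assume "z \<in> carrier (presented_group X R)"
  then obtain w where "z = word_class X R w" "w \<in> words X"
    by (auto simp: carrier_presented_group)
  with w show "x \<otimes>\<^bsub>presented_group X R\<^esub> y \<otimes>\<^bsub>presented_group X R\<^esub> z
      = x \<otimes>\<^bsub>presented_group X R\<^esub> (y \<otimes>\<^bsub>presented_group X R\<^esub> z)"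
    by (simp add: mult_presented_group)
qed

abbreviation gen_class :: "'a set \<Rightarrow> 'a word set \<Rightarrow> 'a \<Rightarrow> 'a word set" where
  "gen_class X R x \<equiv> word_class X R [(x, True)]"

lemma inv_gen_class:
  assumes "x \<in> X"
  shows "inv\<^bsub>presented_group X R\<^esub> gen_class X R x = word_class X R [(x, False)]"
proof -
  interpret group "presented_group X R" by (rule group_presented_group)
  have "word_class X R [(x, False)] \<otimes>\<^bsub>presented_group X R\<^esub> gen_class X R x = \<one>\<^bsub>presented_group X R\<^esub>"
    using assms word_eq_word_inv[of "[(x, True)]" X R]
    by (simp add: mult_presented_group one_presented_group word_class_eq_iff)
  then show ?thesis
    using assms by (intro inv_equality) auto
qed

text \<open>Serves as an induction principle: a property that cuts out a subgroup needs to be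
  checked on the generators only.\<close>

lemma presented_group_generators:
  assumes B: "subgroup B (presented_group X R)" and gen: "\<And>x. x \<in> X \<Longrightarrow> gen_class X R x \<in> B"
  shows "B = carrier (presented_group X R)"
proof -
  have letter: "word_class X R [l] \<in> B" if "fst l \<in> X" for l
  proof (cases l)
    case (Pair x b)
    have "word_class X R [(x, False)] \<in> B"
      using subgroup.m_inv_closed[OF B gen, of x] that inv_gen_class[of x X R] Pair by simp
    then show ?thesis
      using gen[of x] that Pair by (cases b) auto
  qed
  have "word_class X R w \<in> B" if "w \<in> words X" for w
    using that
  proof (induction w)
    case Nil
    then show ?case
      using subgroup.one_closed[OF B] by (simp add: one_presented_group)
  next
    case (Cons l w)
    then have "word_class X R [l] \<otimes>\<^bsub>presented_group X R\<^esub> word_class X R w \<in> B"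
      using letter by (intro subgroup.m_closed[OF B]) auto
    then show ?case
      using Cons.prems by (simp add: mult_presented_group)
  qed
  then have "carrier (presented_group X R) \<subseteq> B"
    unfolding carrier_presented_group by blast
  with subgroup.subset[OF B] show ?thesis
    by (rule subset_antisym)
qed

text \<open>The equalizer of the two homomorphisms is a subgroup containing the generators.\<close>

lemma presented_group_hom_eq:
  assumes "group L" "f \<in> hom (presented_group X R) L" "g \<in> hom (presented_group X R) L"
    and "\<And>x. x \<in> X \<Longrightarrow> f (gen_class X R x) = g (gen_class X R x)"
    and "y \<in> carrier (presented_group X R)"
  shows "f y = g y"
proof -
  interpret G: group "presented_group X R" by (rule group_presented_group)
  interpret f: group_hom "presented_group X R" L f
    by (intro group_hom.intro group_hom_axioms.intro G.group_axioms assms(1,2))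
  interpret g: group_hom "presented_group X R" L g
    by (intro group_hom.intro group_hom_axioms.intro G.group_axioms assms(1,3))
  have "subgroup {y \<in> carrier (presented_group X R). f y = g y} (presented_group X R)"
    by (rule G.subgroupI) auto
  from presented_group_generators[OF this] assms(4) have
    "{y \<in> carrier (presented_group X R). f y = g y} = carrier (presented_group X R)"
    by simp
  with assms(5) show ?thesis
    by blast
qed

section \<open>Evaluation of words and the universal property of a presentation\<close>

primrec word_eval :: "('b, 'c) monoid_scheme \<Rightarrow> ('a \<Rightarrow> 'b) \<Rightarrow> 'a word \<Rightarrow> 'b" where
  "word_eval L f [] = \<one>\<^bsub>L\<^esub>"
| "word_eval L f (l # w) = (if snd l then f (fst l) else inv\<^bsub>L\<^esub> f (fst l)) \<otimes>\<^bsub>L\<^esub> word_eval L f w"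

lemma (in group) word_eval_closed [simp]:
  assumes "f \<in> X \<rightarrow> carrier G" "w \<in> words X"
  shows "word_eval G f w \<in> carrier G"
  using assms(2) by (induction w) (use assms(1) in \<open>auto simp: Pi_iff\<close>)

lemma (in group) word_eval_append:
  assumes "f \<in> X \<rightarrow> carrier G" "u \<in> words X" "v \<in> words X"
  shows "word_eval G f (u @ v) = word_eval G f u \<otimes> word_eval G f v"
  using assms(2)
proof (induction u)
  case (Cons l u)
  then have "f (fst l) \<in> carrier G"
    using assms(1) by auto
  moreover have "word_eval G f u \<in> carrier G" "word_eval G f v \<in> carrier G"
    using assms Cons.prems by auto
  ultimately show ?case
    using Cons by (simp add: m_assoc)
qed (use assms in auto)

lemma (in group) word_eval_cong:
  assumes f: "f \<in> X \<rightarrow> carrier G"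
    and R: "\<And>r. r \<in> R \<Longrightarrow> r \<in> words X \<Longrightarrow> word_eval G f r = \<one>"
    and "word_eq X R u v"
  shows "word_eval G f u = word_eval G f v"
  using assms(3)
proof (induction rule: word_eq.induct)
  case (cancel u x b v)
  then have "f x \<in> carrier G"
    using f by auto
  then have "word_eval G f [(x, b), (x, \<not> b)] = \<one>"
    by (cases b) auto
  moreover have "word_eval G f (u @ [(x, b), (x, \<not> b)] @ v)
      = word_eval G f u \<otimes> (word_eval G f [(x, b), (x, \<not> b)] \<otimes> word_eval G f v)"
    using cancel by (subst word_eval_append[OF f], simp, simp)+ simp
  moreover have "word_eval G f u \<in> carrier G" "word_eval G f v \<in> carrier G"
    using word_eval_closed[OF f] cancel by auto
  ultimately show ?case
    using cancel by (simp add: word_eval_append[OF f])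
next
  case (relator r u v)
  then have "word_eval G f (u @ r @ v) = word_eval G f u \<otimes> (word_eval G f r \<otimes> word_eval G f v)"
    by (simp add: word_eval_append[OF f])
  moreover have "word_eval G f u \<in> carrier G" "word_eval G f v \<in> carrier G"
    using word_eval_closed[OF f] relator by auto
  ultimately show ?case
    using relator R by (simp add: word_eval_append[OF f])
qed auto

text \<open>Von Dyck's theorem. A class is sent to the value of a representative picked by
  \<open>SOME\<close>; \<open>word_eval_cong\<close> makes the choice immaterial. The condition
  concerns relators in \<open>words X\<close>, as \<open>word_eq\<close> applies no others.\<close>

lemma presented_group_hom_exists:
  assumes "group L" and f: "f \<in> X \<rightarrow> carrier L"
    and R: "\<And>r. r \<in> R \<Longrightarrow> r \<in> words X \<Longrightarrow> word_eval L f r = \<one>\<^bsub>L\<^esub>"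
  obtains \<Phi> where "\<Phi> \<in> hom (presented_group X R) L" "\<And>x. x \<in> X \<Longrightarrow> \<Phi> (gen_class X R x) = f x"
proof
  interpret L: group L by fact
  define \<Phi> where "\<Phi> A = word_eval L f (SOME w. w \<in> A)" for A
  have \<Phi>: "\<Phi> (word_class X R w) = word_eval L f w" if "w \<in> words X" for w
  proof -
    have "w \<in> word_class X R w"
      using that by (simp add: mem_word_class word_eq.refl)
    then have "(SOME w'. w' \<in> word_class X R w) \<in> word_class X R w"
      by (metis someI)
    then show ?thesis
      unfolding \<Phi>_def mem_word_class by (metis L.word_eval_cong[OF f R])
  qed
  show "\<Phi> \<in> hom (presented_group X R) L"
    by (rule homI)
      (auto simp: carrier_presented_group \<Phi> mult_presented_group L.word_eval_closed[OF f]
        L.word_eval_append[OF f])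
  show "\<Phi> (gen_class X R x) = f x" if "x \<in> X" for x
  proof -
    have "f x \<in> carrier L"
      using that f by auto
    then show ?thesis
      using that by (simp add: \<Phi>)
  qed
qed

lemma group_free_group: "group (free_group X)"
  by (simp add: free_group_def group_presented_group)

section \<open>Trees in multigraphs\<close>

text \<open>The subtrees with root \<open>r\<close> of the undirected multigraph with edge set \<open>E\<close>, each given by its
  vertex set and its edge set.\<close>

inductive rooted_tree ::
  "('e \<Rightarrow> 'v) \<Rightarrow> ('e \<Rightarrow> 'v) \<Rightarrow> 'e set \<Rightarrow> 'v \<Rightarrow> 'v set \<Rightarrow> 'e set \<Rightarrow> bool"
  for t h :: "'e \<Rightarrow> 'v" and E :: "'e set" and r :: 'v where
  root: "rooted_tree t h E r {r} {}"
| forward: "rooted_tree t h E r S F \<Longrightarrow> e \<in> E \<Longrightarrow> t e \<in> S \<Longrightarrow> h e \<notin> S \<Longrightarrow>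
    rooted_tree t h E r (insert (h e) S) (insert e F)"
| backward: "rooted_tree t h E r S F \<Longrightarrow> e \<in> E \<Longrightarrow> h e \<in> S \<Longrightarrow> t e \<notin> S \<Longrightarrow>
    rooted_tree t h E r (insert (t e) S) (insert e F)"

lemma rooted_tree_edges:
  assumes "rooted_tree t h E r S F"
  shows "F \<subseteq> E \<and> (\<forall>e\<in>F. t e \<in> S \<and> h e \<in> S)"
  using assms by (induction rule: rooted_tree.induct) auto

text \<open>Each construction step attaches one vertex by one edge, so agreement across tree edges
  spreads from the root. It is applied to membership in closed vertex sets and, later, to identities
  between group elements indexed by vertices.\<close>

lemma rooted_tree_propagate:
  assumes "rooted_tree t h E r S F" "\<And>e. e \<in> F \<Longrightarrow> P (t e) \<longleftrightarrow> P (h e)" "v \<in> S"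
  shows "P v \<longleftrightarrow> P r"
  using assms by (induction arbitrary: v rule: rooted_tree.induct) auto

text \<open>\<open>conn\<close> is connectedness in cut form: no proper vertex set containing the
  root is closed under edges. A partial tree that misses a vertex therefore has an edge leaving it,
  and adding this edge shrinks the complement.\<close>

lemma rooted_tree_exists:
  assumes "finite V" "r \<in> V" and E: "\<And>e. e \<in> E \<Longrightarrow> t e \<in> V \<and> h e \<in> V"
    and conn: "\<And>S. S \<subseteq> V \<Longrightarrow> r \<in> S \<Longrightarrow> (\<And>e. e \<in> E \<Longrightarrow> t e \<in> S \<longleftrightarrow> h e \<in> S) \<Longrightarrow> S = V"
  obtains F where "rooted_tree t h E r V F"
proof -
  have "\<exists>F. rooted_tree t h E r V F" if "rooted_tree t h E r S F" "S \<subseteq> V" "r \<in> S" for S F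
    using that
  proof (induction "card (V - S)" arbitrary: S F rule: less_induct)
    case less
    show ?case
    proof (cases "S = V")
      case True
      then show ?thesis using less.prems by blast
    next
      case False
      then obtain e where e: "e \<in> E" "t e \<in> S \<longleftrightarrow> h e \<notin> S"
        using conn[OF less.prems(2,3)] by blast
      then obtain v where v: "v \<in> V" "v \<notin> S" "rooted_tree t h E r (insert v S) (insert e F)"
        using E[OF e(1)] rooted_tree.forward[OF less.prems(1) e(1)]
          rooted_tree.backward[OF less.prems(1) e(1)] by blast
      have "V - insert v S \<subset> V - S"
        using v by blast
      then have "card (V - insert v S) < card (V - S)"
        using \<open>finite V\<close> by (intro psubset_card_mono) auto
      then show ?thesis
        using less.hyps v less.prems by (metis insert_subset insertI2)
    qed
  qed
  then show ?thesis
    using that rooted_tree.root[of t h E r] \<open>r \<in> V\<close> by blast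
qed

text \<open>A new vertex meets exactly one of the edges present when it is attached, so the equation
  of that edge can be solved for its value. There are no cycles, hence no consistency conditions on
  the labels \<open>c\<close>.\<close>

lemma (in group) rooted_tree_potential:
  assumes "rooted_tree t h E r S F" "\<And>e. e \<in> F \<Longrightarrow> c e \<in> carrier G"
  shows "\<exists>f. (\<forall>v. f v \<in> carrier G) \<and> f r = \<one> \<and> (\<forall>e\<in>F. f (t e) \<otimes> c e = f (h e))"
  using assms
proof (induction rule: rooted_tree.induct)
  case root
  then show ?case by (intro exI[of _ "\<lambda>_. \<one>"]) auto
next
  case (forward S F e)
  then obtain f where f: "\<And>v. f v \<in> carrier G" "f r = \<one>" "\<And>e. e \<in> F \<Longrightarrow> f (t e) \<otimes> c e = f (h e)"
    by auto
  have "r \<in> S"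
    using forward.hyps(1) by (induction rule: rooted_tree.induct) auto
  with f forward rooted_tree_edges[OF forward.hyps(1)] show ?case
    by (intro exI[of _ "f(h e := f (t e) \<otimes> c e)"]) auto
next
  case (backward S F e)
  then obtain f where f: "\<And>v. f v \<in> carrier G" "f r = \<one>" "\<And>e. e \<in> F \<Longrightarrow> f (t e) \<otimes> c e = f (h e)"
    by auto
  have "r \<in> S"
    using backward.hyps(1) by (induction rule: rooted_tree.induct) auto
  with f backward rooted_tree_edges[OF backward.hyps(1)] show ?case
    by (intro exI[of _ "f(t e := f (h e) \<otimes> inv c e)"]) (auto simp: m_assoc)
qed

text \<open>A set closed under arcs is closed under walks in the symmetric closure. Conversely, the
  vertices reachable from a given one form such a closed set.\<close>

lemma connected_iff_cut:
  assumes "wf_digraph G"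
  shows "Digraph_Component.connected G \<longleftrightarrow> verts G \<noteq> {} \<and>
    (\<forall>S\<subseteq>verts G. S \<noteq> {} \<longrightarrow> (\<forall>e\<in>arcs G. tail G e \<in> S \<longleftrightarrow> head G e \<in> S) \<longrightarrow> S = verts G)"
proof -
  interpret wf_digraph G by fact
  interpret H: pair_wf_digraph "mk_symmetric G" ..
  have cut: "v \<in> S" if "u \<rightarrow>\<^sup>*\<^bsub>mk_symmetric G\<^esub> v" "u \<in> S" "\<forall>e\<in>arcs G. tail G e \<in> S \<longleftrightarrow> head G e \<in> S"
    for u v S
    using that by (induction rule: H.reachable_induct) (auto simp: parcs_mk_symmetric)
  have reach: "u \<rightarrow>\<^sup>*\<^bsub>mk_symmetric G\<^esub> tail G e \<longleftrightarrow> u \<rightarrow>\<^sup>*\<^bsub>mk_symmetric G\<^esub> head G e"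
    if "e \<in> arcs G" for u e
  proof -
    have "tail G e \<rightarrow>\<^bsub>mk_symmetric G\<^esub> head G e" "head G e \<rightarrow>\<^bsub>mk_symmetric G\<^esub> tail G e"
      using that by (auto simp: parcs_mk_symmetric)
    then show ?thesis
      using wf_digraph.reachable_adj_trans[OF wf_digraph_wp_iff[THEN iffD2, OF H.pair_wf_digraph_axioms]]
      by metis
  qed
  show ?thesis
  proof (intro iffI conjI allI impI)
    assume "Digraph_Component.connected G"
    then show "verts G \<noteq> {}"
      by (auto simp: Digraph_Component.connected_def strongly_connected_def)
    fix S assume S: "S \<subseteq> verts G" "S \<noteq> {}" "\<forall>e\<in>arcs G. tail G e \<in> S \<longleftrightarrow> head G e \<in> S"
    then obtain u where "u \<in> S" "u \<in> verts G"
      by blast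
    then have "v \<in> S" if "v \<in> verts G" for v
      using \<open>Digraph_Component.connected G\<close> that cut[of u v, OF _ _ S(3)]
      by (simp add: Digraph_Component.connected_def strongly_connected_def)
    with S(1) show "S = verts G"
      by blast
  next
    assume *: "verts G \<noteq> {} \<and> (\<forall>S\<subseteq>verts G. S \<noteq> {} \<longrightarrow>
      (\<forall>e\<in>arcs G. tail G e \<in> S \<longleftrightarrow> head G e \<in> S) \<longrightarrow> S = verts G)"
    have "u \<rightarrow>\<^sup>*\<^bsub>mk_symmetric G\<^esub> v" if "u \<in> verts G" "v \<in> verts G" for u v
    proof -
      let ?S = "{v \<in> verts G. u \<rightarrow>\<^sup>*\<^bsub>mk_symmetric G\<^esub> v}"
      have "?S \<subseteq> verts G" "?S \<noteq> {}" "\<forall>e\<in>arcs G. tail G e \<in> ?S \<longleftrightarrow> head G e \<in> ?S"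
        using reach that by auto
      then have "?S = verts G"
        using *[THEN conjunct2, THEN spec, THEN mp, THEN mp, THEN mp] by presburger
      then show ?thesis
        using that by blast
    qed
    with * show "Digraph_Component.connected G"
      by (auto simp: Digraph_Component.connected_def strongly_connected_def)
  qed
qed

text \<open>A spanning rooted tree \<open>F\<close> is grown inside \<open>T\<close>. An arc of
  \<open>T\<close> outside \<open>F\<close> could be deleted without disconnecting \<open>T\<close>,
  because \<open>F\<close> alone still joins all vertices; this contradicts the minimality of
  \<open>T\<close>, so \<open>F = arcs T\<close>.\<close>

lemma maximal_tree_imp_rooted_tree:
  assumes T: "maximal_tree T \<Gamma>" and fin: "finite (verts \<Gamma>)" and r: "r \<in> verts \<Gamma>"
  shows "rooted_tree (tail \<Gamma>) (head \<Gamma>) (arcs \<Gamma>) r (verts \<Gamma>) (arcs T)"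
proof -
  have sub: "arcs T \<subseteq> arcs \<Gamma>" "verts T = verts \<Gamma>" "tail T = tail \<Gamma>" "head T = head \<Gamma>" "wf_digraph T"
    using T by (auto simp: maximal_tree_def spanning_def subgraph_def compatible_def)
  interpret T: wf_digraph T by fact
  have conn: "Digraph_Component.connected T"
    using T by (simp add: maximal_tree_def)
  obtain F where F: "rooted_tree (tail \<Gamma>) (head \<Gamma>) (arcs T) r (verts \<Gamma>) F"
  proof (rule rooted_tree_exists[OF fin r])
    show "tail \<Gamma> e \<in> verts \<Gamma> \<and> head \<Gamma> e \<in> verts \<Gamma>" if "e \<in> arcs T" for e
      using that T.tail_in_verts T.head_in_verts sub by metis
    show "S = verts \<Gamma>" if "S \<subseteq> verts \<Gamma>" "r \<in> S"
      "\<And>e. e \<in> arcs T \<Longrightarrow> tail \<Gamma> e \<in> S \<longleftrightarrow> head \<Gamma> e \<in> S" for S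
      using conn that unfolding connected_iff_cut[OF T.wf_digraph_axioms] sub by blast
  qed
  have "arcs T \<subseteq> F"
  proof
    fix e assume e: "e \<in> arcs T"
    show "e \<in> F"
    proof (rule ccontr)
      assume "e \<notin> F"
      let ?D = "pre_digraph.del_arc T e"
      have D: "verts ?D = verts \<Gamma>" "arcs ?D = arcs T - {e}" "tail ?D = tail \<Gamma>" "head ?D = head \<Gamma>"
        by (simp_all add: pre_digraph.del_arc_def sub)
      have "S = verts \<Gamma>" if S: "S \<subseteq> verts \<Gamma>" "S \<noteq> {}"
        "\<forall>e\<in>arcs T - {e}. tail \<Gamma> e \<in> S \<longleftrightarrow> head \<Gamma> e \<in> S" for S
      proof -
        have "tail \<Gamma> f \<in> S \<longleftrightarrow> head \<Gamma> f \<in> S" if "f \<in> F" for f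
          using that \<open>e \<notin> F\<close> S(3) rooted_tree_edges[OF F] by blast
        from rooted_tree_propagate[OF F, of "\<lambda>v. v \<in> S", OF this] S(1,2) show ?thesis
          by blast
      qed
      moreover have "verts \<Gamma> \<noteq> {}"
        using r by blast
      ultimately have "Digraph_Component.connected ?D"
        unfolding connected_iff_cut[OF T.wf_digraph_del_arc] D by blast
      with T e show False
        by (simp add: maximal_tree_def)
    qed
  qed
  then have "F = arcs T"
    using rooted_tree_edges[OF F] by blast
  with F sub(1) have "rooted_tree (tail \<Gamma>) (head \<Gamma>) (arcs T) r (verts \<Gamma>) (arcs T)"
    by simp
  then show ?thesis
    using sub(1) by (induction rule: rooted_tree.induct) (auto intro: rooted_tree.intros)
qed

section \<open>Cancellation and conjugation in groups\<close>

lemma (in group) mult_inv_cancel: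
  assumes "g \<in> carrier G" "x \<in> carrier G"
  shows "g \<otimes> (inv g \<otimes> x) = x" "inv g \<otimes> (g \<otimes> x) = x"
  using assms by (simp_all add: m_assoc[symmetric])

text \<open>As simplification rules these bring a product to right-nested form with inverses pushed
  to single factors and adjacent inverse pairs cancelled, which decides most of the group identities
  below.\<close>

lemmas (in group) group_normalize = m_assoc inv_mult_group mult_inv_cancel

lemma (in group) conj_hom: "g \<in> carrier G \<Longrightarrow> (\<lambda>x. g \<otimes> x \<otimes> inv g) \<in> hom G G"
  by (rule homI) (auto simp: group_normalize)

lemma (in group) conj_int_pow:
  assumes "g \<in> carrier G" "x \<in> carrier G"
  shows "(g \<otimes> x \<otimes> inv g) [^] (k::int) = g \<otimes> x [^] k \<otimes> inv g"
  using hom_int_pow[OF conj_hom[OF assms(1)] assms(2) group_axioms group_axioms, of k] by simp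

section \<open>Commuting elements of free groups\<close>

definition letter_inv :: "'a \<times> bool \<Rightarrow> 'a \<times> bool" where
  "letter_inv l = (fst l, \<not> snd l)"

lemma letter_inv_simps [simp]:
  "letter_inv (letter_inv l) = l"
  "letter_inv l \<noteq> l"
  "l \<noteq> letter_inv l"
  "letter_inv l = letter_inv m \<longleftrightarrow> l = m"
  "fst (letter_inv l) = fst l"
  by (auto simp: letter_inv_def prod_eq_iff)

definition reduced :: "'a word \<Rightarrow> bool" where
  "reduced = successively (\<lambda>l m. m \<noteq> letter_inv l)"

lemma reduced_Nil [simp]: "reduced []"
  and reduced_single [simp]: "reduced [l]"
  and reduced_Cons2 [simp]: "reduced (l # m # w) \<longleftrightarrow> m \<noteq> letter_inv l \<and> reduced (m # w)"
  by (auto simp: reduced_def)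

lemma reduced_append:
  "reduced (u @ v) \<longleftrightarrow>
    reduced u \<and> reduced v \<and> (u = [] \<or> v = [] \<or> hd v \<noteq> letter_inv (last u))"
  by (auto simp: reduced_def successively_append_iff)

text \<open>Left multiplication by a letter on reduced words, as in van der Waerden's proof of the
  normal form theorem for free groups.\<close>

fun push :: "'a \<times> bool \<Rightarrow> 'a word \<Rightarrow> 'a word" where
  "push l [] = [l]"
| "push l (m # w) = (if m = letter_inv l then w else l # m # w)"

lemma reduced_tl: "reduced (l # w) \<Longrightarrow> reduced w"
  by (cases w) auto

lemma reduced_push: "reduced w \<Longrightarrow> reduced (push l w)"
  by (cases w) (auto dest: reduced_tl)

lemma push_push_inv: "reduced w \<Longrightarrow> push l (push (letter_inv l) w) = w"
  by (cases w rule: remdups_adj.cases) auto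

definition reduce :: "'a word \<Rightarrow> 'a word" where
  "reduce w = foldr push w []"

lemma reduce_simps [simp]: "reduce [] = []" "reduce (l # w) = push l (reduce w)"
  by (auto simp: reduce_def)

lemma reduced_reduce: "reduced (reduce w)"
  by (induction w) (auto intro: reduced_push)

lemma reduce_append: "reduce (u @ v) = foldr push u (reduce v)"
  by (simp add: reduce_def)

lemma reduce_reduced: "reduced w \<Longrightarrow> reduce w = w"
proof (induction w)
  case (Cons l w)
  then show ?case
    by (cases w) auto
qed simp

lemma length_push: "length (push l w) \<le> Suc (length w)"
  by (cases w) auto

lemma length_reduce: "length (reduce w) \<le> length w"
proof (induction w)
  case (Cons l w)
  then show ?case
    using length_push[of l "reduce w"] by simp
qed simp

text \<open>A letter either lengthens the reduced word by one or cancels and shortens it. If no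
  length is lost in total, no cancellation has occurred.\<close>

lemma reduce_eq_if_length: "length (reduce w) = length w \<Longrightarrow> reduce w = w"
proof (induction w)
  case (Cons l w)
  have "length (reduce w) = length w"
    using Cons.prems length_push[of l "reduce w"] length_reduce[of w] by simp
  then have w: "reduce w = w"
    by (rule Cons.IH)
  with Cons.prems have "length (push l w) = Suc (length w)"
    by simp
  then have "push l w = l # w"
    by (cases w) (auto split: if_splits)
  with w show ?case
    by simp
qed simp

lemma word_eq_reduce: "w \<in> words X \<Longrightarrow> word_eq X R w (reduce w)"
proof (induction w)
  case Nil
  then show ?case by (auto intro: word_eq.refl)
next
  case (Cons l w)
  then have *: "word_eq X R (l # w) (l # reduce w)"
    using word_eq_context[of X R w "reduce w" "[l]" "[]"] by auto
  show ?case
  proof (cases "\<exists>v. reduce w = letter_inv l # v")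
    case True
    then obtain v where "reduce w = letter_inv l # v"
      by blast
    moreover have "l = (fst l, snd l)"
      by simp
    ultimately have "word_eq X R (l # reduce w) v"
      using word_eq.cancel[of "[]" "fst l" "snd l" v X R] word_eq_in_words(2)[OF *]
      by (auto simp: letter_inv_def)
    with * show ?thesis
      using \<open>reduce w = letter_inv l # v\<close> by (auto intro: word_eq.trans)
  next
    case False
    then have "push l (reduce w) = l # reduce w"
      by (cases "reduce w") auto
    with * show ?thesis by simp
  qed
qed

text \<open>\<open>push l\<close> and \<open>push (letter_inv l)\<close> are mutually inverse on
  reduced words, so folding \<open>push\<close> is an action of the free group on them.\<close>

lemma reduce_cong: "word_eq X {} u v \<Longrightarrow> reduce u = reduce v"
proof (induction rule: word_eq.induct)
  case (cancel u x b v)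
  have "push (x, b) (push (x, \<not> b) (reduce v)) = reduce v"
    using push_push_inv[OF reduced_reduce[of v], of "(x, b)"] by (simp add: letter_inv_def)
  then show ?case
    by (simp add: reduce_append)
qed auto

lemma word_inv_conv: "word_inv w = rev (map letter_inv w)"
  by (simp add: word_inv_def letter_inv_def case_prod_unfold)

lemma reduced_word_inv: "reduced w \<Longrightarrow> reduced (word_inv w)"
proof (induction w)
  case (Cons l w)
  then show ?case
    by (cases w) (auto simp: word_inv_conv reduced_append)
qed (auto simp: word_inv_conv)

context
  fixes X :: "'a set"
begin

interpretation F: group "free_group X"
  by (rule group_free_group)

lemma free_group_class_pow:
  "w \<in> words X \<Longrightarrow>
    word_class X {} (concat (replicate n w)) = word_class X {} w [^]\<^bsub>free_group X\<^esub> n"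
proof (induction n)
  case 0
  then show ?case by (simp add: free_group_def one_presented_group)
next
  case (Suc n)
  have "concat (replicate n w) \<in> words X"
    using Suc.prems by (induction n) auto
  then have "word_class X {} (w @ concat (replicate n w))
      = word_class X {} w \<otimes>\<^bsub>free_group X\<^esub> word_class X {} w [^]\<^bsub>free_group X\<^esub> n"
    using Suc by (simp add: free_group_def flip: mult_presented_group)
  also have "\<dots> = word_class X {} w [^]\<^bsub>free_group X\<^esub> Suc n"
    using Suc.prems F.nat_pow_Suc2[of "word_class X {} w" n] by (simp add: free_group_def)
  finally show ?case by simp
qed

text \<open>Without cancellation in the product, the two elements commute already in the free monoid.\<close>

lemma free_group_commuting_reduced:
  assumes v: "v \<in> words X" and w: "w \<in> words X" "w \<noteq> []" and red: "reduced (v @ w)"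
    and comm: "word_class X {} (v @ w) = word_class X {} (w @ v)"
  obtains m n :: nat where "n \<noteq> 0"
    "word_class X {} v [^]\<^bsub>free_group X\<^esub> n = word_class X {} w [^]\<^bsub>free_group X\<^esub> m"
proof -
  have "word_eq X {} (v @ w) (w @ v)"
    using comm v w by (simp add: word_class_eq_iff)
  then have eq: "reduce (w @ v) = v @ w"
    using reduce_cong reduce_reduced[OF red] by metis
  then have "reduce (w @ v) = w @ v"
    by (intro reduce_eq_if_length) simp
  with eq have "v @ w = w @ v"
    by simp
  \<comment> \<open>Commuting words are powers of a common word \<open>z\<close>. The exponents are
    used crosswise: both sides of the claimed relation equal the power of \<open>z\<close> with
    exponent \<open>m * n\<close>.\<close>
  then obtain m n z where z: "concat (replicate m z) = v" "concat (replicate n z) = w"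
    using comm_append_are_replicate by metis
  have n: "n \<noteq> 0"
    using z w by auto
  have "z \<in> words X"
  proof (cases n)
    case (Suc k)
    then show ?thesis
      using z w by auto
  qed (use n in simp)
  then have zc: "word_class X {} z \<in> carrier (free_group X)"
    by (simp add: free_group_def)
  have "word_class X {} v [^]\<^bsub>free_group X\<^esub> n = word_class X {} w [^]\<^bsub>free_group X\<^esub> m"
    using free_group_class_pow[OF \<open>z \<in> words X\<close>] zc
    by (simp add: F.nat_pow_pow mult.commute flip: z)
  with n that show thesis by blast
qed

text \<open>If \<open>w\<close> is cyclically reduced, the reduced form \<open>v\<close> of
  \<open>y\<close> can be followed without cancellation by \<open>w\<close> or by its inverse, and
  the cancellation-free case applies. Otherwise \<open>w\<close> is a conjugate of a shorter reduced
  word by its first letter; conjugating \<open>y\<close> along with it reduces the length.\<close>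

lemma free_group_commuting_powers_aux:
  assumes "reduced w" "w \<in> words X" "w \<noteq> []" "y \<in> carrier (free_group X)"
    and "y \<otimes>\<^bsub>free_group X\<^esub> word_class X {} w = word_class X {} w \<otimes>\<^bsub>free_group X\<^esub> y"
  shows "\<exists>(k::int) (j::int). k \<noteq> 0 \<and> y [^]\<^bsub>free_group X\<^esub> k = word_class X {} w [^]\<^bsub>free_group X\<^esub> j"
  using assms
proof (induction "length w" arbitrary: w y rule: less_induct)
  case less
  obtain v0 where "v0 \<in> words X" "y = word_class X {} v0"
    using less.prems(4) by (auto simp: free_group_def carrier_presented_group)
  then obtain v where v: "v \<in> words X" "y = word_class X {} v" "reduced v"
    using reduced_reduce[of v0] word_eq_reduce[of v0 X "{}"] word_eq_in_words(2)
      word_class_eq_iff[of v0 X "reduce v0" "{}"] by blast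
  have comm: "word_class X {} (v @ w) = word_class X {} (w @ v)"
    using less.prems v by (simp add: free_group_def mult_presented_group)
  show ?case
  proof (cases "reduced (w @ w)")
    case cyc: True
    show ?thesis
    proof (cases "reduced (v @ w)")
      case True
      then obtain m n :: nat where "n \<noteq> 0" "y [^]\<^bsub>free_group X\<^esub> n = word_class X {} w [^]\<^bsub>free_group X\<^esub> m"
        using free_group_commuting_reduced[OF v(1) less.prems(2,3) _ comm] v(2) by metis
      then have "int n \<noteq> 0" "y [^]\<^bsub>free_group X\<^esub> int n = word_class X {} w [^]\<^bsub>free_group X\<^esub> int m"
        by (simp_all add: int_pow_int)
      then show ?thesis
        by blast
    next
      case False
      then have "v \<noteq> []" "hd w = letter_inv (last v)"
        using less.prems(1) v(3) by (auto simp: reduced_append)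
      moreover have "hd w \<noteq> letter_inv (last w)"
        using cyc less.prems(3) by (auto simp: reduced_append)
      \<comment> \<open>Cancellation here as well would make the last letter of \<open>v\<close>
        equal to the last letter of \<open>w\<close>. It is already inverse to the first letter of
        \<open>w\<close>, so \<open>w @ w\<close> would not be reduced.\<close>
      ultimately have "reduced (v @ word_inv w)"
        using less.prems(1,3) v(3) reduced_word_inv[OF less.prems(1)]
        by (auto simp: reduced_append word_inv_conv hd_rev last_map)
      let ?c = "word_class X {} w"
      have c: "?c \<in> carrier (free_group X)" "word_class X {} (word_inv w) \<in> carrier (free_group X)"
        using less.prems(2) by (auto simp: free_group_def)
      have "word_class X {} (word_inv w) \<otimes>\<^bsub>free_group X\<^esub> ?c = \<one>\<^bsub>free_group X\<^esub>"
        using less.prems(2) by (simp add: free_group_def mult_presented_group one_presented_group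
            word_class_eq_iff word_eq_word_inv)
      then have inv: "inv\<^bsub>free_group X\<^esub> ?c = word_class X {} (word_inv w)"
        using c by (intro F.inv_equality)
      have "y \<otimes>\<^bsub>free_group X\<^esub> inv\<^bsub>free_group X\<^esub> ?c = inv\<^bsub>free_group X\<^esub> ?c \<otimes>\<^bsub>free_group X\<^esub> y"
        using less.prems(4,5) c
        by (metis F.inv_closed F.inv_solve_left' F.inv_solve_right F.m_assoc F.m_closed)
      then have "word_class X {} (v @ word_inv w) = word_class X {} (word_inv w @ v)"
        using less.prems v unfolding inv by (simp add: free_group_def mult_presented_group)
      then obtain m n :: nat where mn: "n \<noteq> 0"
        "y [^]\<^bsub>free_group X\<^esub> n = (inv\<^bsub>free_group X\<^esub> ?c) [^]\<^bsub>free_group X\<^esub> m"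
        using free_group_commuting_reduced[OF v(1) _ _ \<open>reduced (v @ word_inv w)\<close>] v(2)
          less.prems(2,3) inv by (metis length_0_conv length_word_inv word_inv_in_words)
      then have "y [^]\<^bsub>free_group X\<^esub> int n = ?c [^]\<^bsub>free_group X\<^esub> (- int m)"
        using c by (simp add: int_pow_int F.int_pow_neg F.nat_pow_inv)
      moreover have "int n \<noteq> 0"
        using mn(1) by simp
      ultimately show ?thesis
        by blast
    qed
  next
    case False
    then have hl: "hd w = letter_inv (last w)"
      using less.prems(1) by (auto simp: reduced_append)
    obtain l w1 where w1: "w = l # w1"
      using less.prems(3) by (cases w) auto
    then have "w1 \<noteq> []"
      using hl by auto
    then obtain w2 where w2: "w = l # w2 @ [letter_inv l]"
      using w1 hl by (cases w1 rule: rev_cases) auto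
    have "w2 \<noteq> []" "reduced w2" "w2 \<in> words X" "fst l \<in> X"
      using less.prems(1,2) w2 reduced_append[of "[l]" "w2 @ [letter_inv l]"]
        reduced_append[of w2 "[letter_inv l]"] by auto
    define g where "g = word_class X {} [l]"
    have inv_g: "inv\<^bsub>free_group X\<^esub> g = word_class X {} [letter_inv l]"
    proof (rule F.inv_equality)
      have "word_eq X {} ([letter_inv l] @ [l]) []"
        using word_eq_word_inv[of "[l]" X "{}"] \<open>fst l \<in> X\<close> by (simp add: word_inv_conv)
      then show "word_class X {} [letter_inv l] \<otimes>\<^bsub>free_group X\<^esub> g = \<one>\<^bsub>free_group X\<^esub>"
        using \<open>fst l \<in> X\<close> by (simp add: g_def free_group_def mult_presented_group
            one_presented_group word_class_eq_iff)
    qed (use \<open>fst l \<in> X\<close> in \<open>auto simp: g_def free_group_def\<close>)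
    have carr: "g \<in> carrier (free_group X)" "word_class X {} w2 \<in> carrier (free_group X)"
      using \<open>fst l \<in> X\<close> \<open>w2 \<in> words X\<close> by (auto simp: g_def free_group_def)
    have w_conj: "word_class X {} w = g \<otimes>\<^bsub>free_group X\<^esub> word_class X {} w2 \<otimes>\<^bsub>free_group X\<^esub> inv\<^bsub>free_group X\<^esub> g"
      unfolding inv_g unfolding g_def
      using \<open>fst l \<in> X\<close> \<open>w2 \<in> words X\<close> w2 by (simp add: free_group_def mult_presented_group)
    define y' where "y' = inv\<^bsub>free_group X\<^esub> g \<otimes>\<^bsub>free_group X\<^esub> y \<otimes>\<^bsub>free_group X\<^esub> g"
    have y': "y' \<in> carrier (free_group X)" "y = g \<otimes>\<^bsub>free_group X\<^esub> y' \<otimes>\<^bsub>free_group X\<^esub> inv\<^bsub>free_group X\<^esub> g"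
      using carr less.prems(4) unfolding y'_def
      by (auto simp: F.group_normalize)
    have "g \<otimes>\<^bsub>free_group X\<^esub> (y' \<otimes>\<^bsub>free_group X\<^esub> word_class X {} w2) \<otimes>\<^bsub>free_group X\<^esub> inv\<^bsub>free_group X\<^esub> g
        = y \<otimes>\<^bsub>free_group X\<^esub> word_class X {} w"
      unfolding w_conj using y' carr by (simp add: F.group_normalize)
    also have "\<dots> = word_class X {} w \<otimes>\<^bsub>free_group X\<^esub> y"
      by (rule less.prems(5))
    also have "\<dots> = g \<otimes>\<^bsub>free_group X\<^esub> (word_class X {} w2 \<otimes>\<^bsub>free_group X\<^esub> y') \<otimes>\<^bsub>free_group X\<^esub> inv\<^bsub>free_group X\<^esub> g"
      unfolding w_conj using y' carr by (simp add: F.group_normalize)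
    finally have "y' \<otimes>\<^bsub>free_group X\<^esub> word_class X {} w2 = word_class X {} w2 \<otimes>\<^bsub>free_group X\<^esub> y'"
      using y' carr by simp
    moreover have "length w2 < length w"
      using w2 by simp
    ultimately obtain k j :: int where "k \<noteq> 0"
      "y' [^]\<^bsub>free_group X\<^esub> k = word_class X {} w2 [^]\<^bsub>free_group X\<^esub> j"
      using less.hyps \<open>reduced w2\<close> \<open>w2 \<in> words X\<close> \<open>w2 \<noteq> []\<close> y'(1) by blast
    then show ?thesis
      unfolding w_conj y'(2) using F.conj_int_pow[OF carr(1)] y'(1) carr(2) by metis
  qed
qed

text \<open>The disjunction covers trivial \<open>c\<close>: then \<open>y\<close> may have infinite
  order, and the relation supplied has exponents 0 and 1.\<close>

lemma free_group_commuting_powers: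
  assumes "y \<in> carrier (free_group X)" "c \<in> carrier (free_group X)"
    and "y \<otimes>\<^bsub>free_group X\<^esub> c = c \<otimes>\<^bsub>free_group X\<^esub> y"
  obtains k j :: int where "k \<noteq> 0 \<or> j \<noteq> 0" "y [^]\<^bsub>free_group X\<^esub> k = c [^]\<^bsub>free_group X\<^esub> j"
proof -
  obtain w0 where "w0 \<in> words X" "c = word_class X {} w0"
    using assms(2) by (auto simp: free_group_def carrier_presented_group)
  then obtain w where w: "w \<in> words X" "c = word_class X {} w" "reduced w"
    using reduced_reduce[of w0] word_eq_reduce[of w0 X "{}"] word_eq_in_words(2)
      word_class_eq_iff[of w0 X "reduce w0" "{}"] by blast
  show thesis
  proof (cases "w = []")
    case True
    then have "c = \<one>\<^bsub>free_group X\<^esub>"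
      using w by (simp add: free_group_def one_presented_group)
    then show thesis
      using that[of 0 1] by simp
  next
    case False
    then show thesis
      using free_group_commuting_powers_aux[OF w(3,1) False assms(1)] assms(3) w(2) that by blast
  qed
qed

end

section \<open>The fundamental group of a tubular graph of groups\<close>

lemma word_eval_gen_class:
  "w \<in> words X \<Longrightarrow> word_eval (presented_group X R) (gen_class X R) w = word_class X R w"
proof (induction w)
  case Nil
  then show ?case by (simp add: one_presented_group)
next
  case (Cons l w)
  then show ?case
    using mult_presented_group[of "[l]" X w R] by (cases l) (auto simp: inv_gen_class)
qed

lemma word_eval_relator:
  assumes "r \<in> R" "r \<in> words X"
  shows "word_eval (presented_group X R) (gen_class X R) r = \<one>\<^bsub>presented_group X R\<^esub>"
  using assms word_eq.relator[of r R "[]" "[]" X]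
  by (simp add: word_eval_gen_class one_presented_group word_class_eq_iff)

locale tubular_group = tubular_graph_of_groups \<G>
  for \<G> :: "('v, 'e, 'g, 'h) graph_of_groups" +
  fixes T :: "('v, 'e) pre_digraph"
  assumes maximal_tree: "maximal_tree T (base_graph \<G>)"
begin

abbreviation "V \<equiv> verts (base_graph \<G>)"
abbreviation "E \<equiv> arcs (base_graph \<G>)"
abbreviation "src \<equiv> tail (base_graph \<G>)"
abbreviation "tgt \<equiv> head (base_graph \<G>)"
abbreviation "G \<equiv> fundamental_group \<G> T"

sublocale base: fin_digraph "base_graph \<G>"
  by (rule finite_base_graph)

lemma arcs_T: "arcs T \<subseteq> E"
  using maximal_tree by (auto simp: maximal_tree_def spanning_def subgraph_def)

lemma ends_in_V [simp]: "e \<in> E \<Longrightarrow> src e \<in> V" "e \<in> E \<Longrightarrow> tgt e \<in> V"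
  by auto

lemma V_nonempty: "V \<noteq> {}"
  using connected_base_graph by (auto simp: Digraph_Component.connected_def strongly_connected_def)

lemma tree_from: "r \<in> V \<Longrightarrow> rooted_tree src tgt E r V (arcs T)"
  using maximal_tree_imp_rooted_tree[OF maximal_tree] by simp

sublocale G: group G
  by (simp add: fundamental_group_def group_presented_group)

definition vx :: "'v \<Rightarrow> 'g \<Rightarrow> ('v, 'e, 'g) gen word set" where
  "vx v g = gen_class (gog_gens \<G>) (gog_relators \<G> T) (Vertex_Elt v g)"

definition st :: "'e \<Rightarrow> ('v, 'e, 'g) gen word set" where
  "st e = gen_class (gog_gens \<G>) (gog_relators \<G> T) (Stable_Letter e)"

lemma gens_simps [simp]:
  "Vertex_Elt v g \<in> gog_gens \<G> \<longleftrightarrow> v \<in> V \<and> g \<in> carrier (vertex_group \<G> v)"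
  "Stable_Letter e \<in> gog_gens \<G> \<longleftrightarrow> e \<in> E"
  by (auto simp: gog_gens_def)

lemma tail_map_closed [simp]:
  "e \<in> E \<Longrightarrow> c \<in> carrier (edge_group \<G> e) \<Longrightarrow> tail_map \<G> e c \<in> carrier (vertex_group \<G> (src e))"
  using tail_map_hom by (auto simp: hom_def)

lemma head_map_closed [simp]:
  "e \<in> E \<Longrightarrow> c \<in> carrier (edge_group \<G> e) \<Longrightarrow> head_map \<G> e c \<in> carrier (vertex_group \<G> (tgt e))"
  using head_map_hom by (auto simp: hom_def)

lemma vx_closed [simp]: "v \<in> V \<Longrightarrow> g \<in> carrier (vertex_group \<G> v) \<Longrightarrow> vx v g \<in> carrier G"
  by (simp add: vx_def fundamental_group_def)

lemma st_closed [simp]: "e \<in> E \<Longrightarrow> st e \<in> carrier G"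
  by (simp add: st_def fundamental_group_def)

lemma vx_hom:
  assumes "v \<in> V"
  shows "vx v \<in> hom (vertex_group \<G> v) G"
proof (rule homI)
  interpret A: group "vertex_group \<G> v"
    using assms by (rule group_vertex_group)
  fix g h assume gh: "g \<in> carrier (vertex_group \<G> v)" "h \<in> carrier (vertex_group \<G> v)"
  let ?r = "[(Vertex_Elt v g, True), (Vertex_Elt v h, True),
    (Vertex_Elt v (g \<otimes>\<^bsub>vertex_group \<G> v\<^esub> h), False)]"
  have "?r \<in> gog_relators \<G> T"
    using assms gh by (auto simp: gog_relators_def)
  moreover have "?r \<in> words (gog_gens \<G>)"
    using assms gh by simp
  ultimately have "word_eval G (gen_class (gog_gens \<G>) (gog_relators \<G> T)) ?r = \<one>\<^bsub>G\<^esub>"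
    unfolding fundamental_group_def by (rule word_eval_relator)
  then have "vx v g \<otimes>\<^bsub>G\<^esub> (vx v h \<otimes>\<^bsub>G\<^esub> (inv\<^bsub>G\<^esub> vx v (g \<otimes>\<^bsub>vertex_group \<G> v\<^esub> h) \<otimes>\<^bsub>G\<^esub> \<one>\<^bsub>G\<^esub>)) = \<one>\<^bsub>G\<^esub>"
    using assms gh by (simp add: vx_def)
  then have "vx v g \<otimes>\<^bsub>G\<^esub> vx v h \<otimes>\<^bsub>G\<^esub> inv\<^bsub>G\<^esub> vx v (g \<otimes>\<^bsub>vertex_group \<G> v\<^esub> h) = \<one>\<^bsub>G\<^esub>"
    using assms gh by (simp add: G.m_assoc)
  then show "vx v (g \<otimes>\<^bsub>vertex_group \<G> v\<^esub> h) = vx v g \<otimes>\<^bsub>G\<^esub> vx v h"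
    using assms gh by (metis A.m_closed G.m_closed G.inv_closed G.inv_equality G.inv_inv vx_closed)
qed (use assms in simp)

lemma st_vx:
  assumes "e \<in> E" "c \<in> carrier (edge_group \<G> e)"
  shows "st e \<otimes>\<^bsub>G\<^esub> vx (tgt e) (head_map \<G> e c) = vx (src e) (tail_map \<G> e c) \<otimes>\<^bsub>G\<^esub> st e"
proof -
  let ?r = "[(Stable_Letter e, True), (Vertex_Elt (tgt e) (head_map \<G> e c), True),
      (Stable_Letter e, False), (Vertex_Elt (src e) (tail_map \<G> e c), False)]"
  have "?r \<in> gog_relators \<G> T"
    using assms by (auto simp: gog_relators_def)
  moreover have "?r \<in> words (gog_gens \<G>)"
    using assms by simp
  ultimately have "word_eval G (gen_class (gog_gens \<G>) (gog_relators \<G> T)) ?r = \<one>\<^bsub>G\<^esub>"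
    unfolding fundamental_group_def by (rule word_eval_relator)
  then have "st e \<otimes>\<^bsub>G\<^esub> (vx (tgt e) (head_map \<G> e c) \<otimes>\<^bsub>G\<^esub> (inv\<^bsub>G\<^esub> st e \<otimes>\<^bsub>G\<^esub>
      (inv\<^bsub>G\<^esub> vx (src e) (tail_map \<G> e c) \<otimes>\<^bsub>G\<^esub> \<one>\<^bsub>G\<^esub>))) = \<one>\<^bsub>G\<^esub>"
    using assms by (simp add: vx_def st_def)
  then have "st e \<otimes>\<^bsub>G\<^esub> vx (tgt e) (head_map \<G> e c) \<otimes>\<^bsub>G\<^esub>
      inv\<^bsub>G\<^esub> (vx (src e) (tail_map \<G> e c) \<otimes>\<^bsub>G\<^esub> st e) = \<one>\<^bsub>G\<^esub>"
    using assms by (simp add: G.m_assoc G.inv_mult_group)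
  then show ?thesis
    using assms by (metis G.m_closed G.inv_closed G.inv_equality G.inv_inv vx_closed st_closed
        ends_in_V tail_map_closed head_map_closed)
qed

lemma st_tree:
  assumes "e \<in> arcs T"
  shows "st e = \<one>\<^bsub>G\<^esub>"
proof -
  have "[(Stable_Letter e, True)] \<in> gog_relators \<G> T"
    using assms by (auto simp: gog_relators_def)
  moreover have "[(Stable_Letter e, True)] \<in> words (gog_gens \<G>)"
    using assms arcs_T by auto
  ultimately have "word_eval G (gen_class (gog_gens \<G>) (gog_relators \<G> T)) [(Stable_Letter e, True)] = \<one>\<^bsub>G\<^esub>"
    unfolding fundamental_group_def by (rule word_eval_relator)
  moreover have "st e \<in> carrier G"
    using assms arcs_T by auto
  ultimately show ?thesis
    by (simp add: st_def)
qed

lemma generators: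
  assumes "subgroup B G"
    and "\<And>v g. v \<in> V \<Longrightarrow> g \<in> carrier (vertex_group \<G> v) \<Longrightarrow> vx v g \<in> B"
    and "\<And>e. e \<in> E \<Longrightarrow> st e \<in> B"
  shows "B = carrier G"
  unfolding fundamental_group_def
proof (rule presented_group_generators)
  show "subgroup B (presented_group (gog_gens \<G>) (gog_relators \<G> T))"
    using assms(1) by (simp add: fundamental_group_def)
  show "gen_class (gog_gens \<G>) (gog_relators \<G> T) x \<in> B" if "x \<in> gog_gens \<G>" for x
    using that assms(2,3) by (cases x) (auto simp: vx_def st_def)
qed

lemma homs_eq:
  assumes "group L" "\<Phi> \<in> hom G L" "\<Psi> \<in> hom G L"
    and "\<And>v g. v \<in> V \<Longrightarrow> g \<in> carrier (vertex_group \<G> v) \<Longrightarrow> \<Phi> (vx v g) = \<Psi> (vx v g)"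
    and "\<And>e. e \<in> E \<Longrightarrow> \<Phi> (st e) = \<Psi> (st e)"
    and "x \<in> carrier G"
  shows "\<Phi> x = \<Psi> x"
proof (rule presented_group_hom_eq[OF assms(1)])
  show "\<Phi> (gen_class (gog_gens \<G>) (gog_relators \<G> T) x)
      = \<Psi> (gen_class (gog_gens \<G>) (gog_relators \<G> T) x)" if "x \<in> gog_gens \<G>" for x
    using that assms(4,5) by (cases x) (auto simp: vx_def st_def)
qed (use assms in \<open>auto simp: fundamental_group_def\<close>)

text \<open>Universal property of the fundamental group: \<open>\<rho>\<close>, \<open>rel\<close>
  and \<open>tree\<close> account for the three families of relators.\<close>

lemma hom_exists:
  assumes L: "group L"
    and \<rho>: "\<And>v. v \<in> V \<Longrightarrow> \<rho> v \<in> hom (vertex_group \<G> v) L"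
    and t: "\<And>e. e \<in> E \<Longrightarrow> t e \<in> carrier L"
    and rel: "\<And>e c. e \<in> E \<Longrightarrow> c \<in> carrier (edge_group \<G> e) \<Longrightarrow>
      t e \<otimes>\<^bsub>L\<^esub> \<rho> (tgt e) (head_map \<G> e c) = \<rho> (src e) (tail_map \<G> e c) \<otimes>\<^bsub>L\<^esub> t e"
    and tree: "\<And>e. e \<in> arcs T \<Longrightarrow> t e = \<one>\<^bsub>L\<^esub>"
  obtains \<Phi> where "\<Phi> \<in> hom G L"
    "\<And>v g. v \<in> V \<Longrightarrow> g \<in> carrier (vertex_group \<G> v) \<Longrightarrow> \<Phi> (vx v g) = \<rho> v g"
    "\<And>e. e \<in> E \<Longrightarrow> \<Phi> (st e) = t e"
proof -
  interpret L: group L by fact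
  define f where "f x = (case x of Vertex_Elt v g \<Rightarrow> \<rho> v g | Stable_Letter e \<Rightarrow> t e)" for x
  have \<rho>_closed: "\<rho> v g \<in> carrier L" if "v \<in> V" "g \<in> carrier (vertex_group \<G> v)" for v g
    using \<rho>[OF that(1)] that(2) by (auto simp: hom_def)
  have f: "f \<in> gog_gens \<G> \<rightarrow> carrier L"
    using \<rho>_closed t by (auto simp: f_def gog_gens_def)
  have "word_eval L f r = \<one>\<^bsub>L\<^esub>" if r: "r \<in> gog_relators \<G> T" for r
  proof -
    consider (mult) v g h where "v \<in> V" "g \<in> carrier (vertex_group \<G> v)" "h \<in> carrier (vertex_group \<G> v)"
        "r = [(Vertex_Elt v g, True), (Vertex_Elt v h, True), (Vertex_Elt v (g \<otimes>\<^bsub>vertex_group \<G> v\<^esub> h), False)]"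
      | (edge) e c where "e \<in> E" "c \<in> carrier (edge_group \<G> e)"
        "r = [(Stable_Letter e, True), (Vertex_Elt (tgt e) (head_map \<G> e c), True),
          (Stable_Letter e, False), (Vertex_Elt (src e) (tail_map \<G> e c), False)]"
      | (tree) e where "e \<in> arcs T" "r = [(Stable_Letter e, True)]"
      using r unfolding gog_relators_def by blast
    then show ?thesis
    proof cases
      case mult
      interpret A: group "vertex_group \<G> v"
        using mult(1) by (rule group_vertex_group)
      have "\<rho> v (g \<otimes>\<^bsub>vertex_group \<G> v\<^esub> h) = \<rho> v g \<otimes>\<^bsub>L\<^esub> \<rho> v h"
        using \<rho>[OF mult(1)] mult by (simp add: hom_mult)
      then show ?thesis
        using mult by (simp add: f_def \<rho>_closed L.group_normalize)
    next
      case edge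
      have *: "\<rho> (tgt e) (head_map \<G> e c) \<in> carrier L" "\<rho> (src e) (tail_map \<G> e c) \<in> carrier L"
        using edge \<rho>_closed by simp_all
      have "word_eval L f r = (t e \<otimes>\<^bsub>L\<^esub> \<rho> (tgt e) (head_map \<G> e c)) \<otimes>\<^bsub>L\<^esub>
          inv\<^bsub>L\<^esub> (\<rho> (src e) (tail_map \<G> e c) \<otimes>\<^bsub>L\<^esub> t e)"
        using edge * t by (simp add: f_def L.group_normalize)
      also have "\<dots> = \<one>\<^bsub>L\<^esub>"
        unfolding rel[OF edge(1,2)] using * t edge by simp
      finally show ?thesis .
    next
      case tree
      then show ?thesis
        using assms(5) by (simp add: f_def)
    qed
  qed
  from presented_group_hom_exists[OF L f this] obtain \<Phi> where
    "\<Phi> \<in> hom (presented_group (gog_gens \<G>) (gog_relators \<G> T)) L"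
    "\<And>x. x \<in> gog_gens \<G> \<Longrightarrow> \<Phi> (gen_class (gog_gens \<G>) (gog_relators \<G> T) x) = f x"
    by blast
  then show thesis
    by (intro that[of \<Phi>]) (auto simp: fundamental_group_def vx_def st_def f_def)
qed

text \<open>Conjugating by a potential on the tree trivializes the images of its stable letters.\<close>

lemma twisted_hom_exists:
  assumes L: "group L"
    and \<rho>: "\<And>v. v \<in> V \<Longrightarrow> \<rho> v \<in> hom (vertex_group \<G> v) L"
    and t: "\<And>e. e \<in> E \<Longrightarrow> t e \<in> carrier L"
    and rel: "\<And>e c. e \<in> E \<Longrightarrow> c \<in> carrier (edge_group \<G> e) \<Longrightarrow>
      t e \<otimes>\<^bsub>L\<^esub> \<rho> (tgt e) (head_map \<G> e c) = \<rho> (src e) (tail_map \<G> e c) \<otimes>\<^bsub>L\<^esub> t e"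
    and p: "\<And>v. p v \<in> carrier L" "\<And>e. e \<in> arcs T \<Longrightarrow> p (src e) \<otimes>\<^bsub>L\<^esub> t e = p (tgt e)"
  obtains \<Phi> where "\<Phi> \<in> hom G L"
    "\<And>v g. v \<in> V \<Longrightarrow> g \<in> carrier (vertex_group \<G> v) \<Longrightarrow>
      \<Phi> (vx v g) = p v \<otimes>\<^bsub>L\<^esub> \<rho> v g \<otimes>\<^bsub>L\<^esub> inv\<^bsub>L\<^esub> p v"
    "\<And>e. e \<in> E \<Longrightarrow> \<Phi> (st e) = p (src e) \<otimes>\<^bsub>L\<^esub> t e \<otimes>\<^bsub>L\<^esub> inv\<^bsub>L\<^esub> p (tgt e)"
proof -
  interpret L: group L by fact
  have \<rho>_closed: "\<rho> v g \<in> carrier L" if "v \<in> V" "g \<in> carrier (vertex_group \<G> v)" for v g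
    using \<rho>[OF that(1)] that(2) by (auto simp: hom_def)
  show thesis
  proof (rule hom_exists[OF L, of "\<lambda>v g. p v \<otimes>\<^bsub>L\<^esub> \<rho> v g \<otimes>\<^bsub>L\<^esub> inv\<^bsub>L\<^esub> p v"
        "\<lambda>e. p (src e) \<otimes>\<^bsub>L\<^esub> t e \<otimes>\<^bsub>L\<^esub> inv\<^bsub>L\<^esub> p (tgt e)"])
    show "(\<lambda>g. p v \<otimes>\<^bsub>L\<^esub> \<rho> v g \<otimes>\<^bsub>L\<^esub> inv\<^bsub>L\<^esub> p v) \<in> hom (vertex_group \<G> v) L" if "v \<in> V" for v
      using hom_compose[OF \<rho>[OF that] L.conj_hom[OF p(1)[of v]]] by (simp add: comp_def)
    show "p (src e) \<otimes>\<^bsub>L\<^esub> t e \<otimes>\<^bsub>L\<^esub> inv\<^bsub>L\<^esub> p (tgt e) \<in> carrier L" if "e \<in> E" for e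
      using p(1) t[OF that] by simp
    show "p (src e) \<otimes>\<^bsub>L\<^esub> t e \<otimes>\<^bsub>L\<^esub> inv\<^bsub>L\<^esub> p (tgt e) \<otimes>\<^bsub>L\<^esub>
        (p (tgt e) \<otimes>\<^bsub>L\<^esub> \<rho> (tgt e) (head_map \<G> e c) \<otimes>\<^bsub>L\<^esub> inv\<^bsub>L\<^esub> p (tgt e)) =
        p (src e) \<otimes>\<^bsub>L\<^esub> \<rho> (src e) (tail_map \<G> e c) \<otimes>\<^bsub>L\<^esub> inv\<^bsub>L\<^esub> p (src e) \<otimes>\<^bsub>L\<^esub>
        (p (src e) \<otimes>\<^bsub>L\<^esub> t e \<otimes>\<^bsub>L\<^esub> inv\<^bsub>L\<^esub> p (tgt e))"
      if e: "e \<in> E" "c \<in> carrier (edge_group \<G> e)" for e c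
    proof -
      have *: "\<rho> (tgt e) (head_map \<G> e c) \<in> carrier L" "\<rho> (src e) (tail_map \<G> e c) \<in> carrier L"
        using e \<rho>_closed by simp_all
      have "p (src e) \<otimes>\<^bsub>L\<^esub> (t e \<otimes>\<^bsub>L\<^esub> \<rho> (tgt e) (head_map \<G> e c)) \<otimes>\<^bsub>L\<^esub> inv\<^bsub>L\<^esub> p (tgt e) =
          p (src e) \<otimes>\<^bsub>L\<^esub> (\<rho> (src e) (tail_map \<G> e c) \<otimes>\<^bsub>L\<^esub> t e) \<otimes>\<^bsub>L\<^esub> inv\<^bsub>L\<^esub> p (tgt e)"
        unfolding rel[OF e] ..
      then show ?thesis
        using * p(1) t[OF e(1)] by (simp add: L.group_normalize)
    qed
    show "p (src e) \<otimes>\<^bsub>L\<^esub> t e \<otimes>\<^bsub>L\<^esub> inv\<^bsub>L\<^esub> p (tgt e) = \<one>\<^bsub>L\<^esub>" if "e \<in> arcs T" for e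
      unfolding p(2)[OF that] using p(1) by simp
  qed (use that in blast)
qed

lemma nonzero_iff:
  "nonzero_on_edge_group \<G> T \<chi> e \<longleftrightarrow>
    (\<exists>c\<in>carrier (edge_group \<G> e). \<chi> (vx (src e) (tail_map \<G> e c)) \<noteq> 0)"
  by (auto simp: nonzero_on_edge_group_def edge_group_image_def vx_def)

end

section \<open>Coordinates on the vertex groups and generators of the edge groups\<close>

context tubular_group
begin

definition coord :: "'v \<Rightarrow> 'g \<Rightarrow> int \<times> int" where
  "coord v = (SOME f. f \<in> iso (vertex_group \<G> v) (integer_group \<times>\<times> integer_group))"

lemma coord_iso:
  assumes "v \<in> V"
  shows "coord v \<in> iso (vertex_group \<G> v) (integer_group \<times>\<times> integer_group)"
proof -
  have "\<exists>f. f \<in> iso (vertex_group \<G> v) (integer_group \<times>\<times> integer_group)"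
    using vertex_group_iso[OF assms] by (simp add: is_iso_def ex_in_conv)
  then show ?thesis
    unfolding coord_def by (rule someI_ex)
qed

lemma coord_mult:
  assumes "v \<in> V" "x \<in> carrier (vertex_group \<G> v)" "y \<in> carrier (vertex_group \<G> v)"
  shows "coord v (x \<otimes>\<^bsub>vertex_group \<G> v\<^esub> y) =
    (fst (coord v x) + fst (coord v y), snd (coord v x) + snd (coord v y))"
  using coord_iso[OF assms(1)] assms(2,3)
  by (auto simp: iso_def hom_def DirProd_def integer_group_def case_prod_unfold)

lemma coord_inj:
  assumes "v \<in> V" "x \<in> carrier (vertex_group \<G> v)" "y \<in> carrier (vertex_group \<G> v)"
    and "coord v x = coord v y"
  shows "x = y"
  using coord_iso[OF assms(1)] assms(2-4) by (auto simp: iso_def bij_betw_def inj_on_def)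

lemma coord_surj:
  assumes "v \<in> V"
  obtains x where "x \<in> carrier (vertex_group \<G> v)" "coord v x = z"
proof -
  have "coord v ` carrier (vertex_group \<G> v) = UNIV"
    using coord_iso[OF assms] by (auto simp: iso_def bij_betw_def DirProd_def integer_group_def)
  then show thesis
    using that by (metis UNIV_I imageE)
qed

lemma vertex_group_comm:
  assumes "v \<in> V" "x \<in> carrier (vertex_group \<G> v)" "y \<in> carrier (vertex_group \<G> v)"
  shows "x \<otimes>\<^bsub>vertex_group \<G> v\<^esub> y = y \<otimes>\<^bsub>vertex_group \<G> v\<^esub> x"
proof -
  interpret A: group "vertex_group \<G> v"
    using assms(1) by (rule group_vertex_group)
  show ?thesis
    using assms by (intro coord_inj) (auto simp: coord_mult)
qed

lemma vx_comm:
  assumes "v \<in> V" "x \<in> carrier (vertex_group \<G> v)" "y \<in> carrier (vertex_group \<G> v)"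
  shows "vx v x \<otimes>\<^bsub>G\<^esub> vx v y = vx v y \<otimes>\<^bsub>G\<^esub> vx v x"
  using assms vertex_group_comm[OF assms] by (metis hom_mult vx_hom)

lemma edge_generator_exists:
  assumes "e \<in> E"
  obtains c where "c \<in> carrier (edge_group \<G> e)" "c \<noteq> \<one>\<^bsub>edge_group \<G> e\<^esub>"
    "\<And>x. x \<in> carrier (edge_group \<G> e) \<Longrightarrow> \<exists>n::int. x = c [^]\<^bsub>edge_group \<G> e\<^esub> n"
proof -
  interpret C: group "edge_group \<G> e"
    using assms by (rule group_edge_group)
  obtain f where f: "f \<in> iso (edge_group \<G> e) integer_group"
    using edge_group_iso[OF assms] by (auto simp: is_iso_def)
  then have f_hom: "f \<in> hom (edge_group \<G> e) integer_group" and
    f_bij: "bij_betw f (carrier (edge_group \<G> e)) UNIV"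
    by (auto simp: iso_def)
  then obtain c where c: "c \<in> carrier (edge_group \<G> e)" "f c = 1"
    by (metis UNIV_I bij_betw_imp_surj_on imageE)
  have pow: "f (c [^]\<^bsub>edge_group \<G> e\<^esub> n) = n" for n :: int
    using hom_int_pow[OF f_hom c(1) C.group_axioms group_integer_group, of n] c(2) by simp
  show thesis
  proof (rule that[OF c(1)])
    show "c \<noteq> \<one>\<^bsub>edge_group \<G> e\<^esub>"
      using pow[of 0] c(2) by auto
    show "\<exists>n::int. x = c [^]\<^bsub>edge_group \<G> e\<^esub> n" if "x \<in> carrier (edge_group \<G> e)" for x
      using that f_bij pow c(1) by (metis C.int_pow_closed bij_betw_imp_inj_on inj_on_def)
  qed
qed

end

lemma (in group) commute_mult:
  assumes "x \<in> carrier G" "y \<in> carrier G" "c \<in> carrier G" "x \<otimes> c = c \<otimes> x" "y \<otimes> c = c \<otimes> y"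
  shows "(x \<otimes> y) \<otimes> c = c \<otimes> (x \<otimes> y)"
  using assms by (metis m_assoc)

lemma (in group) commute_inv:
  assumes "x \<in> carrier G" "c \<in> carrier G" "x \<otimes> c = c \<otimes> x"
  shows "inv x \<otimes> c = c \<otimes> inv x"
proof -
  have "inv x \<otimes> (x \<otimes> c) \<otimes> inv x = inv x \<otimes> (c \<otimes> x) \<otimes> inv x"
    using assms(3) by simp
  then show ?thesis
    using assms(1,2) by (simp add: group_normalize)
qed

section \<open>Projections of free by cyclic groups to the integers\<close>

lemma BijGroup_UNIV_simps:
  "f \<in> carrier (BijGroup UNIV) \<longleftrightarrow> bij f"
  "bij f \<Longrightarrow> bij g \<Longrightarrow> f \<otimes>\<^bsub>BijGroup UNIV\<^esub> g = f \<circ> g"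
  "\<one>\<^bsub>BijGroup UNIV\<^esub> = id"
  by (auto simp: BijGroup_def Bij_def compose_def)

text \<open>In the coordinate \<open>w = z / p\<close> this is \<open>w + a + b * Im w\<close>, a
  real translation combined with a horizontal shear. It preserves \<open>Im w\<close>, so for fixed
  \<open>p\<close> these maps commute and their parameters add.\<close>

definition shear :: "complex \<Rightarrow> real \<Rightarrow> real \<Rightarrow> complex \<Rightarrow> complex" where
  "shear p a b z = z + p * of_real (a + b * Im (z / p))"

lemma shear_comp:
  assumes "p \<noteq> 0"
  shows "shear p a b \<circ> shear p a' b' = shear p (a + a') (b + b')"
proof
  fix z
  have "Im (shear p a' b' z / p) = Im (z / p)"
    using assms by (simp add: shear_def add_divide_distrib)
  then show "(shear p a b \<circ> shear p a' b') z = shear p (a + a') (b + b') z"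
    by (simp add: shear_def algebra_simps)
qed

lemma bij_shear:
  assumes "p \<noteq> 0"
  shows "bij (shear p a b)"
proof (rule o_bij)
  show "shear p (- a) (- b) \<circ> shear p a b = id" "shear p a b \<circ> shear p (- a) (- b) = id"
    unfolding shear_comp[OF assms] by (auto simp: shear_def)
qed

lemma shear_int_pow:
  assumes "p \<noteq> 0"
  shows "shear p a b [^]\<^bsub>BijGroup UNIV\<^esub> (k::int) = shear p (of_int k * a) (of_int k * b)"
proof -
  have "(\<lambda>k. shear p (of_int k * a) (of_int k * b)) \<in> hom integer_group (BijGroup UNIV)"
    by (rule homI)
      (auto simp: BijGroup_UNIV_simps bij_shear[OF assms] shear_comp[OF assms] algebra_simps)
  from hom_int_pow[OF this _ group_integer_group group_BijGroup, of 1 k] show ?thesis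
    by simp
qed

context tubular_group
begin

text \<open>The character is the projection of the semidirect product. Its vanishing on
  \<open>e0\<close> places \<open>c\<close> in the kernel, while \<open>y\<close> lies there as a
  commutator; the action on \<complex> is built independently of the character.\<close>

lemma nonzero_if_free_by_cyclic:
  assumes "free_by_cyclic G"
  shows "\<exists>\<chi>\<in>hom G integer_group. \<forall>e\<in>E. nonzero_on_edge_group \<G> T \<chi> e"
proof -
  obtain n :: nat and \<alpha> h where \<alpha>: "\<alpha> \<in> auto (free_group {..<n})"
    and h: "h \<in> iso G (semidirect_int (free_group {..<n}) \<alpha>)"
    using assms by (auto simp: free_by_cyclic_def is_iso_def)
  let ?F = "free_group {..<n}"
  let ?S = "semidirect_int ?F \<alpha>"
  interpret F: group ?F
    by (rule group_free_group)
  have h_bij: "bij_betw h (carrier G) (carrier ?F \<times> UNIV)" and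
    h_hom: "h \<in> hom G ?S"
    using h by (auto simp: iso_def semidirect_int_def)
  define \<chi> where "\<chi> = snd \<circ> h"
  have \<chi>: "\<chi> \<in> hom G integer_group"
    using h_hom by (auto simp: \<chi>_def hom_def semidirect_int_def case_prod_unfold)
  \<comment> \<open>The action involved is the zeroth power of \<open>\<alpha>\<close>, the identity
    of \<open>AutoGroup\<close>. Being extensional, it fixes \<open>g\<close> only on the carrier,
    hence the condition on \<open>g\<close>.\<close>
  have mult0: "(f, 0) \<otimes>\<^bsub>?S\<^esub> (g, 0) = (f \<otimes>\<^bsub>?F\<^esub> g, 0)" if "g \<in> carrier ?F" for f g
    using that by (simp add: semidirect_int_def AutoGroup_def BijGroup_def)
  define j where "j f = inv_into (carrier G) h (f, 0)" for f
  have j: "j f \<in> carrier G" "h (j f) = (f, 0)" if "f \<in> carrier ?F" for f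
    using that h_bij by (auto simp: j_def bij_betw_def f_inv_into_f intro: inv_into_into)
  have j_hom: "j \<in> hom ?F G"
  proof (rule homI)
    fix f g assume fg: "f \<in> carrier ?F" "g \<in> carrier ?F"
    have "h (j f \<otimes>\<^bsub>G\<^esub> j g) = h (j (f \<otimes>\<^bsub>?F\<^esub> g))"
      using fg j hom_mult[OF h_hom] mult0 by simp
    then show "j (f \<otimes>\<^bsub>?F\<^esub> g) = j f \<otimes>\<^bsub>G\<^esub> j g"
      using h_bij fg j by (auto simp: bij_betw_def inj_on_def)
  qed (use j in auto)
  have ker: "\<exists>f\<in>carrier ?F. x = j f" if "x \<in> carrier G" "\<chi> x = 0" for x
  proof
    have "h x \<in> carrier ?F \<times> UNIV"
      using that h_bij by (auto simp: bij_betw_def)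
    then show "fst (h x) \<in> carrier ?F"
      by auto
    show "x = j (fst (h x))"
      using that h_bij by (simp add: j_def \<chi>_def bij_betw_def flip: surjective_pairing)
        (metis \<open>h x \<in> carrier ?F \<times> UNIV\<close> comp_apply inv_into_f_f prod.collapse)
  qed
  have commuting: "\<exists>(k::int) (l::int). (k \<noteq> 0 \<or> l \<noteq> 0) \<and> y [^]\<^bsub>G\<^esub> k = c [^]\<^bsub>G\<^esub> l"
    if yc: "y \<in> carrier G" "c \<in> carrier G" "\<chi> y = 0" "\<chi> c = 0"
      "y \<otimes>\<^bsub>G\<^esub> c = c \<otimes>\<^bsub>G\<^esub> y" for y c
  proof -
    obtain f g where f: "f \<in> carrier ?F" "y = j f" and g: "g \<in> carrier ?F" "c = j g"
      using ker[OF yc(1,3)] ker[OF yc(2,4)] by blast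
    have "(f \<otimes>\<^bsub>?F\<^esub> g, 0) = h (y \<otimes>\<^bsub>G\<^esub> c)" "(g \<otimes>\<^bsub>?F\<^esub> f, 0) = h (c \<otimes>\<^bsub>G\<^esub> y)"
      using f g j hom_mult[OF h_hom] mult0 by simp_all
    with yc(5) have "f \<otimes>\<^bsub>?F\<^esub> g = g \<otimes>\<^bsub>?F\<^esub> f"
      by (metis prod.inject)
    then obtain k l :: int where kl: "k \<noteq> 0 \<or> l \<noteq> 0" "f [^]\<^bsub>?F\<^esub> k = g [^]\<^bsub>?F\<^esub> l"
      using free_group_commuting_powers f(1) g(1) by blast
    then have "y [^]\<^bsub>G\<^esub> k = c [^]\<^bsub>G\<^esub> l"
      using hom_int_pow[OF j_hom _ F.group_axioms G.group_axioms] f g by metis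
    with kl(1) show ?thesis
      by blast
  qed
  show ?thesis
  proof (intro bexI ballI, rule ccontr)
    fix e0 assume e0: "e0 \<in> E" and zero: "\<not> nonzero_on_edge_group \<G> T \<chi> e0"
    define gen where "gen e = (SOME c. c \<in> carrier (edge_group \<G> e) \<and> c \<noteq> \<one>\<^bsub>edge_group \<G> e\<^esub> \<and>
      (\<forall>x\<in>carrier (edge_group \<G> e). \<exists>n::int. x = c [^]\<^bsub>edge_group \<G> e\<^esub> n))" for e
    have gen_all: "gen e \<in> carrier (edge_group \<G> e) \<and> gen e \<noteq> \<one>\<^bsub>edge_group \<G> e\<^esub> \<and>
      (\<forall>x\<in>carrier (edge_group \<G> e). \<exists>n::int. x = gen e [^]\<^bsub>edge_group \<G> e\<^esub> n)" if "e \<in> E" for e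
      unfolding gen_def by (rule someI_ex) (metis edge_generator_exists[OF that])
    \<comment> \<open>The vertex groups become the lattice of Gaussian integers, so that edge
      translations can be divided by one another in \<complex>.\<close>
    define z where "z v x = Complex (of_int (fst (coord v x))) (of_int (snd (coord v x)))" for v x
    have z_mult: "z v (x \<otimes>\<^bsub>vertex_group \<G> v\<^esub> y) = z v x + z v y"
      if "v \<in> V" "x \<in> carrier (vertex_group \<G> v)" "y \<in> carrier (vertex_group \<G> v)" for v x y
      using that by (simp add: z_def coord_mult complex_eq_iff)
    have z_pow: "z v (x [^]\<^bsub>vertex_group \<G> v\<^esub> k) = of_int k * z v x"
      if "v \<in> V" "x \<in> carrier (vertex_group \<G> v)" for v x and k :: int
    proof -
      interpret A: group "vertex_group \<G> v"
        using that(1) by (rule group_vertex_group)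
      have nat: "z v (x [^]\<^bsub>vertex_group \<G> v\<^esub> m) = of_nat m * z v x" for m :: nat
      proof (induction m)
        case 0
        have "z v (\<one>\<^bsub>vertex_group \<G> v\<^esub> \<otimes>\<^bsub>vertex_group \<G> v\<^esub> \<one>\<^bsub>vertex_group \<G> v\<^esub>) =
            z v \<one>\<^bsub>vertex_group \<G> v\<^esub> + z v \<one>\<^bsub>vertex_group \<G> v\<^esub>"
          using that(1) by (intro z_mult) auto
        then show ?case by simp
      qed (use that in \<open>simp add: z_mult algebra_simps\<close>)
      have "z v (inv\<^bsub>vertex_group \<G> v\<^esub> y) = - z v y" if y: "y \<in> carrier (vertex_group \<G> v)" for y
      proof -
        have "z v (inv\<^bsub>vertex_group \<G> v\<^esub> y) + z v y
            = z v (inv\<^bsub>vertex_group \<G> v\<^esub> y \<otimes>\<^bsub>vertex_group \<G> v\<^esub> y)"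
          by (rule z_mult[OF \<open>v \<in> V\<close> _ y, symmetric]) (use y in simp)
        also have "\<dots> = 0"
          using nat[of 0] y by simp
        finally show ?thesis
          by (simp add: eq_neg_iff_add_eq_0)
      qed
      with nat that show ?thesis
        by (cases k rule: int_cases2) (auto simp: int_pow_int A.int_pow_neg)
    qed
    have z_nonzero: "z v x \<noteq> 0"
      if "v \<in> V" "x \<in> carrier (vertex_group \<G> v)" "x \<noteq> \<one>\<^bsub>vertex_group \<G> v\<^esub>" for v x
    proof -
      interpret A: group "vertex_group \<G> v"
        using that(1) by (rule group_vertex_group)
      have "z v \<one>\<^bsub>vertex_group \<G> v\<^esub> = 0"
        using z_pow[OF that(1) A.one_closed, of 0] by simp
      moreover have "coord v x \<noteq> coord v \<one>\<^bsub>vertex_group \<G> v\<^esub>"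
        using that coord_inj A.one_closed by blast
      ultimately show ?thesis
        by (auto simp: z_def complex_eq_iff prod_eq_iff)
    qed
    define p where "p e = z (src e) (tail_map \<G> e (gen e))" for e
    define q where "q e = z (tgt e) (head_map \<G> e (gen e))" for e
    have ends: "z (src e) (tail_map \<G> e (gen e [^]\<^bsub>edge_group \<G> e\<^esub> k)) = of_int k * p e"
      "z (tgt e) (head_map \<G> e (gen e [^]\<^bsub>edge_group \<G> e\<^esub> k)) = of_int k * q e"
      if "e \<in> E" for e and k :: int
      using hom_int_pow[OF tail_map_hom[OF that] _ group_edge_group[OF that] group_vertex_group]
        hom_int_pow[OF head_map_hom[OF that] _ group_edge_group[OF that] group_vertex_group]
        that gen_all[OF that] by (simp_all add: z_pow p_def q_def)
    have pq: "p e \<noteq> 0" "q e \<noteq> 0" if "e \<in> E" for e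
    proof -
      interpret C: group "edge_group \<G> e"
        using that by (rule group_edge_group)
      have "tail_map \<G> e (gen e) \<noteq> tail_map \<G> e \<one>\<^bsub>edge_group \<G> e\<^esub>"
        "head_map \<G> e (gen e) \<noteq> head_map \<G> e \<one>\<^bsub>edge_group \<G> e\<^esub>"
        using tail_map_inj[OF that] head_map_inj[OF that] gen_all[OF that] by (auto simp: inj_on_def)
      then show "p e \<noteq> 0" "q e \<noteq> 0"
        unfolding p_def q_def using that gen_all[OF that]
          hom_one[OF tail_map_hom[OF that] C.group_axioms group_vertex_group]
          hom_one[OF head_map_hom[OF that] C.group_axioms group_vertex_group]
        by (simp_all add: z_nonzero)
    qed
    \<comment> \<open>In the coordinates \<open>w / q e\<close> at the head and
      \<open>w / p e\<close> at the tail, both translations by the edge generator become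
      \<open>w + 1\<close>. The map \<open>\<kappa> e\<close> commutes with \<open>w + 1\<close>,
      since it adds to \<open>w\<close> a function of \<open>Im w\<close>; hence \<open>t e\<close>
      satisfies the edge relation.\<close>
    define \<kappa> where "\<kappa> e w = w + (if e = e0 then of_real (Im w ^ 3) else 0 :: complex)" for e w
    define t where "t e w = p e * \<kappa> e (w / q e)" for e w
    define \<rho> where "\<rho> v x w = w + z v x" for v x w
    let ?L = "BijGroup (UNIV :: complex set)"
    interpret L: group ?L
      by (rule group_BijGroup)
    have bij_\<rho>: "bij (\<rho> v x)" for v x
      by (rule o_bij[of "\<lambda>w. w - z v x"]) (auto simp: \<rho>_def)
    have bij_t: "bij (t e)" if "e \<in> E" for e
      by (rule o_bij[of "\<lambda>w. q e * (w / p e - (if e = e0 then of_real (Im (w / p e) ^ 3) else 0))"])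
        (use pq[OF that] in \<open>auto simp: t_def \<kappa>_def fun_eq_iff add_divide_distrib\<close>)
    then have t_closed: "t e \<in> carrier ?L" if "e \<in> E" for e
      using that by (simp add: BijGroup_UNIV_simps)
    have rel: "t e \<otimes>\<^bsub>?L\<^esub> \<rho> (tgt e) (head_map \<G> e c) = \<rho> (src e) (tail_map \<G> e c) \<otimes>\<^bsub>?L\<^esub> t e"
      if e: "e \<in> E" and c: "c \<in> carrier (edge_group \<G> e)" for e c
    proof -
      obtain k :: int where k: "c = gen e [^]\<^bsub>edge_group \<G> e\<^esub> k"
        using gen_all[OF e] c by blast
      have "t e (w + of_int k * q e) = t e w + of_int k * p e" for w
        using pq[OF e] by (simp add: t_def \<kappa>_def add_divide_distrib algebra_simps)
      then show ?thesis
        using e by (auto simp: BijGroup_UNIV_simps bij_\<rho> bij_t k \<rho>_def ends)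
    qed
    have \<rho>_hom: "\<rho> v \<in> hom (vertex_group \<G> v) ?L" if "v \<in> V" for v
      using that by (intro homI) (auto simp: BijGroup_UNIV_simps bij_\<rho> \<rho>_def z_mult fun_eq_iff)
    obtain r where "r \<in> V"
      using V_nonempty by blast
    obtain P where P: "\<And>v. P v \<in> carrier ?L" "\<And>e. e \<in> arcs T \<Longrightarrow> P (src e) \<otimes>\<^bsub>?L\<^esub> t e = P (tgt e)"
      using L.rooted_tree_potential[OF tree_from[OF \<open>r \<in> V\<close>], of t] t_closed arcs_T by blast
    obtain \<Phi> where \<Phi>: "\<Phi> \<in> hom G ?L"
      "\<And>v g. v \<in> V \<Longrightarrow> g \<in> carrier (vertex_group \<G> v) \<Longrightarrow>
        \<Phi> (vx v g) = P v \<otimes>\<^bsub>?L\<^esub> \<rho> v g \<otimes>\<^bsub>?L\<^esub> inv\<^bsub>?L\<^esub> P v"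
      "\<And>e. e \<in> E \<Longrightarrow> \<Phi> (st e) = P (src e) \<otimes>\<^bsub>?L\<^esub> t e \<otimes>\<^bsub>?L\<^esub> inv\<^bsub>?L\<^esub> P (tgt e)"
      using twisted_hom_exists[OF L.group_axioms \<rho>_hom t_closed rel P] by blast
    interpret \<Phi>: group_hom G ?L \<Phi>
      by (intro group_hom.intro group_hom_axioms.intro G.group_axioms L.group_axioms \<Phi>(1))
    define u where "u = src e0"
    define v where "v = tgt e0"
    have uv: "u \<in> V" "v \<in> V"
      using e0 by (auto simp: u_def v_def)
    \<comment> \<open>Multiplication by \<i> preserves the Gaussian integers. It provides a vertex
      element translating at a right angle to the edge generator, hence not commensurable with
      it.\<close>
    have rotate: "\<exists>b\<in>carrier (vertex_group \<G> w). z w b = \<i> * z w x" if w: "w \<in> V" for w x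
    proof -
      obtain b where b: "b \<in> carrier (vertex_group \<G> w)"
        "coord w b = (- snd (coord w x), fst (coord w x))"
        by (rule coord_surj[OF w])
      then have "z w b = \<i> * z w x"
        by (simp add: z_def complex_eq_iff)
      with b(1) show ?thesis
        by blast
    qed
    obtain b0 where b0: "b0 \<in> carrier (vertex_group \<G> u)" "z u b0 = \<i> * p e0"
      using rotate[OF uv(1)] unfolding p_def u_def by blast
    obtain b1 where b1: "b1 \<in> carrier (vertex_group \<G> v)" "z v b1 = \<i> * q e0"
      using rotate[OF uv(2)] unfolding q_def v_def by blast
    define c where "c = vx u (tail_map \<G> e0 (gen e0))"
    define x0 where "x0 = vx u b0"
    \<comment> \<open>Conjugation by \<open>st e0\<close> moves the head vertex group to the tail
      side, where its edge subgroup is generated by the same \<open>c\<close>. Loops, tree edges and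
      other edges are thereby treated alike.\<close>
    define x1 where "x1 = st e0 \<otimes>\<^bsub>G\<^esub> vx v b1 \<otimes>\<^bsub>G\<^esub> inv\<^bsub>G\<^esub> st e0"
    define y where "y = x0 \<otimes>\<^bsub>G\<^esub> x1 \<otimes>\<^bsub>G\<^esub> inv\<^bsub>G\<^esub> x0 \<otimes>\<^bsub>G\<^esub> inv\<^bsub>G\<^esub> x1"
    have c: "c \<in> carrier G" and x0: "x0 \<in> carrier G" and x1: "x1 \<in> carrier G"
      using e0 uv b0 b1 gen_all[OF e0] by (auto simp: c_def x0_def x1_def u_def)
    then have y: "y \<in> carrier G"
      by (simp add: y_def)
    have "x0 \<otimes>\<^bsub>G\<^esub> c = c \<otimes>\<^bsub>G\<^esub> x0"
      unfolding c_def x0_def using e0 uv b0 gen_all[OF e0] by (intro vx_comm) (auto simp: u_def)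
    moreover have "x1 \<otimes>\<^bsub>G\<^esub> c = c \<otimes>\<^bsub>G\<^esub> x1"
    proof -
      define d where "d = vx v (head_map \<G> e0 (gen e0))"
      have d: "d \<in> carrier G" "vx v b1 \<in> carrier G" "st e0 \<in> carrier G"
        using e0 uv b1 gen_all[OF e0] by (auto simp: d_def v_def)
      have "st e0 \<otimes>\<^bsub>G\<^esub> d = c \<otimes>\<^bsub>G\<^esub> st e0"
        unfolding d_def c_def u_def v_def using e0 gen_all[OF e0] by (intro st_vx) auto
      then have "c = st e0 \<otimes>\<^bsub>G\<^esub> d \<otimes>\<^bsub>G\<^esub> inv\<^bsub>G\<^esub> st e0"
        using c d by (simp add: G.group_normalize)
      moreover have "vx v b1 \<otimes>\<^bsub>G\<^esub> d = d \<otimes>\<^bsub>G\<^esub> vx v b1"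
        unfolding d_def using e0 uv b1 gen_all[OF e0] by (intro vx_comm) (auto simp: v_def)
      ultimately show ?thesis
        unfolding x1_def using G.conj_hom[OF d(3), THEN hom_mult, OF d(1,2)]
          G.conj_hom[OF d(3), THEN hom_mult, OF d(2,1)] by simp
    qed
    ultimately have yc: "y \<otimes>\<^bsub>G\<^esub> c = c \<otimes>\<^bsub>G\<^esub> y"
      unfolding y_def using c x0 x1 by (simp add: G.commute_mult G.commute_inv)
    interpret \<chi>: group_hom G integer_group \<chi>
      by (intro group_hom.intro group_hom_axioms.intro G.group_axioms group_integer_group \<chi>)
    have "\<chi> y = 0"
      using x0 x1 by (simp add: y_def)
    moreover have "\<chi> c = 0"
      using zero gen_all[OF e0] by (auto simp: nonzero_iff c_def u_def)
    ultimately obtain k l :: int where kl: "k \<noteq> 0 \<or> l \<noteq> 0" "y [^]\<^bsub>G\<^esub> k = c [^]\<^bsub>G\<^esub> l"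
      using commuting[OF y c] yc by blast

    have p0: "p e0 \<noteq> 0"
      using pq[OF e0] by simp
    \<comment> \<open>The first difference of the cube. In the coordinate \<open>w / p e0\<close>,
      conjugating the translation by \<i> with \<open>\<kappa> e0\<close> gives the map that adds
      \<open>\<i> + D (Im w)\<close>; this is \<open>X\<close>.\<close>
    define D where "D x = (x + 1) ^ 3 - x ^ 3" for x :: real
    define X where "X w = w + p e0 * (\<i> + of_real (D (Im (w / p e0))))" for w
    have Im_X: "Im (X w / p e0) = Im (w / p e0) + 1" for w
      using p0 by (simp add: X_def add_divide_distrib)
    have bij_X: "bij X"
    proof (rule o_bij)
      let ?Y = "\<lambda>w. w - p e0 * (\<i> + of_real (D (Im (w / p e0) - 1)))"
      have "Im (?Y w / p e0) = Im (w / p e0) - 1" for w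
        using p0 by (simp add: diff_divide_distrib)
      then show "X \<circ> ?Y = id"
        by (simp add: X_def fun_eq_iff)
      show "?Y \<circ> X = id"
        by (simp add: Im_X fun_eq_iff) (simp add: X_def)
    qed
    have "X \<circ> t e0 = t e0 \<circ> \<rho> v b1"
    proof
      fix w
      have "Im (t e0 w / p e0) = Im (w / q e0)"
        using p0 by (simp add: t_def \<kappa>_def)
      moreover have "(w + \<i> * q e0) / q e0 = w / q e0 + \<i>"
        using pq[OF e0] by (simp add: add_divide_distrib)
      ultimately show "(X \<circ> t e0) w = (t e0 \<circ> \<rho> v b1) w"
        by (simp add: X_def \<rho>_def b1 t_def \<kappa>_def D_def algebra_simps)
    qed
    then have "X \<otimes>\<^bsub>?L\<^esub> t e0 = t e0 \<otimes>\<^bsub>?L\<^esub> \<rho> v b1"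
      using bij_X bij_t[OF e0] bij_\<rho> by (simp add: BijGroup_UNIV_simps)
    then have X: "t e0 \<otimes>\<^bsub>?L\<^esub> \<rho> v b1 \<otimes>\<^bsub>?L\<^esub> inv\<^bsub>?L\<^esub> t e0 = X"
      using bij_X bij_t[OF e0] bij_\<rho>
      by (metis BijGroup_UNIV_simps(1) L.inv_solve_right L.m_closed)
    \<comment> \<open>At height \<open>x\<close> the two composites differ by
      \<open>D x - D (x + 1) = - (6 * x + 6)\<close>. The shear acts after \<open>X\<close> and
      \<open>\<rho> u b0\<close>, hence at height \<open>x + 2\<close>, and
      \<open>6 - 6 * (x + 2)\<close> is this value.\<close>
    let ?S = "shear (p e0) 6 (- 6)"
    have "?S \<circ> (X \<circ> \<rho> u b0) = \<rho> u b0 \<circ> X"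
    proof
      fix w
      have "Im ((w + \<i> * p e0) / p e0) = Im (w / p e0) + 1"
        using p0 by (simp add: add_divide_distrib)
      moreover have "D (Im (w / p e0) + 1) = D (Im (w / p e0)) + 6 * Im (w / p e0) + 6"
        by (simp add: D_def power3_eq_cube algebra_simps)
      ultimately show "(?S \<circ> (X \<circ> \<rho> u b0)) w = (\<rho> u b0 \<circ> X) w"
        by (simp add: shear_def Im_X \<rho>_def b0) (simp add: X_def algebra_simps)
    qed
    then have "?S \<otimes>\<^bsub>?L\<^esub> (X \<otimes>\<^bsub>?L\<^esub> \<rho> u b0) = \<rho> u b0 \<otimes>\<^bsub>?L\<^esub> X"
      using bij_X bij_shear[OF p0] bij_\<rho> by (simp add: BijGroup_UNIV_simps bij_comp)
    then have S: "\<rho> u b0 \<otimes>\<^bsub>?L\<^esub> X \<otimes>\<^bsub>?L\<^esub> inv\<^bsub>?L\<^esub> (X \<otimes>\<^bsub>?L\<^esub> \<rho> u b0) = ?S"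
      using bij_X bij_shear[OF p0] bij_\<rho>
      by (metis BijGroup_UNIV_simps(1) L.inv_solve_right L.m_closed)
    have in_L: "X \<in> carrier ?L" "t e0 \<in> carrier ?L" "\<rho> u b0 \<in> carrier ?L" "\<rho> v b1 \<in> carrier ?L"
      "shear (p e0) a b \<in> carrier ?L" for a b
      using bij_X bij_t[OF e0] bij_\<rho> bij_shear[OF p0] by (auto simp: BijGroup_UNIV_simps)
    \<comment> \<open>The images of \<open>x0\<close>, \<open>x1\<close>, \<open>y\<close> and
      \<open>c\<close> are all conjugated by the same \<open>P u\<close>, which therefore drops out
      of the relation between \<open>y\<close> and \<open>c\<close>.\<close>
    have \<Phi>_x0: "\<Phi> x0 = P u \<otimes>\<^bsub>?L\<^esub> \<rho> u b0 \<otimes>\<^bsub>?L\<^esub> inv\<^bsub>?L\<^esub> P u"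
      using uv b0 by (simp add: x0_def \<Phi>)
    have \<Phi>_x1: "\<Phi> x1 = P u \<otimes>\<^bsub>?L\<^esub> X \<otimes>\<^bsub>?L\<^esub> inv\<^bsub>?L\<^esub> P u"
      using uv b1 e0 P(1) in_L by (simp add: x1_def \<Phi> L.group_normalize flip: u_def v_def X)
    have \<Phi>_y: "\<Phi> y = P u \<otimes>\<^bsub>?L\<^esub> ?S \<otimes>\<^bsub>?L\<^esub> inv\<^bsub>?L\<^esub> P u"
      using x0 x1 P(1) in_L by (simp add: y_def \<Phi>_x0 \<Phi>_x1 L.group_normalize flip: S)
    have "\<rho> u (tail_map \<G> e0 (gen e0)) = shear (p e0) 1 0"
      by (simp add: fun_eq_iff \<rho>_def shear_def p_def u_def)
    then have \<Phi>_c: "\<Phi> c = P u \<otimes>\<^bsub>?L\<^esub> shear (p e0) 1 0 \<otimes>\<^bsub>?L\<^esub> inv\<^bsub>?L\<^esub> P u"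
      using uv e0 gen_all[OF e0] by (simp add: c_def \<Phi> u_def)
    have "\<Phi> (y [^]\<^bsub>G\<^esub> k) = \<Phi> (c [^]\<^bsub>G\<^esub> l)"
      by (simp add: kl)
    then have "?S [^]\<^bsub>?L\<^esub> k = shear (p e0) 1 0 [^]\<^bsub>?L\<^esub> l"
      using y c P(1) in_L by (simp add: \<Phi>.hom_int_pow \<Phi>_y \<Phi>_c L.conj_int_pow)
    then have *: "shear (p e0) (of_int k * 6) (of_int k * - 6) w = shear (p e0) (of_int l) 0 w" for w
      by (simp add: shear_int_pow[OF p0])
    \<comment> \<open>Two points determine the parameters. At 0 the relation reads
      \<open>6 * k = l\<close>; at \<open>\<i> * p e0\<close> the factor \<open>6 - 6 * Im\<close>
      vanishes, which leaves \<open>l = 0\<close>.\<close>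
    have "complex_of_real (of_int k * 6) = of_real (of_int l)"
      using *[of 0] p0 by (simp add: shear_def)
    then have "real_of_int k * 6 = of_int l"
      by (simp only: of_real_eq_iff)
    moreover have "complex_of_real (of_int k * 6 + of_int k * - 6) = of_real (of_int l)"
      using *[of "\<i> * p e0"] p0 by (simp add: shear_def)
    then have "real_of_int l = 0"
      by simp
    ultimately show False
      using kl(1) by simp
  qed (rule \<chi>)
qed

end

section \<open>Recognizing free by cyclic groups\<close>

lemma (in group) AutoGroup_int_pow:
  assumes "\<alpha> \<in> auto G" "g \<in> carrier G"
  shows "\<one>\<^bsub>AutoGroup G\<^esub> g = g"
    "(\<alpha> [^]\<^bsub>AutoGroup G\<^esub> (k + 1 :: int)) g = (\<alpha> [^]\<^bsub>AutoGroup G\<^esub> k) (\<alpha> g)"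
    "(\<alpha> [^]\<^bsub>AutoGroup G\<^esub> k) g \<in> carrier G"
proof -
  interpret A: group "AutoGroup G"
    by (rule AutoGroup)
  have \<alpha>: "\<alpha> \<in> carrier (AutoGroup G)"
    using assms(1) by (simp add: AutoGroup_def)
  have closed: "f \<in> Bij (carrier G)" if "f \<in> carrier (AutoGroup G)" for f
    using that by (auto simp: AutoGroup_def auto_def)
  show "\<one>\<^bsub>AutoGroup G\<^esub> g = g"
    using assms(2) by (simp add: AutoGroup_def BijGroup_def)
  have "\<alpha> [^]\<^bsub>AutoGroup G\<^esub> (k + 1) = \<alpha> [^]\<^bsub>AutoGroup G\<^esub> k \<otimes>\<^bsub>AutoGroup G\<^esub> \<alpha>"
    using A.int_pow_mult[OF \<alpha>, of k 1] \<alpha> by simp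
  also have "\<dots> = compose (carrier G) (\<alpha> [^]\<^bsub>AutoGroup G\<^esub> k) \<alpha>"
    using closed[OF \<alpha>] closed[OF A.int_pow_closed[OF \<alpha>, of k]]
    by (simp add: AutoGroup_def BijGroup_def)
  finally show "(\<alpha> [^]\<^bsub>AutoGroup G\<^esub> (k + 1 :: int)) g = (\<alpha> [^]\<^bsub>AutoGroup G\<^esub> k) (\<alpha> g)"
    using assms(2) by (simp add: compose_def)
  show "(\<alpha> [^]\<^bsub>AutoGroup G\<^esub> k) g \<in> carrier G"
    using closed[OF A.int_pow_closed[OF \<alpha>, of k]] assms(2) by (auto simp: Bij_def bij_betw_def)
qed

text \<open>The element \<open>s\<close> splits \<chi>. The automorphism is conjugation by
  \<open>s\<close> transported along \<open>\<phi>\<close>, and the isomorphism sends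
  \<open>x\<close> to the preimage of \<open>x\<close> times the inverse of \<open>s\<close> to the
  power \<open>\<chi> x\<close>, paired with \<open>\<chi> x\<close>.\<close>

lemma free_by_cyclicI:
  assumes "group G" and \<chi>: "\<chi> \<in> hom G integer_group" and s: "s \<in> carrier G" "\<chi> s = 1"
    and \<phi>: "\<phi> \<in> hom (free_group {..<n::nat}) G" "inj_on \<phi> (carrier (free_group {..<n}))"
    and ker: "\<phi> ` carrier (free_group {..<n}) = {x \<in> carrier G. \<chi> x = 0}"
  shows "free_by_cyclic G"
proof -
  interpret G: group G by fact
  define F where "F = free_group {..<n}"
  interpret F: group F
    unfolding F_def by (rule group_free_group)
  note \<phi> = \<phi>[folded F_def] and ker = ker[folded F_def]
  interpret \<chi>: group_hom G integer_group \<chi>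
    by (intro group_hom.intro group_hom_axioms.intro G.group_axioms group_integer_group \<chi>)
  interpret \<phi>: group_hom F G \<phi>
    by (intro group_hom.intro group_hom_axioms.intro G.group_axioms F.group_axioms \<phi>)
  have \<chi>\<phi>: "\<chi> (\<phi> f) = 0" if "f \<in> carrier F" for f
    using that ker by blast
  have lift: "\<exists>!f. f \<in> carrier F \<and> \<phi> f = x" if "x \<in> carrier G" "\<chi> x = 0" for x
    using that ker \<phi>(2) by (auto simp: inj_on_def image_iff set_eq_iff) metis
  \<comment> \<open>Restricted to the carrier because the members of \<open>auto\<close> are
    extensional.\<close>
  define \<alpha> where "\<alpha> = (\<lambda>f\<in>carrier F. inv_into (carrier F) \<phi> (s \<otimes>\<^bsub>G\<^esub> \<phi> f \<otimes>\<^bsub>G\<^esub> inv\<^bsub>G\<^esub> s))"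
  have \<alpha>: "\<alpha> f \<in> carrier F" "\<phi> (\<alpha> f) = s \<otimes>\<^bsub>G\<^esub> \<phi> f \<otimes>\<^bsub>G\<^esub> inv\<^bsub>G\<^esub> s" if "f \<in> carrier F" for f
  proof -
    have "s \<otimes>\<^bsub>G\<^esub> \<phi> f \<otimes>\<^bsub>G\<^esub> inv\<^bsub>G\<^esub> s \<in> \<phi> ` carrier F"
      unfolding ker using that s \<chi>\<phi> by simp
    then show "\<alpha> f \<in> carrier F" "\<phi> (\<alpha> f) = s \<otimes>\<^bsub>G\<^esub> \<phi> f \<otimes>\<^bsub>G\<^esub> inv\<^bsub>G\<^esub> s"
      using that by (simp_all add: \<alpha>_def inv_into_into f_inv_into_f)
  qed
  have \<phi>_inj: "f = g" if "f \<in> carrier F" "g \<in> carrier F" "\<phi> f = \<phi> g" for f g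
    using that \<phi>(2) by (auto simp: inj_on_def)
  have "\<alpha> \<in> auto F"
    unfolding auto_def Bij_def
  proof (intro IntI CollectI homI bij_betw_imageI inj_onI)
    show "\<alpha> (f \<otimes>\<^bsub>F\<^esub> g) = \<alpha> f \<otimes>\<^bsub>F\<^esub> \<alpha> g" if "f \<in> carrier F" "g \<in> carrier F" for f g
      using that s by (intro \<phi>_inj) (auto simp: \<alpha> G.group_normalize)
    show "f = g" if "f \<in> carrier F" "g \<in> carrier F" "\<alpha> f = \<alpha> g" for f g
    proof -
      have "s \<otimes>\<^bsub>G\<^esub> \<phi> f \<otimes>\<^bsub>G\<^esub> inv\<^bsub>G\<^esub> s = s \<otimes>\<^bsub>G\<^esub> \<phi> g \<otimes>\<^bsub>G\<^esub> inv\<^bsub>G\<^esub> s"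
        using that \<alpha>(2) by metis
      then show ?thesis
        using that s by (intro \<phi>_inj) auto
    qed
    show "\<alpha> ` carrier F = carrier F"
    proof (intro equalityI subsetI)
      fix f assume f: "f \<in> carrier F"
      have "inv\<^bsub>G\<^esub> s \<otimes>\<^bsub>G\<^esub> \<phi> f \<otimes>\<^bsub>G\<^esub> s \<in> carrier G" "\<chi> (inv\<^bsub>G\<^esub> s \<otimes>\<^bsub>G\<^esub> \<phi> f \<otimes>\<^bsub>G\<^esub> s) = 0"
        using f s \<chi>\<phi> by simp_all
      then obtain g where g: "g \<in> carrier F" "\<phi> g = inv\<^bsub>G\<^esub> s \<otimes>\<^bsub>G\<^esub> \<phi> f \<otimes>\<^bsub>G\<^esub> s"
        using lift by blast
      then have "\<alpha> g = f"
        using f s by (intro \<phi>_inj) (auto simp: \<alpha> G.group_normalize)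
      with g show "f \<in> \<alpha> ` carrier F"
        by blast
    qed (use \<alpha> in auto)
  qed (use \<alpha> in \<open>auto simp: \<alpha>_def\<close>)
  then have \<alpha>_surj: "\<alpha> ` carrier F = carrier F"
    by (simp add: auto_def Bij_def bij_betw_def)
  note \<alpha>_pow = F.AutoGroup_int_pow[OF \<open>\<alpha> \<in> auto F\<close>]
  have \<phi>\<alpha>_pow: "\<phi> ((\<alpha> [^]\<^bsub>AutoGroup F\<^esub> k) f) = s [^]\<^bsub>G\<^esub> k \<otimes>\<^bsub>G\<^esub> \<phi> f \<otimes>\<^bsub>G\<^esub> inv\<^bsub>G\<^esub> (s [^]\<^bsub>G\<^esub> k)"
    if "f \<in> carrier F" for f and k :: int
    using that
  proof (induction k arbitrary: f rule: int_induct[where k = 0])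
    case base
    then show ?case by (simp add: \<alpha>_pow)
  next
    case (step1 k)
    have "s [^]\<^bsub>G\<^esub> (k + 1) = s [^]\<^bsub>G\<^esub> k \<otimes>\<^bsub>G\<^esub> s"
      using G.int_pow_mult[OF s(1), of k 1] s by simp
    then show ?case
      using step1 s by (simp add: \<alpha>_pow \<alpha> G.group_normalize)
  next
    case (step2 k)
    have "s [^]\<^bsub>G\<^esub> k = s [^]\<^bsub>G\<^esub> (k - 1) \<otimes>\<^bsub>G\<^esub> s"
      using G.int_pow_mult[OF s(1), of "k - 1" 1] s by simp
    \<comment> \<open>Descending to the exponent \<open>k - 1\<close> uses surjectivity of
      \<open>\<alpha>\<close>: at \<open>f = \<alpha> g\<close> the power \<open>k - 1\<close>
      equals the power \<open>k\<close> at \<open>g\<close>, where the induction hypothesis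
      applies.\<close>
    moreover obtain g where g: "g \<in> carrier F" "\<alpha> g = f"
      using \<alpha>_surj step2.prems by (metis imageE)
    moreover have "(\<alpha> [^]\<^bsub>AutoGroup F\<^esub> (k - 1)) f = (\<alpha> [^]\<^bsub>AutoGroup F\<^esub> k) g"
      using \<alpha>_pow(2)[OF g(1), of "k - 1"] g by simp
    ultimately show ?case
      using step2 s by (simp add: \<alpha> G.group_normalize flip: g(2))
  qed
  define h where "h x = (THE f. f \<in> carrier F \<and> \<phi> f = x \<otimes>\<^bsub>G\<^esub> inv\<^bsub>G\<^esub> (s [^]\<^bsub>G\<^esub> \<chi> x))" for x
  have \<chi>_pow: "\<chi> (s [^]\<^bsub>G\<^esub> k) = k" for k :: int
    using s by (simp add: \<chi>.hom_int_pow)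
  have h: "h x \<in> carrier F" "\<phi> (h x) = x \<otimes>\<^bsub>G\<^esub> inv\<^bsub>G\<^esub> (s [^]\<^bsub>G\<^esub> \<chi> x)" if "x \<in> carrier G" for x
  proof -
    have "x \<otimes>\<^bsub>G\<^esub> inv\<^bsub>G\<^esub> (s [^]\<^bsub>G\<^esub> \<chi> x) \<in> carrier G" "\<chi> (x \<otimes>\<^bsub>G\<^esub> inv\<^bsub>G\<^esub> (s [^]\<^bsub>G\<^esub> \<chi> x)) = 0"
      using that s by (simp_all add: \<chi>_pow)
    from theI'[OF lift[OF this]] show "h x \<in> carrier F" "\<phi> (h x) = x \<otimes>\<^bsub>G\<^esub> inv\<^bsub>G\<^esub> (s [^]\<^bsub>G\<^esub> \<chi> x)"
      unfolding h_def by blast+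
  qed
  have "(\<lambda>x. (h x, \<chi> x)) \<in> iso G (semidirect_int F \<alpha>)"
    unfolding iso_def
  proof (intro CollectI conjI homI bij_betw_imageI inj_onI equalityI subsetI)
    fix x y assume xy: "x \<in> carrier G" "y \<in> carrier G"
    have "h (x \<otimes>\<^bsub>G\<^esub> y) = h x \<otimes>\<^bsub>F\<^esub> (\<alpha> [^]\<^bsub>AutoGroup F\<^esub> \<chi> x) (h y)"
    proof (rule \<phi>_inj)
      have "s [^]\<^bsub>G\<^esub> (\<chi> x + \<chi> y) = s [^]\<^bsub>G\<^esub> \<chi> x \<otimes>\<^bsub>G\<^esub> s [^]\<^bsub>G\<^esub> \<chi> y"
        using s by (simp add: G.int_pow_mult)
      then show "\<phi> (h (x \<otimes>\<^bsub>G\<^esub> y)) = \<phi> (h x \<otimes>\<^bsub>F\<^esub> (\<alpha> [^]\<^bsub>AutoGroup F\<^esub> \<chi> x) (h y))"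
        using xy s h by (simp add: \<phi>\<alpha>_pow \<alpha>_pow G.group_normalize)
    qed (use xy h \<alpha>_pow in auto)
    then show "(h (x \<otimes>\<^bsub>G\<^esub> y), \<chi> (x \<otimes>\<^bsub>G\<^esub> y)) = (h x, \<chi> x) \<otimes>\<^bsub>semidirect_int F \<alpha>\<^esub> (h y, \<chi> y)"
      using xy by (simp add: semidirect_int_def)
  next
    fix x y assume xy: "x \<in> carrier G" "y \<in> carrier G" "(h x, \<chi> x) = (h y, \<chi> y)"
    then have "x \<otimes>\<^bsub>G\<^esub> inv\<^bsub>G\<^esub> (s [^]\<^bsub>G\<^esub> \<chi> x) = y \<otimes>\<^bsub>G\<^esub> inv\<^bsub>G\<^esub> (s [^]\<^bsub>G\<^esub> \<chi> x)"
      using h by (metis prod.inject)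
    then show "x = y"
      using xy s by simp
  next
    fix z assume "z \<in> carrier (semidirect_int F \<alpha>)"
    then obtain f k where z: "z = (f, k)" "f \<in> carrier F"
      by (auto simp: semidirect_int_def)
    define x where "x = \<phi> f \<otimes>\<^bsub>G\<^esub> s [^]\<^bsub>G\<^esub> k"
    have x: "x \<in> carrier G" "\<chi> x = k"
      using z s \<chi>\<phi> by (simp_all add: x_def \<chi>_pow)
    moreover have "h x = f"
      using h[OF x(1)] z s x(2) by (intro \<phi>_inj) (simp_all add: x_def G.group_normalize)
    ultimately show "z \<in> (\<lambda>x. (h x, \<chi> x)) ` carrier G"
      using z by (intro image_eqI[of _ _ x]) auto
  qed (use h in \<open>auto simp: semidirect_int_def\<close>)
  with \<open>\<alpha> \<in> auto F\<close> show ?thesis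
    unfolding free_by_cyclic_def F_def is_iso_def by blast
qed

section \<open>Wreath products with the integers\<close>

text \<open>The unrestricted wreath product: functions on \<int> of arbitrary support. A pair
  \<open>(f, m)\<close> can be read as the moves from each level \<open>i\<close> to level
  \<open>i + m\<close> with label \<open>f i\<close>; multiplication composes the moves and
  multiplies the labels along them.\<close>

definition wreath :: "('a, 'b) monoid_scheme \<Rightarrow> ((int \<Rightarrow> 'a) \<times> int) monoid" where
  "wreath H = \<lparr>carrier = (UNIV \<rightarrow> carrier H) \<times> UNIV,
    monoid.mult = (\<lambda>(f, m) (g, n). (\<lambda>i. f i \<otimes>\<^bsub>H\<^esub> g (i + m), m + n)),
    one = (\<lambda>_. \<one>\<^bsub>H\<^esub>, 0)\<rparr>"

lemma wreath_simps [simp]: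
  "(f, m) \<in> carrier (wreath H) \<longleftrightarrow> (\<forall>i. f i \<in> carrier H)"
  "(f, m) \<otimes>\<^bsub>wreath H\<^esub> (g, n) = (\<lambda>i. f i \<otimes>\<^bsub>H\<^esub> g (i + m), m + n)"
  "\<one>\<^bsub>wreath H\<^esub> = (\<lambda>_. \<one>\<^bsub>H\<^esub>, 0)"
  by (auto simp: wreath_def)

lemma (in group) group_wreath: "group (wreath G)"
proof (rule groupI)
  fix x assume "x \<in> carrier (wreath G)"
  then obtain f m where x: "x = (f, m)" "\<And>i. f i \<in> carrier G"
    by (cases x) auto
  then show "\<exists>y\<in>carrier (wreath G). y \<otimes>\<^bsub>wreath G\<^esub> x = \<one>\<^bsub>wreath G\<^esub>"
    by (intro bexI[of _ "(\<lambda>i. inv (f (i - m)), - m)"]) auto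
qed (auto simp: m_assoc add.assoc)

lemma (in group) inv_wreath:
  assumes "\<And>i. f i \<in> carrier G"
  shows "inv\<^bsub>wreath G\<^esub> (f, m) = (\<lambda>i. inv (f (i - m)), - m)"
  by (rule group.inv_equality[OF group_wreath]) (use assms in auto)

lemma wreath_snd_hom: "snd \<in> hom (wreath H) integer_group"
  by (rule homI) (auto simp: wreath_def)

lemma wreath_map_hom:
  assumes "\<phi> \<in> hom H K"
  shows "map_prod (\<lambda>f. \<phi> \<circ> f) id \<in> hom (wreath H) (wreath K)"
  using assms by (auto simp: hom_def wreath_def Pi_iff fun_eq_iff)

section \<open>Characters that are nonzero on the edge groups\<close>

text \<open>The image of \<chi> is generated by its least positive value, and \<chi> is divided by
  that value.\<close>

lemma hom_integer_normalize:
  assumes "group G" and \<chi>: "\<chi> \<in> hom G integer_group" and x: "x \<in> carrier G" "\<chi> x \<noteq> 0"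
  obtains \<psi> s d where "\<psi> \<in> hom G integer_group" "s \<in> carrier G" "\<psi> s = 1"
    "\<And>y. y \<in> carrier G \<Longrightarrow> \<chi> y = d * \<psi> y"
proof -
  interpret G: group G by fact
  interpret \<chi>: group_hom G integer_group \<chi>
    by (intro group_hom.intro group_hom_axioms.intro G.group_axioms group_integer_group \<chi>)
  define P where "P n \<longleftrightarrow> 0 < n \<and> (\<exists>y\<in>carrier G. \<chi> y = int n)" for n
  have "P (nat \<bar>\<chi> x\<bar>)"
  proof (cases "\<chi> x > 0")
    case False
    then have "\<chi> (inv\<^bsub>G\<^esub> x) = int (nat \<bar>\<chi> x\<bar>)" "inv\<^bsub>G\<^esub> x \<in> carrier G"
      using x by simp_all
    then show ?thesis
      using x(2) unfolding P_def by (intro conjI bexI[of _ "inv\<^bsub>G\<^esub> x"]) auto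
  qed (use x in \<open>auto simp: P_def\<close>)
  define d where "d = (LEAST n. P n)"
  have "P d"
    unfolding d_def using \<open>P (nat \<bar>\<chi> x\<bar>)\<close> by (rule LeastI)
  then obtain s where s: "s \<in> carrier G" "\<chi> s = int d" "d > 0"
    unfolding P_def by blast
  have dvd: "int d dvd \<chi> y" if y: "y \<in> carrier G" for y
  proof (rule ccontr)
    assume "\<not> int d dvd \<chi> y"
    then have "\<chi> y mod int d \<noteq> 0"
      by (simp only: dvd_eq_mod_eq_0 not_False_eq_True)
    moreover have "0 \<le> \<chi> y mod int d"
      using s(3) by (intro pos_mod_sign) simp
    ultimately have pos: "\<chi> y mod int d > 0"
      by linarith
    have less: "\<chi> y mod int d < int d"
      using s(3) by (intro pos_mod_bound) simp
    have "\<chi> (y \<otimes>\<^bsub>G\<^esub> inv\<^bsub>G\<^esub> (s [^]\<^bsub>G\<^esub> (\<chi> y div int d))) = \<chi> y mod int d"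
      using y s by (simp add: \<chi>.hom_int_pow minus_div_mult_eq_mod)
    then have "P (nat (\<chi> y mod int d))"
      unfolding P_def using pos y s
      by (intro conjI bexI[of _ "y \<otimes>\<^bsub>G\<^esub> inv\<^bsub>G\<^esub> (s [^]\<^bsub>G\<^esub> (\<chi> y div int d))"]) auto
    then have "d \<le> nat (\<chi> y mod int d)"
      unfolding d_def by (rule Least_le)
    with pos less show False by linarith
  qed
  show thesis
  proof (rule that[of "\<lambda>y. \<chi> y div int d" s "int d"])
    show "(\<lambda>y. \<chi> y div int d) \<in> hom G integer_group"
      using dvd by (intro homI) (auto simp: div_plus_div_distrib_dvd_left)
  qed (use s dvd in auto)
qed

context tubular_group
begin

text \<open>In a connected graph with an edge, every vertex is an end of some edge, so being nonzero
  on edge groups passes to vertex groups. Without edges the hypothesis is vacuous and \<chi> may be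
  zero; a coordinate of the single vertex group replaces it.\<close>

lemma good_character_exists:
  assumes \<chi>: "\<chi> \<in> hom G integer_group" and nonzero: "\<forall>e\<in>E. nonzero_on_edge_group \<G> T \<chi> e"
  obtains \<psi> s where "\<psi> \<in> hom G integer_group" "s \<in> carrier G" "\<psi> s = 1"
    "\<And>v. v \<in> V \<Longrightarrow> \<exists>x\<in>carrier (vertex_group \<G> v). \<psi> (vx v x) \<noteq> 0"
    "\<And>e. e \<in> E \<Longrightarrow> nonzero_on_edge_group \<G> T \<psi> e"
proof -
  obtain r where r: "r \<in> V"
    using V_nonempty by blast
  have cut: "S = V" if "S \<subseteq> V" "S \<noteq> {}" "\<forall>e\<in>E. src e \<in> S \<longleftrightarrow> tgt e \<in> S" for S
    using connected_base_graph that unfolding connected_iff_cut[OF base.wf_digraph_axioms] by blast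
  show thesis
  proof (cases "E = {}")
    case True
    then have "{r} = V"
      using r by (intro cut) auto
    have hom: "fst \<circ> coord v \<in> hom (vertex_group \<G> v) integer_group" if "v \<in> V" for v
      using that by (intro homI) (auto simp: coord_mult)
    obtain \<psi> where \<psi>: "\<psi> \<in> hom G integer_group"
      "\<And>v x. v \<in> V \<Longrightarrow> x \<in> carrier (vertex_group \<G> v) \<Longrightarrow> \<psi> (vx v x) = fst (coord v x)"
      by (rule hom_exists[OF group_integer_group, of "\<lambda>v. fst \<circ> coord v" "\<lambda>_. 0"])
        (use True arcs_T hom in auto)
    obtain x where x: "x \<in> carrier (vertex_group \<G> r)" "coord r x = (1, 0)"
      using coord_surj[OF r] by blast
    show thesis
    proof (rule that[OF \<psi>(1), of "vx r x"])
      show "\<exists>x\<in>carrier (vertex_group \<G> v). \<psi> (vx v x) \<noteq> 0" if "v \<in> V" for v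
        using that x \<psi>(2) \<open>{r} = V\<close> by force
    qed (use r x \<psi>(2) True in auto)
  next
    case False
    then obtain e x where "e \<in> E" "x \<in> carrier (edge_group \<G> e)" "\<chi> (vx (src e) (tail_map \<G> e x)) \<noteq> 0"
      using nonzero unfolding nonzero_iff by blast
    then obtain \<psi> s d where \<psi>: "\<psi> \<in> hom G integer_group" "s \<in> carrier G" "\<psi> s = 1"
      "\<And>y. y \<in> carrier G \<Longrightarrow> \<chi> y = d * \<psi> y"
      using hom_integer_normalize[OF G.group_axioms \<chi>, of "vx (src e) (tail_map \<G> e x)"] by auto
    interpret \<psi>: group_hom G integer_group \<psi>
      by (intro group_hom.intro group_hom_axioms.intro G.group_axioms group_integer_group \<psi>)
    have edge: "\<exists>c\<in>carrier (edge_group \<G> e). \<psi> (vx (src e) (tail_map \<G> e c)) \<noteq> 0" if e: "e \<in> E" for e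
    proof -
      obtain c where "c \<in> carrier (edge_group \<G> e)" "\<chi> (vx (src e) (tail_map \<G> e c)) \<noteq> 0"
        using nonzero e unfolding nonzero_iff by blast
      then show ?thesis
        using \<psi>(4)[of "vx (src e) (tail_map \<G> e c)"] e by auto
    qed
    define S where "S = {v \<in> V. \<exists>e\<in>E. v = src e \<or> v = tgt e}"
    have "src e \<in> S"
      using \<open>e \<in> E\<close> by (auto simp: S_def)
    then have "S = V"
      by (intro cut) (auto simp: S_def)
    show thesis
    proof (rule that[OF \<psi>(1-3)])
      fix v assume "v \<in> V"
      then obtain e where e: "e \<in> E" "v = src e \<or> v = tgt e"
        using \<open>S = V\<close> by (auto simp: S_def)
      obtain c where c: "c \<in> carrier (edge_group \<G> e)" "\<psi> (vx (src e) (tail_map \<G> e c)) \<noteq> 0"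
        using edge[OF e(1)] by blast
      have "\<psi> (st e \<otimes>\<^bsub>G\<^esub> vx (tgt e) (head_map \<G> e c)) = \<psi> (vx (src e) (tail_map \<G> e c) \<otimes>\<^bsub>G\<^esub> st e)"
        using st_vx[OF e(1) c(1)] by simp
      then have "\<psi> (vx (tgt e) (head_map \<G> e c)) \<noteq> 0"
        using e c by simp
      with e c show "\<exists>x\<in>carrier (vertex_group \<G> v). \<psi> (vx v x) \<noteq> 0"
        by (metis head_map_closed tail_map_closed)
    qed (use edge in \<open>simp add: nonzero_iff\<close>)
  qed
qed

section \<open>Bases of the vertex groups adapted to a character\<close>

lemma coord_int_pow:
  assumes "v \<in> V" "x \<in> carrier (vertex_group \<G> v)"
  shows "coord v (x [^]\<^bsub>vertex_group \<G> v\<^esub> (k::int)) = (k * fst (coord v x), k * snd (coord v x))"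
proof -
  have "fst \<circ> coord v \<in> hom (vertex_group \<G> v) integer_group"
    "snd \<circ> coord v \<in> hom (vertex_group \<G> v) integer_group"
    using assms(1) by (auto intro!: homI simp: coord_mult)
  from this[THEN hom_int_pow, OF assms(2) group_vertex_group[OF assms(1)] group_integer_group, of k]
  show ?thesis
    by (simp add: prod_eq_iff)
qed

text \<open>In coordinates \<open>f\<close> is \<open>d\<close> times the primitive form
  \<open>(\<alpha>, \<beta>)\<close>. A Bezout pair gives \<open>a = (u, w)\<close>, and
  \<open>b = (- \<beta>, \<alpha>)\<close> spans the kernel. Their determinant is 1, so they form a
  basis; \<open>y x\<close> is the determinant of \<open>a\<close> and \<open>x\<close>, which is
  the coordinate of \<open>x\<close> along \<open>b\<close>.\<close>

lemma vertex_basis_exists: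
  assumes v: "v \<in> V" and f: "f \<in> hom (vertex_group \<G> v) integer_group"
    and nz: "\<exists>x\<in>carrier (vertex_group \<G> v). f x \<noteq> 0"
  shows "\<exists>d a b y. d > 0 \<and> a \<in> carrier (vertex_group \<G> v) \<and> b \<in> carrier (vertex_group \<G> v) \<and>
    f a = d \<and> f b = 0 \<and> y \<in> hom (vertex_group \<G> v) integer_group \<and> y a = 0 \<and> y b = 1 \<and>
    (\<forall>x\<in>carrier (vertex_group \<G> v). \<exists>k. f x = d * k \<and>
      x = a [^]\<^bsub>vertex_group \<G> v\<^esub> (k::int) \<otimes>\<^bsub>vertex_group \<G> v\<^esub> b [^]\<^bsub>vertex_group \<G> v\<^esub> (y x :: int))"
proof -
  interpret A: group "vertex_group \<G> v"
    using v by (rule group_vertex_group)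
  interpret f: group_hom "vertex_group \<G> v" integer_group f
    by (intro group_hom.intro group_hom_axioms.intro A.group_axioms group_integer_group f)
  obtain e1 where e1: "e1 \<in> carrier (vertex_group \<G> v)" "coord v e1 = (1, 0)"
    using coord_surj[OF v] by blast
  obtain e2 where e2: "e2 \<in> carrier (vertex_group \<G> v)" "coord v e2 = (0, 1)"
    using coord_surj[OF v] by blast
  have f_eq: "f x = fst (coord v x) * f e1 + snd (coord v x) * f e2"
    if x: "x \<in> carrier (vertex_group \<G> v)" for x
  proof -
    have "x = e1 [^]\<^bsub>vertex_group \<G> v\<^esub> fst (coord v x) \<otimes>\<^bsub>vertex_group \<G> v\<^esub>
        e2 [^]\<^bsub>vertex_group \<G> v\<^esub> snd (coord v x)"
      using v x e1 e2 by (intro coord_inj) (auto simp: coord_mult coord_int_pow)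
    then have "f x = f (e1 [^]\<^bsub>vertex_group \<G> v\<^esub> fst (coord v x) \<otimes>\<^bsub>vertex_group \<G> v\<^esub>
        e2 [^]\<^bsub>vertex_group \<G> v\<^esub> snd (coord v x))"
      by (rule arg_cong)
    then show ?thesis
      using e1(1) e2(1) by (simp add: f.hom_int_pow)
  qed
  define d where "d = gcd (f e1) (f e2)"
  obtain u w where uw: "u * f e1 + w * f e2 = d"
    using bezout_int[of "f e1" "f e2"] unfolding d_def by blast
  have "f e1 \<noteq> 0 \<or> f e2 \<noteq> 0"
    using nz f_eq by force
  then have "d > 0"
    by (simp add: d_def)
  obtain \<alpha> \<beta> where \<alpha>\<beta>: "f e1 = d * \<alpha>" "f e2 = d * \<beta>"
    unfolding d_def by (meson dvdE gcd_dvd1 gcd_dvd2)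
  then have "d * (u * \<alpha> + w * \<beta>) = d * 1"
    using uw by (simp add: algebra_simps)
  then have unimodular: "u * \<alpha> + w * \<beta> = 1"
    using \<open>d > 0\<close> by (metis less_irrefl mult_left_cancel)
  obtain a where a: "a \<in> carrier (vertex_group \<G> v)" "coord v a = (u, w)"
    using coord_surj[OF v] by blast
  obtain b where b: "b \<in> carrier (vertex_group \<G> v)" "coord v b = (- \<beta>, \<alpha>)"
    using coord_surj[OF v] by blast
  define y where "y x = u * snd (coord v x) - w * fst (coord v x)" for x
  have y: "y \<in> hom (vertex_group \<G> v) integer_group"
    using v by (intro homI) (auto simp: y_def coord_mult algebra_simps)
  have decomp: "\<exists>k. f x = d * k \<and>
      x = a [^]\<^bsub>vertex_group \<G> v\<^esub> (k::int) \<otimes>\<^bsub>vertex_group \<G> v\<^esub> b [^]\<^bsub>vertex_group \<G> v\<^esub> (y x :: int)"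
    if x: "x \<in> carrier (vertex_group \<G> v)" for x
  proof (intro exI[of _ "fst (coord v x) * \<alpha> + snd (coord v x) * \<beta>"] conjI)
    let ?m = "fst (coord v x)" and ?n = "snd (coord v x)"
    show "f x = d * (?m * \<alpha> + ?n * \<beta>)"
      using f_eq[OF x] \<alpha>\<beta> by (simp add: algebra_simps)
    have "(?m * \<alpha> + ?n * \<beta>) * u + y x * (- \<beta>) = ?m * (u * \<alpha> + w * \<beta>)"
      "(?m * \<alpha> + ?n * \<beta>) * w + y x * \<alpha> = ?n * (u * \<alpha> + w * \<beta>)"
      by (simp_all add: y_def algebra_simps)
    then show "x = a [^]\<^bsub>vertex_group \<G> v\<^esub> (?m * \<alpha> + ?n * \<beta>) \<otimes>\<^bsub>vertex_group \<G> v\<^esub> b [^]\<^bsub>vertex_group \<G> v\<^esub> y x"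
      using v x a b unimodular
      by (intro coord_inj) (auto simp: coord_mult coord_int_pow prod_eq_iff)
  qed
  have "f a = d"
    using f_eq[OF a(1)] a(2) uw by simp
  moreover have "f b = 0"
    using f_eq[OF b(1)] b(2) \<alpha>\<beta> by simp
  moreover have "y a = 0" "y b = 1"
    using a b unimodular by (simp_all add: y_def algebra_simps)
  ultimately show ?thesis
    using \<open>d > 0\<close> a(1) b(1) y decomp by blast
qed

end

section \<open>The kernel of a nonzero character\<close>

text \<open>Fixes the choices needed for the kernel: \<open>d v\<close> generates the values of
  \<chi> on a vertex group, \<open>a v\<close> and \<open>b v\<close> are an adapted basis with
  \<open>y v\<close> the coordinate along \<open>b v\<close>, and \<open>c e\<close> is the
  generator of the edge group on which \<chi> is positive.\<close>

locale tubular_character = tubular_group \<G> T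
  for \<G> :: "('v, 'e, 'g, 'h) graph_of_groups" and T :: "('v, 'e) pre_digraph" +
  fixes \<chi> :: "('v, 'e, 'g) gen word set \<Rightarrow> int" and s r
    and d :: "'v \<Rightarrow> int" and a b :: "'v \<Rightarrow> 'g" and y :: "'v \<Rightarrow> 'g \<Rightarrow> int" and c :: "'e \<Rightarrow> 'h"
  assumes \<chi>_hom: "\<chi> \<in> hom G integer_group"
    and s: "s \<in> carrier G" "\<chi> s = 1"
    and r: "r \<in> V"
    and d_pos: "v \<in> V \<Longrightarrow> d v > 0"
    and ab_closed [simp]: "v \<in> V \<Longrightarrow> a v \<in> carrier (vertex_group \<G> v)"
      "v \<in> V \<Longrightarrow> b v \<in> carrier (vertex_group \<G> v)"
    and \<chi>_ab [simp]: "v \<in> V \<Longrightarrow> \<chi> (vx v (a v)) = d v" "v \<in> V \<Longrightarrow> \<chi> (vx v (b v)) = 0"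
    and y_hom: "v \<in> V \<Longrightarrow> y v \<in> hom (vertex_group \<G> v) integer_group"
    and y_ab [simp]: "v \<in> V \<Longrightarrow> y v (a v) = 0" "v \<in> V \<Longrightarrow> y v (b v) = 1"
    and decomp: "v \<in> V \<Longrightarrow> x \<in> carrier (vertex_group \<G> v) \<Longrightarrow> \<exists>k. \<chi> (vx v x) = d v * k \<and>
      x = a v [^]\<^bsub>vertex_group \<G> v\<^esub> (k::int) \<otimes>\<^bsub>vertex_group \<G> v\<^esub> b v [^]\<^bsub>vertex_group \<G> v\<^esub> (y v x :: int)"
    and c_closed [simp]: "e \<in> E \<Longrightarrow> c e \<in> carrier (edge_group \<G> e)"
    and c_gen: "e \<in> E \<Longrightarrow> z \<in> carrier (edge_group \<G> e) \<Longrightarrow> \<exists>k::int. z = c e [^]\<^bsub>edge_group \<G> e\<^esub> k"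
    and m_pos: "e \<in> E \<Longrightarrow> \<chi> (vx (src e) (tail_map \<G> e (c e))) > 0"
begin

sublocale \<chi>: group_hom G integer_group \<chi>
  by (intro group_hom.intro group_hom_axioms.intro G.group_axioms group_integer_group \<chi>_hom)

definition "av v = vx v (a v)"
definition "bv v = vx v (b v)"
definition "m e = \<chi> (vx (src e) (tail_map \<G> e (c e)))"
definition "\<tau> e = \<chi> (st e)"
text \<open>The edge generator is a power of \<open>av\<close> times \<open>bv\<close> to the power
  \<open>yp e\<close> at its tail, and \<open>yq e\<close> at its head. The powers of
  \<open>av\<close> have exponents \<open>m e\<close> divided by \<open>d\<close> of the respective
  end.\<close>

definition "yp e = y (src e) (tail_map \<G> e (c e))"
definition "yq e = y (tgt e) (head_map \<G> e (c e))"

lemma abv_closed [simp]: "v \<in> V \<Longrightarrow> av v \<in> carrier G" "v \<in> V \<Longrightarrow> bv v \<in> carrier G"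
  by (simp_all add: av_def bv_def)

lemma vx_int_pow:
  assumes "v \<in> V" "x \<in> carrier (vertex_group \<G> v)"
  shows "vx v (x [^]\<^bsub>vertex_group \<G> v\<^esub> (k::int)) = vx v x [^]\<^bsub>G\<^esub> k"
  using hom_int_pow[OF vx_hom[OF assms(1)] assms(2) group_vertex_group[OF assms(1)] G.group_axioms] .

lemma abv_comm:
  assumes "v \<in> V"
  shows "av v [^]\<^bsub>G\<^esub> (k::int) \<otimes>\<^bsub>G\<^esub> bv v [^]\<^bsub>G\<^esub> (l::int) = bv v [^]\<^bsub>G\<^esub> l \<otimes>\<^bsub>G\<^esub> av v [^]\<^bsub>G\<^esub> k"
proof -
  interpret A: group "vertex_group \<G> v"
    using assms by (rule group_vertex_group)
  show ?thesis
    using vx_comm[OF assms, of "a v [^]\<^bsub>vertex_group \<G> v\<^esub> k" "b v [^]\<^bsub>vertex_group \<G> v\<^esub> l"] assms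
    by (simp add: vx_int_pow av_def bv_def)
qed

lemma vx_decomp:
  assumes "v \<in> V" "x \<in> carrier (vertex_group \<G> v)"
  shows "d v dvd \<chi> (vx v x)"
    "vx v x = av v [^]\<^bsub>G\<^esub> (\<chi> (vx v x) div d v) \<otimes>\<^bsub>G\<^esub> bv v [^]\<^bsub>G\<^esub> y v x"
proof -
  interpret A: group "vertex_group \<G> v"
    using assms(1) by (rule group_vertex_group)
  obtain k where k: "\<chi> (vx v x) = d v * k"
    "x = a v [^]\<^bsub>vertex_group \<G> v\<^esub> k \<otimes>\<^bsub>vertex_group \<G> v\<^esub> b v [^]\<^bsub>vertex_group \<G> v\<^esub> y v x"
    using decomp[OF assms] by blast
  then show "d v dvd \<chi> (vx v x)"
    by simp
  have "vx v x = vx v (a v [^]\<^bsub>vertex_group \<G> v\<^esub> k) \<otimes>\<^bsub>G\<^esub> vx v (b v [^]\<^bsub>vertex_group \<G> v\<^esub> y v x)"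
    by (subst k(2), rule hom_mult[OF vx_hom]) (use assms in auto)
  moreover have "\<chi> (vx v x) div d v = k"
    using k(1) d_pos[OF assms(1)] by simp
  ultimately show "vx v x = av v [^]\<^bsub>G\<^esub> (\<chi> (vx v x) div d v) \<otimes>\<^bsub>G\<^esub> bv v [^]\<^bsub>G\<^esub> y v x"
    using assms(1) by (simp add: vx_int_pow av_def bv_def)
qed

text \<open>The two images of \<open>x\<close> are conjugate by \<open>st e\<close>, and \<int> is
  abelian.\<close>

lemma \<chi>_head:
  assumes "e \<in> E" "x \<in> carrier (edge_group \<G> e)"
  shows "\<chi> (vx (tgt e) (head_map \<G> e x)) = \<chi> (vx (src e) (tail_map \<G> e x))"
proof -
  have "\<chi> (st e \<otimes>\<^bsub>G\<^esub> vx (tgt e) (head_map \<G> e x)) = \<chi> (vx (src e) (tail_map \<G> e x) \<otimes>\<^bsub>G\<^esub> st e)"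
    using st_vx[OF assms] by simp
  then show ?thesis
    using assms by simp
qed

lemma d_dvd_m:
  assumes "e \<in> E"
  shows "d (src e) dvd m e" "d (tgt e) dvd m e"
  using assms vx_decomp(1)[of "src e" "tail_map \<G> e (c e)"] vx_decomp(1)[of "tgt e" "head_map \<G> e (c e)"]
  by (simp_all add: m_def \<chi>_head)

lemma tail_map_pow:
  assumes "e \<in> E"
  shows "tail_map \<G> e (c e [^]\<^bsub>edge_group \<G> e\<^esub> (k::int)) =
      tail_map \<G> e (c e) [^]\<^bsub>vertex_group \<G> (src e)\<^esub> k"
    "head_map \<G> e (c e [^]\<^bsub>edge_group \<G> e\<^esub> (k::int)) =
      head_map \<G> e (c e) [^]\<^bsub>vertex_group \<G> (tgt e)\<^esub> k"
  using assms hom_int_pow[OF tail_map_hom[OF assms] _ group_edge_group[OF assms] group_vertex_group]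
    hom_int_pow[OF head_map_hom[OF assms] _ group_edge_group[OF assms] group_vertex_group]
  by simp_all

lemma y_pow:
  assumes "v \<in> V" "x \<in> carrier (vertex_group \<G> v)"
  shows "y v (x [^]\<^bsub>vertex_group \<G> v\<^esub> (k::int)) = k * y v x"
  using hom_int_pow[OF y_hom[OF assms(1)] assms(2) group_vertex_group[OF assms(1)] group_integer_group, of k]
  by simp

lemma \<tau>_tree: "e \<in> arcs T \<Longrightarrow> \<tau> e = 0"
  by (simp add: \<tau>_def st_tree)

text \<open>The quotient by the kernel of \<open>\<chi>\<close> of its Bass-Serre tree: over a vertex \<open>v\<close> there are \<open>d v\<close>
  vertices with stabilizers generated by conjugates of \<open>b v\<close>, and over an edge \<open>e\<close> there are
  \<open>m e\<close> edges with trivial stabilizers.\<close>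

definition "cover_verts = (SIGMA v:V. {0..<d v})"
definition "cover_arcs = (SIGMA e:E. {0..<m e})"
text \<open>The pair \<open>(v, i)\<close> stands for the cosets of the vertex group of
  \<open>v\<close> by elements \<open>g\<close> with \<open>\<chi> g\<close> congruent to
  \<open>i\<close> modulo \<open>d v\<close>. The edge given by \<open>g\<close> ends in the coset
  of \<open>g\<close> times \<open>st e\<close>, hence the shift by \<open>\<tau> e\<close>.\<close>

definition "cover_src = (\<lambda>(e, i). (src e, i mod d (src e)))"
definition "cover_tgt = (\<lambda>(e, i). (tgt e, (i + \<tau> e) mod d (tgt e)))"

lemma cover_simps [simp]:
  "(v, i) \<in> cover_verts \<longleftrightarrow> v \<in> V \<and> 0 \<le> i \<and> i < d v"
  "(e, i) \<in> cover_arcs \<longleftrightarrow> e \<in> E \<and> 0 \<le> i \<and> i < m e"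
  "cover_src (e, i) = (src e, i mod d (src e))"
  "cover_tgt (e, i) = (tgt e, (i + \<tau> e) mod d (tgt e))"
  by (auto simp: cover_verts_def cover_arcs_def cover_src_def cover_tgt_def)

lemma finite_cover [simp]: "finite cover_verts" "finite cover_arcs"
  by (auto simp: cover_verts_def cover_arcs_def)

text \<open>The cover is connected because \<chi> is onto. Tree edges shift no levels, so a closed
  set \<open>S\<close> contains the same integers \<open>Z r\<close>, taken periodically, over every
  vertex. The elements of G whose value under \<chi> is a period of \<open>Z r\<close> form a
  subgroup containing all generators, hence also \<open>s\<close>; so 1 is a period and
  \<open>Z r\<close> is all of \<int>.\<close>

lemma cover_tree_exists:
  obtains TX where "rooted_tree cover_src cover_tgt cover_arcs (r, 0) cover_verts TX"
proof (rule rooted_tree_exists)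
  show "finite cover_verts" "(r, 0) \<in> cover_verts"
    using r d_pos by auto
  show "cover_src x \<in> cover_verts \<and> cover_tgt x \<in> cover_verts" if "x \<in> cover_arcs" for x
    using that d_pos by (cases x) auto
  fix S assume S: "S \<subseteq> cover_verts" "(r, 0) \<in> S"
    and closed: "\<And>x. x \<in> cover_arcs \<Longrightarrow> cover_src x \<in> S \<longleftrightarrow> cover_tgt x \<in> S"
  define Z where "Z v = {i. (v, i mod d v) \<in> S}" for v
  have Z_edge: "i \<in> Z (src e) \<longleftrightarrow> i + \<tau> e \<in> Z (tgt e)" if e: "e \<in> E" for e i
  proof -
    have "(e, i mod m e) \<in> cover_arcs"
      using e m_pos[OF e] by (simp add: m_def)
    moreover have "i mod m e mod d (src e) = i mod d (src e)"
      using d_dvd_m[OF e] by (simp add: mod_mod_cancel)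
    moreover have "(i mod m e + \<tau> e) mod d (tgt e) = (i + \<tau> e) mod d (tgt e)"
      using d_dvd_m[OF e] by (intro mod_add_cong) (simp_all add: mod_mod_cancel)
    ultimately show ?thesis
      using closed[of "(e, i mod m e)"] by (simp add: Z_def)
  qed
  have Z_tree: "Z v = Z r" if v: "v \<in> V" for v
  proof -
    have "i \<in> Z v \<longleftrightarrow> i \<in> Z r" for i
    proof (rule rooted_tree_propagate[OF tree_from[OF r] _ v])
      show "i \<in> Z (src e) \<longleftrightarrow> i \<in> Z (tgt e)" if "e \<in> arcs T" for e
        using Z_edge[of e i] \<tau>_tree[OF that] arcs_T that by auto
    qed
    then show ?thesis by blast
  qed
  define period where "period k \<longleftrightarrow> (\<forall>i. i \<in> Z r \<longleftrightarrow> i + k \<in> Z r)" for k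
  have period_neg: "period (- k)" if "period k" for k
    unfolding period_def
  proof
    show "i \<in> Z r \<longleftrightarrow> i + - k \<in> Z r" for i
      using that[unfolded period_def, THEN spec, of "i + - k"] by simp
  qed
  have period_add: "period (k + l)" if "period k" "period l" for k l
    unfolding period_def
  proof
    show "i \<in> Z r \<longleftrightarrow> i + (k + l) \<in> Z r" for i
      using that(1)[unfolded period_def, THEN spec, of i]
        that(2)[unfolded period_def, THEN spec, of "i + k"] by (simp add: add.assoc)
  qed
  define B where "B = {x \<in> carrier G. period (\<chi> x)}"
  have "B = carrier G"
  proof (rule generators)
    show "subgroup B G"
    proof (rule G.subgroupI)
      have "\<one>\<^bsub>G\<^esub> \<in> B"
        by (simp add: B_def period_def)
      then show "B \<noteq> {}" by blast
    qed (auto simp: B_def period_neg period_add)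
    show "vx v x \<in> B" if vx: "v \<in> V" "x \<in> carrier (vertex_group \<G> v)" for v x
    proof -
      have "(i + \<chi> (vx v x)) mod d v = i mod d v" for i
        using vx_decomp(1)[OF vx] by (metis add_0_right dvd_eq_mod_eq_0 mod_add_right_eq)
      then have "i \<in> Z v \<longleftrightarrow> i + \<chi> (vx v x) \<in> Z v" for i
        by (simp add: Z_def)
      then have "period (\<chi> (vx v x))"
        unfolding period_def Z_tree[OF vx(1)] by blast
      then show ?thesis
        using vx by (simp add: B_def)
    qed
    show "st e \<in> B" if e: "e \<in> E" for e
    proof -
      have "period (\<tau> e)"
        using Z_edge[OF e] unfolding period_def Z_tree[OF ends_in_V(1)[OF e]] Z_tree[OF ends_in_V(2)[OF e]]
        by blast
      then show ?thesis
        using e by (simp add: B_def \<tau>_def)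
    qed
  qed
  then have "s \<in> B"
    using s(1) by simp
  then have "period 1"
    using s(2) by (simp add: B_def)
  then have step: "i \<in> Z r \<longleftrightarrow> i + 1 \<in> Z r" for i
    unfolding period_def by blast
  have "0 \<in> Z r"
    using S(2) by (simp add: Z_def)
  then have all: "i \<in> Z r" for i
  proof (induction i rule: int_induct[where k = 0])
    case (step1 i)
    then show ?case using step[of i] by blast
  next
    case (step2 i)
    then show ?case using step[of "i - 1"] by simp
  qed
  have "(v, i) \<in> S" if "(v, i) \<in> cover_verts" for v i
  proof -
    have "i \<in> Z v"
      using all Z_tree[of v] that by simp
    then show ?thesis
      using that by (simp add: Z_def)
  qed
  with S(1) show "S = cover_verts"
    by auto
qed (use that in blast)

end

text \<open>The index set of the prospective basis: a vertex of the cover contributes the generator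
  of its infinite cyclic group, an arc outside the spanning tree \<open>TX\<close> contributes a
  stable letter. \<open>\<nu>\<close> numbers them.\<close>

locale tubular_cover = tubular_character +
  fixes TX \<nu> and n :: nat
  assumes TX: "rooted_tree cover_src cover_tgt cover_arcs (r, 0) cover_verts TX"
    and \<nu>: "bij_betw \<nu> (Inl ` cover_verts \<union> Inr ` (cover_arcs - TX)) {..<n}"
begin

abbreviation "basis_index \<equiv> Inl ` cover_verts \<union> Inr ` (cover_arcs - TX)"
abbreviation "F \<equiv> free_group {..<n}"

sublocale F: group F
  by (rule group_free_group)

text \<open>The default value is what an arc of \<open>TX\<close> receives: its stable letter is
  trivial.\<close>

definition "dat x = (if x \<in> basis_index then gen_class {..<n} {} (\<nu> x) else \<one>\<^bsub>F\<^esub>)"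
definition "\<beta> v i = dat (Inl (v, i mod d v))"
text \<open>Generators exist for the levels from 0 to \<open>m e - 1\<close> only. Raising the level
  by \<open>m e\<close> amounts to passing the edge generator, whose parts along \<open>bv\<close>
  at the two ends have exponents \<open>yp e\<close> and \<open>yq e\<close>; this forces the outer
  factors.\<close>

definition "tt e i = \<beta> (src e) i [^]\<^bsub>F\<^esub> (- (i div m e) * yp e) \<otimes>\<^bsub>F\<^esub> dat (Inr (e, i mod m e)) \<otimes>\<^bsub>F\<^esub>
  \<beta> (tgt e) (i + \<tau> e) [^]\<^bsub>F\<^esub> (i div m e * yq e)"

lemma dat_closed [simp]: "dat x \<in> carrier F"
proof -
  have "gen_class {..<n} {} (\<nu> x) \<in> carrier F" if "x \<in> basis_index"
    using bij_betwE[OF \<nu>] that by (auto simp: free_group_def)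
  then show ?thesis
    unfolding dat_def by simp
qed

lemma \<beta>_closed [simp]: "\<beta> v i \<in> carrier F"
  by (simp add: \<beta>_def)

lemma tt_closed [simp]: "tt e i \<in> carrier F"
  by (simp add: tt_def)

lemma \<beta>_periodic: "d v dvd k \<Longrightarrow> \<beta> v (i + k) = \<beta> v i"
  unfolding \<beta>_def by (metis add_0_right dvd_eq_mod_eq_0 mod_add_right_eq)

text \<open>The edge relation for the \<open>k\<close>-th power of \<open>c e\<close>, read at level
  \<open>i\<close> of the wreath product.\<close>

lemma tt_shift:
  assumes e: "e \<in> E"
  shows "tt e i \<otimes>\<^bsub>F\<^esub> \<beta> (tgt e) (i + \<tau> e) [^]\<^bsub>F\<^esub> (k * yq e) =
    \<beta> (src e) i [^]\<^bsub>F\<^esub> (k * yp e) \<otimes>\<^bsub>F\<^esub> tt e (i + k * m e)"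
proof -
  have "(i + k * m e) div m e = i div m e + k" "(i + k * m e) mod m e = i mod m e"
    using m_pos[OF e] by (simp_all add: m_def)
  moreover have "\<beta> (src e) (i + k * m e) = \<beta> (src e) i"
    "\<beta> (tgt e) (i + k * m e + \<tau> e) = \<beta> (tgt e) (i + \<tau> e)"
    using \<beta>_periodic[of "src e" "k * m e" i] \<beta>_periodic[of "tgt e" "k * m e" "i + \<tau> e"] d_dvd_m[OF e]
    by (simp_all add: ac_simps)
  ultimately have shift: "tt e (i + k * m e) = \<beta> (src e) i [^]\<^bsub>F\<^esub> (- (i div m e + k) * yp e) \<otimes>\<^bsub>F\<^esub>
      dat (Inr (e, i mod m e)) \<otimes>\<^bsub>F\<^esub> \<beta> (tgt e) (i + \<tau> e) [^]\<^bsub>F\<^esub> ((i div m e + k) * yq e)"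
    by (simp add: tt_def)
  have src: "\<beta> (src e) i [^]\<^bsub>F\<^esub> (- (i div m e) * yp e) =
      \<beta> (src e) i [^]\<^bsub>F\<^esub> (k * yp e) \<otimes>\<^bsub>F\<^esub> \<beta> (src e) i [^]\<^bsub>F\<^esub> (- (i div m e + k) * yp e)"
    by (simp add: algebra_simps flip: F.int_pow_mult)
  have tgt: "\<beta> (tgt e) (i + \<tau> e) [^]\<^bsub>F\<^esub> (i div m e * yq e) \<otimes>\<^bsub>F\<^esub> \<beta> (tgt e) (i + \<tau> e) [^]\<^bsub>F\<^esub> (k * yq e) =
      \<beta> (tgt e) (i + \<tau> e) [^]\<^bsub>F\<^esub> ((i div m e + k) * yq e)"
    by (simp add: algebra_simps flip: F.int_pow_mult)
  have "tt e i \<otimes>\<^bsub>F\<^esub> \<beta> (tgt e) (i + \<tau> e) [^]\<^bsub>F\<^esub> (k * yq e) =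
      \<beta> (src e) i [^]\<^bsub>F\<^esub> (- (i div m e) * yp e) \<otimes>\<^bsub>F\<^esub> dat (Inr (e, i mod m e)) \<otimes>\<^bsub>F\<^esub>
      (\<beta> (tgt e) (i + \<tau> e) [^]\<^bsub>F\<^esub> (i div m e * yq e) \<otimes>\<^bsub>F\<^esub> \<beta> (tgt e) (i + \<tau> e) [^]\<^bsub>F\<^esub> (k * yq e))"
    by (simp add: tt_def F.m_assoc)
  also have "\<dots> = \<beta> (src e) i [^]\<^bsub>F\<^esub> (k * yp e) \<otimes>\<^bsub>F\<^esub> tt e (i + k * m e)"
    unfolding src tgt shift by (simp add: F.m_assoc)
  finally show ?thesis .
qed

text \<open>A homomorphism from \<open>G\<close> to the wreath product lifting \<open>\<chi>\<close> induces a homomorphism from the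
  kernel of \<open>\<chi>\<close> to \<open>F\<close>, by evaluation of the first component at 0.\<close>

lemma cocycle_exists:
  obtains h \<Phi> where "\<And>i v. h i v \<in> carrier F" "\<And>i. h i r = \<one>\<^bsub>F\<^esub>"
    "\<And>i e. e \<in> arcs T \<Longrightarrow> h i (src e) \<otimes>\<^bsub>F\<^esub> tt e i = h i (tgt e)"
    "\<Phi> \<in> hom G (wreath F)" "\<And>x. x \<in> carrier G \<Longrightarrow> snd (\<Phi> x) = \<chi> x"
    "\<And>v x i. v \<in> V \<Longrightarrow> x \<in> carrier (vertex_group \<G> v) \<Longrightarrow>
      fst (\<Phi> (vx v x)) i = h i v \<otimes>\<^bsub>F\<^esub> \<beta> v i [^]\<^bsub>F\<^esub> y v x \<otimes>\<^bsub>F\<^esub> inv\<^bsub>F\<^esub> h (i + \<chi> (vx v x)) v"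
    "\<And>e i. e \<in> E \<Longrightarrow>
      fst (\<Phi> (st e)) i = h i (src e) \<otimes>\<^bsub>F\<^esub> tt e i \<otimes>\<^bsub>F\<^esub> inv\<^bsub>F\<^esub> h (i + \<tau> e) (tgt e)"
proof -
  \<comment> \<open>Edges of \<open>T\<close> have level shift 0, so a potential can be chosen on
    each level separately.\<close>
  have "\<exists>f. (\<forall>v. f v \<in> carrier F) \<and> f r = \<one>\<^bsub>F\<^esub> \<and> (\<forall>e\<in>arcs T. f (src e) \<otimes>\<^bsub>F\<^esub> tt e i = f (tgt e))" for i
    by (rule F.rooted_tree_potential[OF tree_from[OF r]]) simp
  then obtain h where h: "\<And>i v. h i v \<in> carrier F" "\<And>i. h i r = \<one>\<^bsub>F\<^esub>"
    "\<And>i e. e \<in> arcs T \<Longrightarrow> h i (src e) \<otimes>\<^bsub>F\<^esub> tt e i = h i (tgt e)"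
    by metis
  interpret W: group "wreath F"
    by (rule F.group_wreath)
  \<comment> \<open>\<open>a v\<close> becomes a pure shift by \<open>d v\<close> and
    \<open>b v\<close> the family of all \<open>\<beta> v i\<close> without shift. They commute
    because \<open>\<beta> v\<close> has period \<open>d v\<close>.\<close>
  define \<rho> where "\<rho> v x = (\<lambda>i. \<beta> v i [^]\<^bsub>F\<^esub> y v x, \<chi> (vx v x))" for v x
  define te where "te e = (\<lambda>i. tt e i, \<tau> e)" for e
  define p where "p v = (\<lambda>i. h i v, 0 :: int)" for v
  obtain \<Phi> where \<Phi>: "\<Phi> \<in> hom G (wreath F)"
    "\<And>v x. v \<in> V \<Longrightarrow> x \<in> carrier (vertex_group \<G> v) \<Longrightarrow>
      \<Phi> (vx v x) = p v \<otimes>\<^bsub>wreath F\<^esub> \<rho> v x \<otimes>\<^bsub>wreath F\<^esub> inv\<^bsub>wreath F\<^esub> p v"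
    "\<And>e. e \<in> E \<Longrightarrow> \<Phi> (st e) = p (src e) \<otimes>\<^bsub>wreath F\<^esub> te e \<otimes>\<^bsub>wreath F\<^esub> inv\<^bsub>wreath F\<^esub> p (tgt e)"
  proof (rule twisted_hom_exists[OF W.group_axioms])
    show "\<rho> v \<in> hom (vertex_group \<G> v) (wreath F)" if v: "v \<in> V" for v
    proof (rule homI)
      fix x x' assume x: "x \<in> carrier (vertex_group \<G> v)" "x' \<in> carrier (vertex_group \<G> v)"
      have "\<beta> v (i + \<chi> (vx v x)) = \<beta> v i" for i
        using vx_decomp(1)[OF v x(1)] by (rule \<beta>_periodic)
      then show "\<rho> v (x \<otimes>\<^bsub>vertex_group \<G> v\<^esub> x') = \<rho> v x \<otimes>\<^bsub>wreath F\<^esub> \<rho> v x'"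
        using v x hom_mult[OF vx_hom[OF v] x] hom_mult[OF y_hom[OF v] x]
        by (simp add: \<rho>_def F.int_pow_mult)
    qed (simp add: \<rho>_def)
    show "te e \<otimes>\<^bsub>wreath F\<^esub> \<rho> (tgt e) (head_map \<G> e x) = \<rho> (src e) (tail_map \<G> e x) \<otimes>\<^bsub>wreath F\<^esub> te e"
      if e: "e \<in> E" and x: "x \<in> carrier (edge_group \<G> e)" for e x
    proof -
      obtain k :: int where k: "x = c e [^]\<^bsub>edge_group \<G> e\<^esub> k"
        using c_gen[OF e x] by blast
      have "y (src e) (tail_map \<G> e x) = k * yp e" "y (tgt e) (head_map \<G> e x) = k * yq e"
        "\<chi> (vx (src e) (tail_map \<G> e x)) = k * m e" "\<chi> (vx (tgt e) (head_map \<G> e x)) = k * m e"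
        using e x by (simp_all add: \<chi>_head) (simp_all add: k tail_map_pow y_pow yp_def yq_def vx_int_pow
            \<chi>.hom_int_pow m_def)
      then show ?thesis
        using tt_shift[OF e, of _ k] by (simp add: te_def \<rho>_def add.commute)
    qed
    show "p (src e) \<otimes>\<^bsub>wreath F\<^esub> te e = p (tgt e)" if "e \<in> arcs T" for e
      using h(3)[OF that] \<tau>_tree[OF that] by (simp add: p_def te_def)
  qed (use h(1) in \<open>auto simp: te_def p_def\<close>)
  have inv_p: "inv\<^bsub>wreath F\<^esub> p v = (\<lambda>i. inv\<^bsub>F\<^esub> h i v, 0)" for v
    unfolding p_def using h(1) by (subst F.inv_wreath) simp_all
  note \<Phi>_simps = \<Phi>(2,3)[unfolded inv_p, unfolded p_def \<rho>_def te_def, simplified]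
  show thesis
  proof (rule that[OF h \<Phi>(1)])
    show "snd (\<Phi> x) = \<chi> x" if "x \<in> carrier G" for x
      using homs_eq[OF group_integer_group hom_compose[OF \<Phi>(1) wreath_snd_hom] \<chi>_hom _ _ that]
      by (simp add: \<Phi>_simps \<tau>_def)
  qed (simp_all add: \<Phi>_simps)
qed

text \<open>A lift of \<open>TX\<close> to the Bass-Serre tree: \<open>g v i\<close> leads from the
  base vertex to the chosen lift over \<open>(v, i mod d v)\<close>. Other levels differ by powers
  of \<open>av v\<close>, which fix the lift, and the last property says that arcs of
  \<open>TX\<close> lift to arcs between chosen lifts.\<close>

lemma section_exists:
  obtains g where "\<And>v i. v \<in> V \<Longrightarrow> g v i \<in> carrier G" "g r 0 = \<one>\<^bsub>G\<^esub>"
    "\<And>v i. v \<in> V \<Longrightarrow> \<chi> (g v i) = i"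
    "\<And>v i k. v \<in> V \<Longrightarrow> g v (i + d v * k) = g v i \<otimes>\<^bsub>G\<^esub> av v [^]\<^bsub>G\<^esub> k"
    "\<And>e i. (e, i) \<in> TX \<Longrightarrow> g (src e) i \<otimes>\<^bsub>G\<^esub> st e = g (tgt e) (i + \<tau> e)"
proof -
  have TX_sub: "e \<in> E \<and> 0 \<le> i \<and> i < m e" if "(e, i) \<in> TX" for e i
    using rooted_tree_edges[OF TX] that by auto
  \<comment> \<open>\<open>g\<close> will be \<open>f\<close> at the reduced level times a power of
    \<open>av\<close>. Moving these powers to one side of the required relation along
    \<open>TX\<close> leaves this label for \<open>f\<close>.\<close>
  define C where "C = (\<lambda>(e, i). av (src e) [^]\<^bsub>G\<^esub> (i div d (src e)) \<otimes>\<^bsub>G\<^esub> st e \<otimes>\<^bsub>G\<^esub>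
    inv\<^bsub>G\<^esub> (av (tgt e) [^]\<^bsub>G\<^esub> ((i + \<tau> e) div d (tgt e))))"
  have C_closed: "C x \<in> carrier G" if "x \<in> TX" for x
    using that TX_sub by (cases x) (auto simp: C_def)
  obtain f where f: "\<And>x. f x \<in> carrier G" "f (r, 0) = \<one>\<^bsub>G\<^esub>"
    "\<And>x. x \<in> TX \<Longrightarrow> f (cover_src x) \<otimes>\<^bsub>G\<^esub> C x = f (cover_tgt x)"
    using G.rooted_tree_potential[OF TX, of C] C_closed by blast
  have \<chi>_av: "\<chi> (av v [^]\<^bsub>G\<^esub> (k::int)) = k * d v" if "v \<in> V" for v k
    using that by (simp add: \<chi>.hom_int_pow) (simp add: av_def)
  have \<chi>_step: "\<chi> (f (cover_src x)) = snd (cover_src x) \<longleftrightarrow> \<chi> (f (cover_tgt x)) = snd (cover_tgt x)"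
    if x: "x \<in> TX" for x
  proof -
    obtain e i where xe: "x = (e, i)" "e \<in> E"
      using x TX_sub by (cases x) auto
    have "\<chi> (f (cover_tgt x)) = \<chi> (f (cover_src x)) + \<chi> (C x)"
      using f(3)[OF x, symmetric] f(1) C_closed[OF x] by simp
    moreover have "\<chi> (C x) = i div d (src e) * d (src e) + \<tau> e - (i + \<tau> e) div d (tgt e) * d (tgt e)"
      using xe by (simp add: C_def \<chi>_av \<tau>_def)
    moreover have "i div d (src e) * d (src e) = i - i mod d (src e)"
      "(i + \<tau> e) div d (tgt e) * d (tgt e) = i + \<tau> e - (i + \<tau> e) mod d (tgt e)"
      by (simp_all add: minus_mod_eq_div_mult)
    ultimately show ?thesis
      using xe by auto
  qed
  have \<chi>_f: "\<chi> (f (v, i)) = i" if "v \<in> V" "0 \<le> i" "i < d v" for v i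
    using rooted_tree_propagate[OF TX, of "\<lambda>x. \<chi> (f x) = snd x" "(v, i)"] \<chi>_step that f(2) by simp
  define g where "g v i = f (v, i mod d v) \<otimes>\<^bsub>G\<^esub> av v [^]\<^bsub>G\<^esub> (i div d v)" for v i
  show thesis
  proof (rule that[of g])
    show closed: "g v i \<in> carrier G" if "v \<in> V" for v i
      using that f(1) by (simp add: g_def)
    show "g r 0 = \<one>\<^bsub>G\<^esub>"
      using f(2) by (simp add: g_def)
    show "\<chi> (g v i) = i" if "v \<in> V" for v i
      using that f(1) \<chi>_f[OF that, of "i mod d v"] d_pos[OF that] by (simp add: g_def \<chi>_av)
    show "g v (i + d v * k) = g v i \<otimes>\<^bsub>G\<^esub> av v [^]\<^bsub>G\<^esub> k" if "v \<in> V" for v i k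
    proof -
      have "av v [^]\<^bsub>G\<^esub> ((i + d v * k) div d v) = av v [^]\<^bsub>G\<^esub> (i div d v) \<otimes>\<^bsub>G\<^esub> av v [^]\<^bsub>G\<^esub> k"
        using that d_pos[OF that] by (simp add: add.commute flip: G.int_pow_mult)
      then show ?thesis
        unfolding g_def using that f(1) by (simp only: mod_mult_self2 G.m_assoc G.int_pow_closed abv_closed)
    qed
    show "g (src e) i \<otimes>\<^bsub>G\<^esub> st e = g (tgt e) (i + \<tau> e)" if "(e, i) \<in> TX" for e i
      using f(3)[OF that, symmetric] f(1) TX_sub[OF that] by (simp add: g_def C_def G.group_normalize)
  qed
qed

end

section \<open>Mutually inverse maps between the free group and the kernel\<close>

context tubular_cover
begin

text \<open>\<open>\<phi>\<close> realizes the basis in the kernel, and \<open>\<psi>\<close>, the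
  component of \<open>\<Phi>\<close> at level 0, inverts it. One composite is computed on the
  generators of G, at all levels at once; the other on the basis of \<open>F\<close>.\<close>

lemma free_by_cyclic_if_cover: "free_by_cyclic G"
proof -
  obtain h \<Phi> where h: "\<And>i v. h i v \<in> carrier F" "\<And>i. h i r = \<one>\<^bsub>F\<^esub>"
    "\<And>i e. e \<in> arcs T \<Longrightarrow> h i (src e) \<otimes>\<^bsub>F\<^esub> tt e i = h i (tgt e)"
    and \<Phi>: "\<Phi> \<in> hom G (wreath F)" "\<And>x. x \<in> carrier G \<Longrightarrow> snd (\<Phi> x) = \<chi> x"
    "\<And>v x i. v \<in> V \<Longrightarrow> x \<in> carrier (vertex_group \<G> v) \<Longrightarrow>
      fst (\<Phi> (vx v x)) i = h i v \<otimes>\<^bsub>F\<^esub> \<beta> v i [^]\<^bsub>F\<^esub> y v x \<otimes>\<^bsub>F\<^esub> inv\<^bsub>F\<^esub> h (i + \<chi> (vx v x)) v"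
    "\<And>e i. e \<in> E \<Longrightarrow>
      fst (\<Phi> (st e)) i = h i (src e) \<otimes>\<^bsub>F\<^esub> tt e i \<otimes>\<^bsub>F\<^esub> inv\<^bsub>F\<^esub> h (i + \<tau> e) (tgt e)"
    using cocycle_exists by blast
  obtain g where g: "\<And>v i. v \<in> V \<Longrightarrow> g v i \<in> carrier G" "g r 0 = \<one>\<^bsub>G\<^esub>"
    "\<And>v i. v \<in> V \<Longrightarrow> \<chi> (g v i) = i"
    "\<And>v i k. v \<in> V \<Longrightarrow> g v (i + d v * k) = g v i \<otimes>\<^bsub>G\<^esub> av v [^]\<^bsub>G\<^esub> k"
    "\<And>e i. (e, i) \<in> TX \<Longrightarrow> g (src e) i \<otimes>\<^bsub>G\<^esub> st e = g (tgt e) (i + \<tau> e)"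
    using section_exists by blast
  have TX_sub: "TX \<subseteq> cover_arcs"
    using rooted_tree_edges[OF TX] by blast
  \<comment> \<open>The first kind generates the kernel part of the stabilizer of a chosen lift; the
    second compares the end of a lifted arc with the chosen lift there, and is trivial on
    \<open>TX\<close>.\<close>
  define \<kappa> where "\<kappa> = case_sum (\<lambda>(v, i). g v i \<otimes>\<^bsub>G\<^esub> bv v \<otimes>\<^bsub>G\<^esub> inv\<^bsub>G\<^esub> g v i)
    (\<lambda>(e, i). g (src e) i \<otimes>\<^bsub>G\<^esub> st e \<otimes>\<^bsub>G\<^esub> inv\<^bsub>G\<^esub> g (tgt e) (i + \<tau> e))"
  have \<kappa>_Inl: "\<kappa> (Inl (v, i)) = g v i \<otimes>\<^bsub>G\<^esub> bv v \<otimes>\<^bsub>G\<^esub> inv\<^bsub>G\<^esub> g v i"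
    and \<kappa>_Inr: "\<kappa> (Inr (e, i)) = g (src e) i \<otimes>\<^bsub>G\<^esub> st e \<otimes>\<^bsub>G\<^esub> inv\<^bsub>G\<^esub> g (tgt e) (i + \<tau> e)" for v e i
    by (simp_all add: \<kappa>_def)
  have \<kappa>: "\<kappa> x \<in> carrier G" "\<chi> (\<kappa> x) = 0" if "x \<in> Inl ` cover_verts \<union> Inr ` cover_arcs" for x
    using that g(1,3) by (auto simp: \<kappa>_Inl \<kappa>_Inr \<tau>_def bv_def)
  have basis_sub: "x \<in> Inl ` cover_verts \<union> Inr ` cover_arcs" if "x \<in> basis_index" for x
    using that by blast
  have inv_\<nu>: "inv_into basis_index \<nu> k \<in> basis_index" if "k < n" for k
    using that bij_betw_imp_surj_on[OF \<nu>] by (intro inv_into_into) simp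
  have "(\<lambda>k. \<kappa> (inv_into basis_index \<nu> k)) \<in> {..<n} \<rightarrow> carrier G"
    by (intro Pi_I \<kappa>(1) basis_sub inv_\<nu>) simp
  from presented_group_hom_exists[OF G.group_axioms this, of "{}"]
  obtain \<phi> where "\<phi> \<in> hom (presented_group {..<n} {}) G"
    "\<And>k. k \<in> {..<n} \<Longrightarrow> \<phi> (gen_class {..<n} {} k) = \<kappa> (inv_into basis_index \<nu> k)"
    by blast
  then have \<phi>: "\<phi> \<in> hom F G"
    "\<And>k. k < n \<Longrightarrow> \<phi> (gen_class {..<n} {} k) = \<kappa> (inv_into basis_index \<nu> k)"
    by (simp_all add: free_group_def)
  interpret \<phi>: group_hom F G \<phi>
    by (intro group_hom.intro group_hom_axioms.intro G.group_axioms F.group_axioms \<phi>(1))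

  have \<phi>_dat: "\<phi> (dat x) = \<kappa> x" if x: "x \<in> Inl ` cover_verts \<union> Inr ` cover_arcs" for x
  proof (cases "x \<in> basis_index")
    case True
    then have "\<nu> x < n" "inv_into basis_index \<nu> (\<nu> x) = x"
      using bij_betwE[OF \<nu>] bij_betw_inv_into_left[OF \<nu>] by blast+
    then show ?thesis
      using \<phi>(2) True by (simp add: dat_def)
  next
    case False
    then obtain e i where ei: "x = Inr (e, i)" "(e, i) \<in> TX" "(e, i) \<in> cover_arcs"
      using x by auto
    then have "\<kappa> x = \<one>\<^bsub>G\<^esub>"
      using g(1,5) by (simp add: \<kappa>_Inr)
    then show ?thesis
      using False by (simp add: dat_def)
  qed
  \<comment> \<open>Reducing the level changes \<open>g v i\<close> by a power of
    \<open>av v\<close>, which commutes with \<open>bv v\<close>.\<close>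
  have \<phi>_\<beta>: "\<phi> (\<beta> v i) = g v i \<otimes>\<^bsub>G\<^esub> bv v \<otimes>\<^bsub>G\<^esub> inv\<^bsub>G\<^esub> g v i" if v: "v \<in> V" for v i
  proof -
    have "g v i = g v (i mod d v) \<otimes>\<^bsub>G\<^esub> av v [^]\<^bsub>G\<^esub> (i div d v)"
      using g(4)[OF v, of "i mod d v" "i div d v"] by simp
    moreover have "av v [^]\<^bsub>G\<^esub> (i div d v) \<otimes>\<^bsub>G\<^esub> bv v = bv v \<otimes>\<^bsub>G\<^esub> av v [^]\<^bsub>G\<^esub> (i div d v)"
      using abv_comm[OF v, of "i div d v" 1] v by simp
    then have "av v [^]\<^bsub>G\<^esub> (i div d v) \<otimes>\<^bsub>G\<^esub> bv v \<otimes>\<^bsub>G\<^esub> inv\<^bsub>G\<^esub> (av v [^]\<^bsub>G\<^esub> (i div d v)) = bv v"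
      using v by (simp add: G.group_normalize)
    then have "g v (i mod d v) \<otimes>\<^bsub>G\<^esub> (av v [^]\<^bsub>G\<^esub> (i div d v) \<otimes>\<^bsub>G\<^esub> bv v \<otimes>\<^bsub>G\<^esub>
        inv\<^bsub>G\<^esub> (av v [^]\<^bsub>G\<^esub> (i div d v))) \<otimes>\<^bsub>G\<^esub> inv\<^bsub>G\<^esub> g v (i mod d v) = \<phi> (\<beta> v i)"
      using v d_pos[OF v] \<phi>_dat[of "Inl (v, i mod d v)"] by (simp add: \<beta>_def \<kappa>_Inl)
    ultimately show ?thesis
      using v g(1)[OF v] by (simp add: G.group_normalize)
  qed
  \<comment> \<open>For the residue \<open>i0\<close> of \<open>i\<close> this is the choice of
    \<open>\<phi>\<close>. Going back to \<open>i\<close> multiplies the two values of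
    \<open>g\<close> by \<open>A\<close> and \<open>A'\<close>. The edge relation for the power
    \<open>q\<close> of \<open>c e\<close> trades these for \<open>B\<close> and \<open>B'\<close>,
    the outer factors in \<open>tt\<close>.\<close>
  have \<phi>_tt: "\<phi> (tt e i) = g (src e) i \<otimes>\<^bsub>G\<^esub> st e \<otimes>\<^bsub>G\<^esub> inv\<^bsub>G\<^esub> g (tgt e) (i + \<tau> e)" if e: "e \<in> E" for e i
  proof -
    note ends = ends_in_V[OF e]
    define q where "q = i div m e"
    define i0 where "i0 = i mod m e"
    have i: "i = i0 + q * m e"
      by (simp add: q_def i0_def)
    define A where "A = av (src e) [^]\<^bsub>G\<^esub> (q * m e div d (src e))"
    define A' where "A' = av (tgt e) [^]\<^bsub>G\<^esub> (q * m e div d (tgt e))"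
    define B where "B = bv (src e) [^]\<^bsub>G\<^esub> (q * yp e)"
    define B' where "B' = bv (tgt e) [^]\<^bsub>G\<^esub> (q * yq e)"
    note defs = A_def A'_def B_def B'_def
    have closed: "A \<in> carrier G" "A' \<in> carrier G" "B \<in> carrier G" "B' \<in> carrier G"
      "g (src e) j \<in> carrier G" "g (tgt e) j \<in> carrier G" "st e \<in> carrier G" for j
      using ends e g(1) by (simp_all add: defs)
    have comm: "A \<otimes>\<^bsub>G\<^esub> B = B \<otimes>\<^bsub>G\<^esub> A" "A' \<otimes>\<^bsub>G\<^esub> B' = B' \<otimes>\<^bsub>G\<^esub> A'"
      unfolding defs by (rule abv_comm[OF ends(1)], rule abv_comm[OF ends(2)])
    define x where "x = c e [^]\<^bsub>edge_group \<G> e\<^esub> q"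
    interpret C: group "edge_group \<G> e"
      using e by (rule group_edge_group)
    have x: "x \<in> carrier (edge_group \<G> e)"
      using e by (simp add: x_def)
    have vals: "y (src e) (tail_map \<G> e x) = q * yp e" "y (tgt e) (head_map \<G> e x) = q * yq e"
      "\<chi> (vx (src e) (tail_map \<G> e x)) = q * m e" "\<chi> (vx (tgt e) (head_map \<G> e x)) = q * m e"
      using e x by (simp_all add: \<chi>_head) (simp_all add: x_def tail_map_pow y_pow yp_def yq_def vx_int_pow
          \<chi>.hom_int_pow m_def)
    have "vx (src e) (tail_map \<G> e x) = A \<otimes>\<^bsub>G\<^esub> B" "vx (tgt e) (head_map \<G> e x) = A' \<otimes>\<^bsub>G\<^esub> B'"
      using vx_decomp(2)[OF ends(1), of "tail_map \<G> e x"] vx_decomp(2)[OF ends(2), of "head_map \<G> e x"] e x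
      by (simp_all add: vals defs)
    then have rel: "st e \<otimes>\<^bsub>G\<^esub> (B' \<otimes>\<^bsub>G\<^esub> A') = B \<otimes>\<^bsub>G\<^esub> A \<otimes>\<^bsub>G\<^esub> st e"
      using st_vx[OF e x] comm by simp
    have "A \<otimes>\<^bsub>G\<^esub> st e \<otimes>\<^bsub>G\<^esub> inv\<^bsub>G\<^esub> A' = inv\<^bsub>G\<^esub> B \<otimes>\<^bsub>G\<^esub> (B \<otimes>\<^bsub>G\<^esub> A \<otimes>\<^bsub>G\<^esub> st e) \<otimes>\<^bsub>G\<^esub> inv\<^bsub>G\<^esub> A'"
      using closed by (simp add: G.group_normalize)
    also have "\<dots> = inv\<^bsub>G\<^esub> B \<otimes>\<^bsub>G\<^esub> st e \<otimes>\<^bsub>G\<^esub> B'"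
      unfolding rel[symmetric] using closed by (simp add: G.group_normalize)
    finally have rel': "A \<otimes>\<^bsub>G\<^esub> st e \<otimes>\<^bsub>G\<^esub> inv\<^bsub>G\<^esub> A' = inv\<^bsub>G\<^esub> B \<otimes>\<^bsub>G\<^esub> st e \<otimes>\<^bsub>G\<^esub> B'" .
    have conj_B: "A \<otimes>\<^bsub>G\<^esub> inv\<^bsub>G\<^esub> B \<otimes>\<^bsub>G\<^esub> inv\<^bsub>G\<^esub> A = inv\<^bsub>G\<^esub> B" "A' \<otimes>\<^bsub>G\<^esub> B' \<otimes>\<^bsub>G\<^esub> inv\<^bsub>G\<^esub> A' = B'"
    proof -
      have "inv\<^bsub>G\<^esub> B \<otimes>\<^bsub>G\<^esub> A = A \<otimes>\<^bsub>G\<^esub> inv\<^bsub>G\<^esub> B"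
        using closed by (intro G.commute_inv comm(1)[symmetric])
      then show "A \<otimes>\<^bsub>G\<^esub> inv\<^bsub>G\<^esub> B \<otimes>\<^bsub>G\<^esub> inv\<^bsub>G\<^esub> A = inv\<^bsub>G\<^esub> B"
        using closed by (metis G.inv_closed G.inv_solve_right' G.m_closed)
      show "A' \<otimes>\<^bsub>G\<^esub> B' \<otimes>\<^bsub>G\<^esub> inv\<^bsub>G\<^esub> A' = B'"
        unfolding comm using closed by (simp add: G.m_assoc)
    qed
    obtain k k' where k: "m e = d (src e) * k" "m e = d (tgt e) * k'"
      using d_dvd_m[OF e] by (metis dvdE)
    have quot: "q * m e div d (src e) = q * k" "q * m e div d (tgt e) = q * k'"
      using d_pos[OF ends(1)] d_pos[OF ends(2)] by (simp add: k(1), simp add: k(2))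
    have "i = i0 + d (src e) * (q * k)" "i + \<tau> e = i0 + \<tau> e + d (tgt e) * (q * k')"
      by (simp add: i k(1), simp add: i k(2))
    then have shift: "g (src e) i = g (src e) i0 \<otimes>\<^bsub>G\<^esub> A"
      "g (tgt e) (i + \<tau> e) = g (tgt e) (i0 + \<tau> e) \<otimes>\<^bsub>G\<^esub> A'"
      unfolding A_def A'_def quot
      using g(4)[OF ends(1), of i0 "q * k"] g(4)[OF ends(2), of "i0 + \<tau> e" "q * k'"] by metis+
    have "(e, i0) \<in> cover_arcs"
      using e m_pos[OF e] by (simp add: i0_def m_def)
    then have dat_i0: "\<phi> (dat (Inr (e, i0))) = g (src e) i0 \<otimes>\<^bsub>G\<^esub> st e \<otimes>\<^bsub>G\<^esub> inv\<^bsub>G\<^esub> g (tgt e) (i0 + \<tau> e)"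
      using \<phi>_dat[of "Inr (e, i0)"] by (simp add: \<kappa>_Inr)
    have "\<phi> (tt e i) = \<phi> (\<beta> (src e) i) [^]\<^bsub>G\<^esub> (- (q * yp e)) \<otimes>\<^bsub>G\<^esub> \<phi> (dat (Inr (e, i0))) \<otimes>\<^bsub>G\<^esub>
        \<phi> (\<beta> (tgt e) (i + \<tau> e)) [^]\<^bsub>G\<^esub> (q * yq e)"
      by (simp add: tt_def \<phi>.hom_int_pow flip: q_def i0_def)
    also have "\<phi> (\<beta> (src e) i) [^]\<^bsub>G\<^esub> (- (q * yp e)) = g (src e) i \<otimes>\<^bsub>G\<^esub> inv\<^bsub>G\<^esub> B \<otimes>\<^bsub>G\<^esub> inv\<^bsub>G\<^esub> g (src e) i"
      using ends closed by (simp add: \<phi>_\<beta> G.conj_int_pow G.int_pow_neg B_def)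
        (simp add: G.group_normalize)
    also have "\<dots> = g (src e) i0 \<otimes>\<^bsub>G\<^esub> (A \<otimes>\<^bsub>G\<^esub> inv\<^bsub>G\<^esub> B \<otimes>\<^bsub>G\<^esub> inv\<^bsub>G\<^esub> A) \<otimes>\<^bsub>G\<^esub> inv\<^bsub>G\<^esub> g (src e) i0"
      unfolding shift using closed by (simp add: G.group_normalize)
    also have "\<phi> (\<beta> (tgt e) (i + \<tau> e)) [^]\<^bsub>G\<^esub> (q * yq e) =
        g (tgt e) (i + \<tau> e) \<otimes>\<^bsub>G\<^esub> B' \<otimes>\<^bsub>G\<^esub> inv\<^bsub>G\<^esub> g (tgt e) (i + \<tau> e)"
      using ends closed by (simp add: \<phi>_\<beta> G.conj_int_pow B'_def)
    also have "\<dots> = g (tgt e) (i0 + \<tau> e) \<otimes>\<^bsub>G\<^esub> (A' \<otimes>\<^bsub>G\<^esub> B' \<otimes>\<^bsub>G\<^esub> inv\<^bsub>G\<^esub> A') \<otimes>\<^bsub>G\<^esub> inv\<^bsub>G\<^esub> g (tgt e) (i0 + \<tau> e)"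
      unfolding shift using closed by (simp add: G.group_normalize)
    finally have "\<phi> (tt e i) = g (src e) i0 \<otimes>\<^bsub>G\<^esub> (inv\<^bsub>G\<^esub> B \<otimes>\<^bsub>G\<^esub> st e \<otimes>\<^bsub>G\<^esub> B') \<otimes>\<^bsub>G\<^esub> inv\<^bsub>G\<^esub> g (tgt e) (i0 + \<tau> e)"
      unfolding conj_B dat_i0 using closed by (simp add: G.group_normalize)
    then show ?thesis
      unfolding rel'[symmetric] shift using closed by (simp add: G.group_normalize)
  qed
  \<comment> \<open>Both sides agree at the root and change by the same factor along an edge of
    \<open>T\<close>, where the stable letter is trivial and the level shift is 0.\<close>
  have \<phi>_h: "\<phi> (h i v) = g r i \<otimes>\<^bsub>G\<^esub> inv\<^bsub>G\<^esub> g v i" if v: "v \<in> V" for v i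
  proof -
    have "\<phi> (h i (src e)) = g r i \<otimes>\<^bsub>G\<^esub> inv\<^bsub>G\<^esub> g (src e) i \<longleftrightarrow>
        \<phi> (h i (tgt e)) = g r i \<otimes>\<^bsub>G\<^esub> inv\<^bsub>G\<^esub> g (tgt e) i" if e: "e \<in> arcs T" for e
    proof -
      have eE: "e \<in> E"
        using e arcs_T by blast
      have closed: "g (src e) i \<in> carrier G" "g (tgt e) i \<in> carrier G" "g r i \<in> carrier G"
        "\<phi> (h i (src e)) \<in> carrier G"
        using eE r g(1) h(1) by auto
      have "\<phi> (h i (tgt e)) = \<phi> (h i (src e)) \<otimes>\<^bsub>G\<^esub> \<phi> (tt e i)"
        using h(1) by (simp flip: h(3)[OF e])
      then have step: "\<phi> (h i (tgt e)) = \<phi> (h i (src e)) \<otimes>\<^bsub>G\<^esub> (g (src e) i \<otimes>\<^bsub>G\<^esub> inv\<^bsub>G\<^esub> g (tgt e) i)"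
        using closed by (simp add: \<phi>_tt[OF eE] st_tree[OF e] \<tau>_tree[OF e])
      have "g r i \<otimes>\<^bsub>G\<^esub> inv\<^bsub>G\<^esub> g (tgt e) i =
          g r i \<otimes>\<^bsub>G\<^esub> inv\<^bsub>G\<^esub> g (src e) i \<otimes>\<^bsub>G\<^esub> (g (src e) i \<otimes>\<^bsub>G\<^esub> inv\<^bsub>G\<^esub> g (tgt e) i)"
        using closed by (simp add: G.group_normalize)
      then show ?thesis
        unfolding step using closed by (simp only: G.right_cancel G.m_closed G.inv_closed)
    qed
    from rooted_tree_propagate[OF tree_from[OF r], of "\<lambda>v. \<phi> (h i v) = g r i \<otimes>\<^bsub>G\<^esub> inv\<^bsub>G\<^esub> g v i", OF this v]
    show ?thesis
      using h(2) g(1)[OF r] by simp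
  qed

  \<comment> \<open>The right-hand side, with \<chi> as second component, is the homomorphism into
    the wreath product of G given by the transversal \<open>g r\<close>. On generators the
    intermediate \<open>g v i\<close> telescope. For \<open>i = 0\<close> and
    \<open>\<chi> x = 0\<close> the formula gives \<open>\<phi> (\<psi> x) = x\<close>.\<close>
  have \<phi>\<Phi>: "\<phi> (fst (\<Phi> x) i) = g r i \<otimes>\<^bsub>G\<^esub> x \<otimes>\<^bsub>G\<^esub> inv\<^bsub>G\<^esub> g r (i + \<chi> x)" if x: "x \<in> carrier G" for x i
  proof -
    define \<Psi> where "\<Psi> x = (\<lambda>i. g r i \<otimes>\<^bsub>G\<^esub> x \<otimes>\<^bsub>G\<^esub> inv\<^bsub>G\<^esub> g r (i + \<chi> x), \<chi> x)" for x
    have \<Psi>: "\<Psi> \<in> hom G (wreath G)"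
      using g(1)[OF r] by (intro homI) (auto simp: \<Psi>_def G.group_normalize add.assoc)
    have "(map_prod (\<lambda>f. \<phi> \<circ> f) id \<circ> \<Phi>) x = \<Psi> x"
    proof (rule homs_eq[OF G.group_wreath hom_compose[OF \<Phi>(1) wreath_map_hom[OF \<phi>(1)]] \<Psi> _ _ x])
      show "(map_prod (\<lambda>f. \<phi> \<circ> f) id \<circ> \<Phi>) (vx v x) = \<Psi> (vx v x)"
        if v: "v \<in> V" and x: "x \<in> carrier (vertex_group \<G> v)" for v x
      proof -
        have "\<phi> (fst (\<Phi> (vx v x)) i) = g r i \<otimes>\<^bsub>G\<^esub> vx v x \<otimes>\<^bsub>G\<^esub> inv\<^bsub>G\<^esub> g r (i + \<chi> (vx v x))" for i
        proof -
          obtain k where k: "\<chi> (vx v x) = d v * k"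
            using vx_decomp(1)[OF v x] by (metis dvdE)
          then have vx: "vx v x = av v [^]\<^bsub>G\<^esub> k \<otimes>\<^bsub>G\<^esub> bv v [^]\<^bsub>G\<^esub> y v x"
            using vx_decomp(2)[OF v x] d_pos[OF v] by simp
          have closed: "g r j \<in> carrier G" "g v j \<in> carrier G" for j
            using g(1) r v by auto
          have "\<phi> (fst (\<Phi> (vx v x)) i) = g r i \<otimes>\<^bsub>G\<^esub> inv\<^bsub>G\<^esub> g v i \<otimes>\<^bsub>G\<^esub>
              (g v i \<otimes>\<^bsub>G\<^esub> bv v [^]\<^bsub>G\<^esub> y v x \<otimes>\<^bsub>G\<^esub> inv\<^bsub>G\<^esub> g v i) \<otimes>\<^bsub>G\<^esub>
              inv\<^bsub>G\<^esub> (g r (i + \<chi> (vx v x)) \<otimes>\<^bsub>G\<^esub> inv\<^bsub>G\<^esub> g v (i + \<chi> (vx v x)))"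
            using v x h(1) closed by (simp add: \<Phi>(3) \<phi>.hom_int_pow \<phi>_\<beta> \<phi>_h G.conj_int_pow)
          also have "\<dots> = g r i \<otimes>\<^bsub>G\<^esub> (bv v [^]\<^bsub>G\<^esub> y v x \<otimes>\<^bsub>G\<^esub> av v [^]\<^bsub>G\<^esub> k) \<otimes>\<^bsub>G\<^esub>
              inv\<^bsub>G\<^esub> g r (i + \<chi> (vx v x))"
            using v closed by (simp add: k g(4)[OF v] G.group_normalize)
          also have "bv v [^]\<^bsub>G\<^esub> y v x \<otimes>\<^bsub>G\<^esub> av v [^]\<^bsub>G\<^esub> k = vx v x"
            unfolding vx by (rule abv_comm[OF v, symmetric])
          finally show ?thesis .
        qed
        moreover have "snd (\<Phi> (vx v x)) = \<chi> (vx v x)"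
          using v x by (simp add: \<Phi>(2))
        ultimately show ?thesis
          by (simp add: \<Psi>_def prod_eq_iff fun_eq_iff)
      qed
      show "(map_prod (\<lambda>f. \<phi> \<circ> f) id \<circ> \<Phi>) (st e) = \<Psi> (st e)" if e: "e \<in> E" for e
      proof -
        have closed: "g r j \<in> carrier G" "g (src e) j \<in> carrier G" "g (tgt e) j \<in> carrier G" for j
          using g(1) r e by auto
        have "\<phi> (fst (\<Phi> (st e)) i) = g r i \<otimes>\<^bsub>G\<^esub> st e \<otimes>\<^bsub>G\<^esub> inv\<^bsub>G\<^esub> g r (i + \<chi> (st e))" for i
          using e h(1) closed by (simp add: \<Phi>(4) \<phi>_tt \<phi>_h G.group_normalize flip: \<tau>_def)
        moreover have "snd (\<Phi> (st e)) = \<chi> (st e)"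
          using e by (simp add: \<Phi>(2))
        ultimately show ?thesis
          by (simp add: \<Psi>_def prod_eq_iff fun_eq_iff)
      qed
    qed
    then show ?thesis
      by (auto simp: \<Psi>_def prod_eq_iff dest: fun_cong[of _ _ i])
  qed

  define \<psi> where "\<psi> x = fst (\<Phi> x) 0" for x
  have \<Phi>_closed: "fst (\<Phi> x) i \<in> carrier F" if "x \<in> carrier G" for x i
    using hom_carrier[OF \<Phi>(1)] that by (auto simp: wreath_def Pi_iff image_subset_iff mem_Times_iff)
  have \<psi>_closed: "\<psi> x \<in> carrier F" if "x \<in> carrier G" for x
    using that by (simp add: \<psi>_def \<Phi>_closed)
  \<comment> \<open>A crossed homomorphism rule: the second factor is read at the level reached by
    the first. On the kernel of \<chi> that level is 0.\<close>
  have \<psi>_mult: "\<psi> (x \<otimes>\<^bsub>G\<^esub> x') = \<psi> x \<otimes>\<^bsub>F\<^esub> fst (\<Phi> x') (\<chi> x)" if "x \<in> carrier G" "x' \<in> carrier G" for x x'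
    using hom_mult[OF \<Phi>(1) that] \<Phi>(2)[OF that(1)] that
    by (simp add: \<psi>_def wreath_def case_prod_unfold)
  have \<psi>_g_shift: "\<psi> (g v (i + d v * k)) = \<psi> (g v i) \<otimes>\<^bsub>F\<^esub> (h i v \<otimes>\<^bsub>F\<^esub> inv\<^bsub>F\<^esub> h (i + d v * k) v)"
    if v: "v \<in> V" for v i k
  proof -
    interpret A: group "vertex_group \<G> v"
      using v by (rule group_vertex_group)
    have "av v [^]\<^bsub>G\<^esub> k = vx v (a v [^]\<^bsub>vertex_group \<G> v\<^esub> k)"
      using v by (simp add: av_def vx_int_pow)
    moreover have "\<chi> (av v [^]\<^bsub>G\<^esub> k) = d v * k"
      using v by (simp add: \<chi>.hom_int_pow) (simp add: av_def)
    moreover have "y v (a v [^]\<^bsub>vertex_group \<G> v\<^esub> k) = 0"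
      using v by (simp add: y_pow)
    ultimately have "fst (\<Phi> (av v [^]\<^bsub>G\<^esub> k)) i = h i v \<otimes>\<^bsub>F\<^esub> inv\<^bsub>F\<^esub> h (i + d v * k) v"
      using v h(1) \<Phi>(3)[OF v, of "a v [^]\<^bsub>vertex_group \<G> v\<^esub> k" i] by simp
    then show ?thesis
      using v g(1,3) by (simp add: g(4) \<psi>_mult)
  qed
  \<comment> \<open>True at \<open>(r, 0)\<close>, where both sides are trivial. It depends on
    \<open>i\<close> only modulo \<open>d v\<close> and passes across the arcs of \<open>TX\<close>,
    where \<open>tt e i\<close> is trivial, so it holds over the whole cover.\<close>
  define Q where "Q v i \<longleftrightarrow> \<psi> (g v i) = inv\<^bsub>F\<^esub> h i v" for v i
  have cancel: "x \<otimes>\<^bsub>F\<^esub> (z \<otimes>\<^bsub>F\<^esub> w) = w \<longleftrightarrow> x = inv\<^bsub>F\<^esub> z"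
    if xzw: "x \<in> carrier F" "z \<in> carrier F" "w \<in> carrier F" for x z w
  proof
    assume "x \<otimes>\<^bsub>F\<^esub> (z \<otimes>\<^bsub>F\<^esub> w) = w"
    then have "x \<otimes>\<^bsub>F\<^esub> z \<otimes>\<^bsub>F\<^esub> w = \<one>\<^bsub>F\<^esub> \<otimes>\<^bsub>F\<^esub> w"
      using xzw by (simp add: F.m_assoc)
    then have "x \<otimes>\<^bsub>F\<^esub> z = \<one>\<^bsub>F\<^esub>"
      using xzw by (simp only: F.right_cancel F.m_closed F.one_closed)
    then show "x = inv\<^bsub>F\<^esub> z"
      using xzw by (simp add: F.inv_equality)
  qed (use xzw in \<open>simp add: F.group_normalize\<close>)
  have Q_mod: "Q v (i mod d v) \<longleftrightarrow> Q v i" if v: "v \<in> V" for v i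
  proof -
    have "\<psi> (g v i) = \<psi> (g v (i mod d v)) \<otimes>\<^bsub>F\<^esub> (h (i mod d v) v \<otimes>\<^bsub>F\<^esub> inv\<^bsub>F\<^esub> h i v)"
      using \<psi>_g_shift[OF v, of "i mod d v" "i div d v"] by simp
    then show ?thesis
      using v h(1) g(1) by (simp add: Q_def cancel \<psi>_closed)
  qed
  have Q_edge: "Q (src e) i \<longleftrightarrow> Q (tgt e) (i + \<tau> e)" if ei: "(e, i) \<in> TX" for e i
  proof -
    have e: "e \<in> E" "0 \<le> i" "i < m e"
      using ei TX_sub by auto
    then have "tt e i = \<one>\<^bsub>F\<^esub>"
      using ei by (auto simp: tt_def dat_def)
    then have "\<psi> (g (tgt e) (i + \<tau> e)) = \<psi> (g (src e) i) \<otimes>\<^bsub>F\<^esub> (h i (src e) \<otimes>\<^bsub>F\<^esub> inv\<^bsub>F\<^esub> h (i + \<tau> e) (tgt e))"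
      using e g(1,3) h(1) by (simp add: \<psi>_mult \<Phi>(4) flip: g(5)[OF ei])
    then show ?thesis
      using e h(1) g(1) by (simp add: Q_def cancel \<psi>_closed)
  qed
  have "Q (fst (cover_src x)) (snd (cover_src x)) \<longleftrightarrow> Q (fst (cover_tgt x)) (snd (cover_tgt x))"
    if x: "x \<in> TX" for x
  proof -
    obtain e i where "x = (e, i)" "e \<in> E"
      using x TX_sub by (cases x) auto
    then show ?thesis
      using Q_edge[of e i] x by (simp add: Q_mod)
  qed
  note Q_cover = rooted_tree_propagate[OF TX, of "\<lambda>x. Q (fst x) (snd x)", OF this]
  have "\<psi> \<one>\<^bsub>G\<^esub> = \<one>\<^bsub>F\<^esub>"
    using hom_one[OF \<Phi>(1) G.group_axioms F.group_wreath] by (simp add: \<psi>_def)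
  then have "Q r 0"
    using g(2) h(2) by (simp add: Q_def)
  then have \<psi>_g: "\<psi> (g v i) = inv\<^bsub>F\<^esub> h i v" if v: "v \<in> V" for v i
    using Q_cover[of "(v, i mod d v)"] Q_mod[OF v, of i] v d_pos[OF v] by (simp add: Q_def)
  \<comment> \<open>Multiplying \<open>\<kappa> x\<close> by its last factor removes the inverse and
    leaves products of two elements, to which \<open>\<psi>_mult\<close> applies. Since
    \<open>\<chi> (\<kappa> x) = 0\<close>, the factor multiplied on is read at level 0, where
    \<open>\<psi>_g\<close> gives its value.\<close>
  have \<psi>_\<kappa>: "\<psi> (\<kappa> x) = dat x" if x: "x \<in> Inl ` cover_verts \<union> Inr ` cover_arcs" for x
    using x
  proof (elim UnE imageE)
    fix z assume z: "x = Inl z" "z \<in> cover_verts"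
    then obtain v i where vi: "x = Inl (v, i)" "v \<in> V" "0 \<le> i" "i < d v"
      by (cases z) auto
    have "\<kappa> x \<otimes>\<^bsub>G\<^esub> g v i = g v i \<otimes>\<^bsub>G\<^esub> bv v"
      using vi g(1) by (simp add: \<kappa>_Inl G.group_normalize)
    then have "\<psi> (\<kappa> x) \<otimes>\<^bsub>F\<^esub> fst (\<Phi> (g v i)) (\<chi> (\<kappa> x)) = \<psi> (g v i) \<otimes>\<^bsub>F\<^esub> fst (\<Phi> (bv v)) (\<chi> (g v i))"
      using vi g(1) \<kappa>(1)[OF x] by (metis \<psi>_mult abv_closed(2))
    then have "\<psi> (\<kappa> x) \<otimes>\<^bsub>F\<^esub> \<psi> (g v i) = \<psi> (g v i) \<otimes>\<^bsub>F\<^esub> fst (\<Phi> (bv v)) i"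
      by (simp only: \<kappa>(2)[OF x] g(3)[OF vi(2)] \<psi>_def)
    also have "\<dots> = \<beta> v i \<otimes>\<^bsub>F\<^esub> \<psi> (g v i)"
      using vi h(1) by (simp add: \<psi>_g bv_def \<Phi>(3) F.group_normalize)
    finally have "\<psi> (\<kappa> x) = \<beta> v i"
      using vi g(1) \<kappa>(1)[OF x] by (simp add: \<psi>_closed)
    then show ?thesis
      using vi by (simp add: \<beta>_def)
  next
    fix z assume z: "x = Inr z" "z \<in> cover_arcs"
    then obtain e i where ei: "x = Inr (e, i)" "e \<in> E" "0 \<le> i" "i < m e"
      by (cases z) auto
    have "\<kappa> x \<otimes>\<^bsub>G\<^esub> g (tgt e) (i + \<tau> e) = g (src e) i \<otimes>\<^bsub>G\<^esub> st e"
      using ei g(1) by (simp add: \<kappa>_Inr G.group_normalize)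
    then have "\<psi> (\<kappa> x) \<otimes>\<^bsub>F\<^esub> fst (\<Phi> (g (tgt e) (i + \<tau> e))) (\<chi> (\<kappa> x)) =
        \<psi> (g (src e) i) \<otimes>\<^bsub>F\<^esub> fst (\<Phi> (st e)) (\<chi> (g (src e) i))"
      using ei g(1) \<kappa>(1)[OF x] by (metis \<psi>_mult st_closed ends_in_V)
    then have "\<psi> (\<kappa> x) \<otimes>\<^bsub>F\<^esub> \<psi> (g (tgt e) (i + \<tau> e)) = \<psi> (g (src e) i) \<otimes>\<^bsub>F\<^esub> fst (\<Phi> (st e)) i"
      by (simp only: \<kappa>(2)[OF x] g(3)[OF ends_in_V(1)[OF ei(2)]] \<psi>_def)
    also have "\<dots> = tt e i \<otimes>\<^bsub>F\<^esub> \<psi> (g (tgt e) (i + \<tau> e))"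
      using ei h(1) by (simp add: \<psi>_g \<Phi>(4) F.group_normalize)
    finally have "\<psi> (\<kappa> x) = tt e i"
      using ei g(1) \<kappa>(1)[OF x] by (simp add: \<psi>_closed)
    then show ?thesis
      using ei by (simp add: tt_def)
  qed

  have ker_\<phi>: "\<chi> (\<phi> f) = 0" if f: "f \<in> carrier F" for f
  proof -
    have "(\<chi> \<circ> \<phi>) f = (\<lambda>_. 0) f"
    proof (rule presented_group_hom_eq[OF group_integer_group, of _ "{..<n}" "{}"])
      show "\<chi> \<circ> \<phi> \<in> hom (presented_group {..<n} {}) integer_group"
        using hom_compose[OF \<phi>(1) \<chi>_hom] by (simp add: free_group_def)
      show "(\<chi> \<circ> \<phi>) (gen_class {..<n} {} k) = 0" if "k \<in> {..<n}" for k
        using that \<phi>(2) \<kappa>(2)[OF basis_sub[OF inv_\<nu>]] by simp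
    qed (use f in \<open>auto simp: free_group_def hom_def\<close>)
    then show ?thesis by simp
  qed
  have \<psi>\<phi>: "\<psi> (\<phi> f) = f" if f: "f \<in> carrier F" for f
  proof -
    have "(\<psi> \<circ> \<phi>) f = (\<lambda>f. f) f"
    proof (rule presented_group_hom_eq[of F _ "{..<n}" "{}"])
      show "\<psi> \<circ> \<phi> \<in> hom (presented_group {..<n} {}) F"
        unfolding free_group_def[symmetric]
      proof (rule homI)
        show "(\<psi> \<circ> \<phi>) (f \<otimes>\<^bsub>F\<^esub> f') = (\<psi> \<circ> \<phi>) f \<otimes>\<^bsub>F\<^esub> (\<psi> \<circ> \<phi>) f'"
          if "f \<in> carrier F" "f' \<in> carrier F" for f f'
          using that by (simp add: \<psi>_mult ker_\<phi> flip: \<psi>_def)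
      qed (simp add: \<psi>_closed)
      show "(\<psi> \<circ> \<phi>) (gen_class {..<n} {} k) = gen_class {..<n} {} k" if k: "k \<in> {..<n}" for k
      proof -
        have "\<nu> (inv_into basis_index \<nu> k) = k"
          using k by (rule bij_betw_inv_into_right[OF \<nu>])
        then show ?thesis
          using k inv_\<nu>[of k] \<phi>(2)[of k] \<psi>_\<kappa>[OF basis_sub, OF inv_\<nu>, of k] by (simp add: dat_def)
      qed
    qed (use f in \<open>auto simp: free_group_def hom_def group_presented_group\<close>)
    then show ?thesis by simp
  qed
  show ?thesis
  proof (rule free_by_cyclicI[OF G.group_axioms \<chi>_hom s \<phi>(1)])
    show "inj_on \<phi> (carrier F)"
      using \<psi>\<phi> by (rule inj_on_inverseI)
    show "\<phi> ` carrier F = {x \<in> carrier G. \<chi> x = 0}"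
    proof (intro equalityI subsetI)
      fix x assume x: "x \<in> {x \<in> carrier G. \<chi> x = 0}"
      then have "\<phi> (\<psi> x) = x"
        using \<phi>\<Phi>[of x 0] g(2) by (simp add: \<psi>_def)
      with x \<psi>_closed show "x \<in> \<phi> ` carrier F"
        by (metis (no_types, lifting) imageI mem_Collect_eq)
    qed (use ker_\<phi> in auto)
  qed
qed

end

section \<open>Assembling the data for a given character\<close>

context tubular_group
begin

lemma free_by_cyclic_if_nonzero:
  assumes "\<chi>0 \<in> hom G integer_group" "\<forall>e\<in>E. nonzero_on_edge_group \<G> T \<chi>0 e"
  shows "free_by_cyclic G"
proof -
  obtain \<chi> s where \<chi>: "\<chi> \<in> hom G integer_group" "s \<in> carrier G" "\<chi> s = 1"
    "\<And>v. v \<in> V \<Longrightarrow> \<exists>x\<in>carrier (vertex_group \<G> v). \<chi> (vx v x) \<noteq> 0"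
    "\<And>e. e \<in> E \<Longrightarrow> nonzero_on_edge_group \<G> T \<chi> e"
    using good_character_exists[OF assms] by blast
  interpret \<chi>: group_hom G integer_group \<chi>
    by (intro group_hom.intro group_hom_axioms.intro G.group_axioms group_integer_group \<chi>(1))
  obtain r where r: "r \<in> V"
    using V_nonempty by blast
  have "\<forall>v\<in>V. \<exists>d a b y. d > 0 \<and> a \<in> carrier (vertex_group \<G> v) \<and> b \<in> carrier (vertex_group \<G> v) \<and>
    \<chi> (vx v a) = d \<and> \<chi> (vx v b) = 0 \<and> y \<in> hom (vertex_group \<G> v) integer_group \<and> y a = 0 \<and> y b = 1 \<and>
    (\<forall>x\<in>carrier (vertex_group \<G> v). \<exists>k. \<chi> (vx v x) = d * k \<and>
      x = a [^]\<^bsub>vertex_group \<G> v\<^esub> (k::int) \<otimes>\<^bsub>vertex_group \<G> v\<^esub> b [^]\<^bsub>vertex_group \<G> v\<^esub> (y x :: int))"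
  proof
    fix v assume v: "v \<in> V"
    have "\<exists>x\<in>carrier (vertex_group \<G> v). (\<chi> \<circ> vx v) x \<noteq> 0"
      using \<chi>(4)[OF v] by simp
    from vertex_basis_exists[OF v hom_compose[OF vx_hom[OF v] \<chi>(1)] this]
    show "\<exists>d a b y. d > 0 \<and> a \<in> carrier (vertex_group \<G> v) \<and> b \<in> carrier (vertex_group \<G> v) \<and>
      \<chi> (vx v a) = d \<and> \<chi> (vx v b) = 0 \<and> y \<in> hom (vertex_group \<G> v) integer_group \<and> y a = 0 \<and> y b = 1 \<and>
      (\<forall>x\<in>carrier (vertex_group \<G> v). \<exists>k. \<chi> (vx v x) = d * k \<and>
        x = a [^]\<^bsub>vertex_group \<G> v\<^esub> (k::int) \<otimes>\<^bsub>vertex_group \<G> v\<^esub> b [^]\<^bsub>vertex_group \<G> v\<^esub> (y x :: int))"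
      by (simp only: comp_apply)
  qed
  then obtain d a b y where vertex: "\<forall>v\<in>V. d v > 0 \<and> a v \<in> carrier (vertex_group \<G> v) \<and>
    b v \<in> carrier (vertex_group \<G> v) \<and> \<chi> (vx v (a v)) = d v \<and> \<chi> (vx v (b v)) = 0 \<and>
    y v \<in> hom (vertex_group \<G> v) integer_group \<and> y v (a v) = 0 \<and> y v (b v) = 1 \<and>
    (\<forall>x\<in>carrier (vertex_group \<G> v). \<exists>k. \<chi> (vx v x) = d v * k \<and>
      x = a v [^]\<^bsub>vertex_group \<G> v\<^esub> (k::int) \<otimes>\<^bsub>vertex_group \<G> v\<^esub> b v [^]\<^bsub>vertex_group \<G> v\<^esub> (y v x :: int))"
    by (simp only: bchoice_iff) blast
  have "\<exists>c. c \<in> carrier (edge_group \<G> e) \<and>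
      (\<forall>x\<in>carrier (edge_group \<G> e). \<exists>k::int. x = c [^]\<^bsub>edge_group \<G> e\<^esub> k) \<and>
      \<chi> (vx (src e) (tail_map \<G> e c)) > 0" if e: "e \<in> E" for e
  proof -
    interpret C: group "edge_group \<G> e"
      using e by (rule group_edge_group)
    obtain c where c: "c \<in> carrier (edge_group \<G> e)"
      "\<And>x. x \<in> carrier (edge_group \<G> e) \<Longrightarrow> \<exists>n::int. x = c [^]\<^bsub>edge_group \<G> e\<^esub> n"
      using edge_generator_exists[OF e] by blast
    define f where "f x = \<chi> (vx (src e) (tail_map \<G> e x))" for x
    have f: "f \<in> hom (edge_group \<G> e) integer_group"
      using hom_compose[OF hom_compose[OF tail_map_hom[OF e] vx_hom[OF ends_in_V(1)[OF e]]] \<chi>(1)]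
      by (simp add: f_def[abs_def] comp_def)
    have pow: "f (c [^]\<^bsub>edge_group \<G> e\<^esub> k) = k * f c" for k :: int
      using hom_int_pow[OF f c(1) C.group_axioms group_integer_group, of k] by simp
    obtain x where x: "x \<in> carrier (edge_group \<G> e)" "f x \<noteq> 0"
      using \<chi>(5)[OF e] by (auto simp: nonzero_iff f_def)
    then have "f c \<noteq> 0"
      using c(2)[OF x(1)] pow by auto
    show ?thesis
    proof (cases "f c > 0")
      case True
      then show ?thesis
        using c by (auto simp: f_def)
    next
      \<comment> \<open>The inverse generator is taken, so that the value \<open>m e\<close> is
        positive and can count the edges over \<open>e\<close>.\<close>
      case False
      have "f (inv\<^bsub>edge_group \<G> e\<^esub> c) = - f c"
        using pow[of "- 1"] c(1) by (simp add: C.int_pow_neg)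
      then have "f (inv\<^bsub>edge_group \<G> e\<^esub> c) > 0"
        using False \<open>f c \<noteq> 0\<close> by simp
      moreover have "\<exists>k::int. x = (inv\<^bsub>edge_group \<G> e\<^esub> c) [^]\<^bsub>edge_group \<G> e\<^esub> k"
        if x: "x \<in> carrier (edge_group \<G> e)" for x
      proof -
        obtain k :: int where "x = c [^]\<^bsub>edge_group \<G> e\<^esub> k"
          using c(2)[OF x] by blast
        then have "x = (inv\<^bsub>edge_group \<G> e\<^esub> c) [^]\<^bsub>edge_group \<G> e\<^esub> (- k)"
          using c(1) by (simp add: C.int_pow_neg C.int_pow_inv)
        then show ?thesis
          by blast
      qed
      ultimately show ?thesis
        using c(1) unfolding f_def by (intro exI[of _ "inv\<^bsub>edge_group \<G> e\<^esub> c"]) auto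
    qed
  qed
  then obtain c where edge: "\<forall>e\<in>E. c e \<in> carrier (edge_group \<G> e) \<and>
      (\<forall>x\<in>carrier (edge_group \<G> e). \<exists>k::int. x = c e [^]\<^bsub>edge_group \<G> e\<^esub> k) \<and>
      \<chi> (vx (src e) (tail_map \<G> e (c e))) > 0"
    by metis
  interpret tubular_character \<G> T \<chi> s r d a b y c
    by unfold_locales (use \<chi> r vertex edge in blast)+
  obtain TX where TX: "rooted_tree cover_src cover_tgt cover_arcs (r, 0) cover_verts TX"
    by (rule cover_tree_exists)
  have "finite (Inl ` cover_verts \<union> Inr ` (cover_arcs - TX))"
    by simp
  then obtain \<nu> and n :: nat where \<nu>: "bij_betw \<nu> (Inl ` cover_verts \<union> Inr ` (cover_arcs - TX)) {..<n}"
    using ex_bij_betw_finite_nat unfolding atLeast0LessThan by blast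
  interpret tubular_cover \<G> T \<chi> s r d a b y c TX \<nu> n
    by unfold_locales (fact TX \<nu>)+
  show ?thesis
    by (rule free_by_cyclic_if_cover)
qed

end

theorem theorem2p1:
  fixes \<G> :: "('v, 'e, 'g, 'h) graph_of_groups" and T :: "('v, 'e) pre_digraph"
  assumes "tubular_graph_of_groups \<G>"
    and "maximal_tree T (base_graph \<G>)"
  shows "free_by_cyclic (fundamental_group \<G> T) \<longleftrightarrow>
    (\<exists>\<chi> \<in> hom (fundamental_group \<G> T) integer_group.
      \<forall>e \<in> arcs (base_graph \<G>). nonzero_on_edge_group \<G> T \<chi> e)"
proof -
  interpret tubular_group \<G> T
    using assms by (simp add: tubular_group_def tubular_group_axioms_def)
  show ?thesis
    using nonzero_if_free_by_cyclic free_by_cyclic_if_nonzero by blast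
qed

end
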